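(* Let $(\mathcal B,\otimes,\mathbb 1)$ be a braided monoidal category with a twist $\theta$, let $H$ be a Hopf algebra in $\mathcal B$, and let $(\delta,\sigma)$ be a $\theta$-twisted modular pair in involution for $H$. Then for all $n\in\mathbb N$, $$(\tau_n(\delta,\sigma))^{n+1}=\theta_{H^{\otimes n}}.$$
   Context: Associativity and unit constraints are suppressed; $H^{\otimes0}=\mathbb 1$; $\mathbb N$ contains $0$. The braiding $c=\{c_{X,Y}\colon X\otimes Y\to Y\otimes X\}$ satisfies $c_{X,Y\otimes Z}=(\mathrm{id}_Y\otimes c_{X,Z})(c_{X,Y}\otimes\mathrm{id}_Z)$ and $c_{X\otimes Y,Z}=(c_{X,Z}\otimes\mathrm{id}_Y)(\mathrm{id}_X\otimes c_{Y,Z})$. A twist for $\mathcal B$ is a natural isomorphism $\theta=\{\theta_X\colon X\to X\}$ with $\theta_{X\otimes Y}=(\theta_X\otimes\theta_Y)c_{Y,X}c_{X,Y}$ for all objects $X,Y$ (hence $\theta_{\mathbb 1}=\mathrm{id}_{\mathbb 1}$). A Hopf algebra in $\mathcal B$ is $(H,m,u,\Delta,\varepsilon,S)$ where $(H,m,u)$ is an algebra and $(H,\Delta,\varepsilon)$ a coalgebra in $\mathcal B$, $\Delta m=(m\otimes m)(\mathrm{id}_H\otimes c_{H,H}\otimes\mathrm{id}_H)(\Delta\otimes\Delta)$, $\Delta u=u\otimes u$, $\varepsilon m=\varepsilon\otimes\varepsilon$, $\varepsilon u=\mathrm{id}_{\mathbb 1}$, and $S\colon H\to H$ is an isomorphism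 with $m(S\otimes\mathrm{id}_H)\Delta=u\varepsilon=m(\mathrm{id}_H\otimes S)\Delta$. A modular pair for $H$ is a pair $(\delta,\sigma)$ with $\delta\colon H\to\mathbb 1$ an algebra morphism and $\sigma\colon\mathbb 1\to H$ a coalgebra morphism such that $\delta\sigma=\mathrm{id}_{\mathbb 1}$. It is a $\theta$-twisted modular pair in involution if $$S^2=m(m\otimes\mathrm{id}_H)(\sigma\otimes\theta_H\otimes S\sigma)\circ(\delta S\otimes\mathrm{id}_H\otimes\delta)(\Delta\otimes\mathrm{id}_H)\Delta .$$ The left diagonal action $\lambda_n\colon H\otimes H^{\otimes n}\to H^{\otimes n}$ is defined by $\lambda_0=\varepsilon$ and $\lambda_n=(m\otimes\lambda_{n-1})(\mathrm{id}_H\otimes c_{H,H}\otimes\mathrm{id}_{H^{\otimes n-1}})(\Delta\otimes\mathrm{id}_{H^{\otimes n}})$ for $n\ge1$. With $\tilde S=(\delta\otimes S)\Delta$, the paracocyclic operators are $\tau_0(\delta,\sigma)=\mathrm{id}_{\mathbb 1}$ and $\tau_n(\delta,\sigma)=\lambda_n(\tilde S\otimes\mathrm{id}_{H^{\otimes n-1}}\otimes\sigma)\colon H^{\otimes n}\to H^{\otimes n}$ for $n\ge1$. *)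

theory Defs
  imports Main
begin

text \<open>
  Monoidal categories are not assumed to be strict: the associativity and unit constraints that
  are suppressed on paper are written out.  Every formula below reduces to the usual one when all
  constraints are identities.
\<close>

record ('o, 'm) category =
  Obj :: "'o set"
  Arr :: "'m set"
  Dom :: "'m \<Rightarrow> 'o"
  Cod :: "'m \<Rightarrow> 'o"
  Id :: "'o \<Rightarrow> 'm"
  comp :: "'m \<Rightarrow> 'm \<Rightarrow> 'm"  (infixr "\<cdot>\<index>" 70)

record ('o, 'm) monoidal = "('o, 'm) category" +
  tensor_obj :: "'o \<Rightarrow> 'o \<Rightarrow> 'o"  (infixr "\<otimes>\<^sub>o\<index>" 75)
  tensor :: "'m \<Rightarrow> 'm \<Rightarrow> 'm"  (infixr "\<otimes>\<index>" 75)
  unit_obj :: "'o"  ("\<one>\<index>")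
  assoc :: "'o \<Rightarrow> 'o \<Rightarrow> 'o \<Rightarrow> 'm"
  lunit :: "'o \<Rightarrow> 'm"
  runit :: "'o \<Rightarrow> 'm"

record ('o, 'm) braided = "('o, 'm) monoidal" +
  braid :: "'o \<Rightarrow> 'o \<Rightarrow> 'm"

definition hom :: "('o, 'm, 'z) category_scheme \<Rightarrow> 'o \<Rightarrow> 'o \<Rightarrow> 'm set" where
  "hom B X Y = {f \<in> Arr B. Dom B f = X \<and> Cod B f = Y}"

definition inverse_arrows :: "('o, 'm, 'z) category_scheme \<Rightarrow> 'm \<Rightarrow> 'm \<Rightarrow> bool" where
  "inverse_arrows B f g \<longleftrightarrow>
     f \<in> hom B (Dom B f) (Cod B f) \<and> g \<in> hom B (Cod B f) (Dom B f) \<and>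
     g \<cdot>\<^bsub>B\<^esub> f = Id B (Dom B f) \<and> f \<cdot>\<^bsub>B\<^esub> g = Id B (Cod B f)"

definition iso :: "('o, 'm, 'z) category_scheme \<Rightarrow> 'm \<Rightarrow> bool" where
  "iso B f \<longleftrightarrow> (\<exists>g. inverse_arrows B f g)"

definition inv_arr :: "('o, 'm, 'z) category_scheme \<Rightarrow> 'm \<Rightarrow> 'm" where
  "inv_arr B f = (THE g. inverse_arrows B f g)"

primrec arr_pow :: "('o, 'm, 'z) category_scheme \<Rightarrow> 'm \<Rightarrow> nat \<Rightarrow> 'm" where
  "arr_pow B f 0 = Id B (Dom B f)"
| "arr_pow B f (Suc k) = f \<cdot>\<^bsub>B\<^esub> arr_pow B f k"

locale category =
  fixes B :: "('o, 'm, 'z) category_scheme" (structure)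
  assumes Dom_Obj: "f \<in> Arr B \<Longrightarrow> Dom B f \<in> Obj B"
    and Cod_Obj: "f \<in> Arr B \<Longrightarrow> Cod B f \<in> Obj B"
    and Id_hom: "X \<in> Obj B \<Longrightarrow> Id B X \<in> hom B X X"
    and comp_hom: "\<lbrakk>f \<in> hom B X Y; g \<in> hom B Y Z\<rbrakk> \<Longrightarrow> g \<cdot> f \<in> hom B X Z"
    and comp_Id_left: "f \<in> hom B X Y \<Longrightarrow> Id B Y \<cdot> f = f"
    and comp_Id_right: "f \<in> hom B X Y \<Longrightarrow> f \<cdot> Id B X = f"
    and comp_assoc: "\<lbrakk>f \<in> hom B W X; g \<in> hom B X Y; h \<in> hom B Y Z\<rbrakk>
          \<Longrightarrow> (h \<cdot> g) \<cdot> f = h \<cdot> (g \<cdot> f)"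

locale monoidal_category = category B
  for B :: "('o, 'm, 'z) monoidal_scheme" (structure) +
  assumes unit_Obj: "\<one> \<in> Obj B"
    and tensor_Obj: "\<lbrakk>X \<in> Obj B; Y \<in> Obj B\<rbrakk> \<Longrightarrow> X \<otimes>\<^sub>o Y \<in> Obj B"
    and tensor_hom: "\<lbrakk>f \<in> hom B X X'; g \<in> hom B Y Y'\<rbrakk>
          \<Longrightarrow> f \<otimes> g \<in> hom B (X \<otimes>\<^sub>o Y) (X' \<otimes>\<^sub>o Y')"
    and tensor_Id: "\<lbrakk>X \<in> Obj B; Y \<in> Obj B\<rbrakk> \<Longrightarrow> Id B X \<otimes> Id B Y = Id B (X \<otimes>\<^sub>o Y)"
    and tensor_comp: "\<lbrakk>f \<in> hom B X X'; f' \<in> hom B X' X''; g \<in> hom B Y Y'; g' \<in> hom B Y' Y''\<rbrakk>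
          \<Longrightarrow> (f' \<cdot> f) \<otimes> (g' \<cdot> g) = (f' \<otimes> g') \<cdot> (f \<otimes> g)"
    and assoc_hom: "\<lbrakk>X \<in> Obj B; Y \<in> Obj B; Z \<in> Obj B\<rbrakk>
          \<Longrightarrow> assoc B X Y Z \<in> hom B ((X \<otimes>\<^sub>o Y) \<otimes>\<^sub>o Z) (X \<otimes>\<^sub>o (Y \<otimes>\<^sub>o Z))"
    and assoc_iso: "\<lbrakk>X \<in> Obj B; Y \<in> Obj B; Z \<in> Obj B\<rbrakk> \<Longrightarrow> iso B (assoc B X Y Z)"
    and assoc_natural: "\<lbrakk>f \<in> hom B X X'; g \<in> hom B Y Y'; h \<in> hom B Z Z'\<rbrakk>
          \<Longrightarrow> assoc B X' Y' Z' \<cdot> ((f \<otimes> g) \<otimes> h) = (f \<otimes> (g \<otimes> h)) \<cdot> assoc B X Y Z"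
    and lunit_hom: "X \<in> Obj B \<Longrightarrow> lunit B X \<in> hom B (\<one> \<otimes>\<^sub>o X) X"
    and lunit_iso: "X \<in> Obj B \<Longrightarrow> iso B (lunit B X)"
    and lunit_natural: "f \<in> hom B X Y \<Longrightarrow> lunit B Y \<cdot> (Id B \<one> \<otimes> f) = f \<cdot> lunit B X"
    and runit_hom: "X \<in> Obj B \<Longrightarrow> runit B X \<in> hom B (X \<otimes>\<^sub>o \<one>) X"
    and runit_iso: "X \<in> Obj B \<Longrightarrow> iso B (runit B X)"
    and runit_natural: "f \<in> hom B X Y \<Longrightarrow> runit B Y \<cdot> (f \<otimes> Id B \<one>) = f \<cdot> runit B X"
    and pentagon: "\<lbrakk>W \<in> Obj B; X \<in> Obj B; Y \<in> Obj B; Z \<in> Obj B\<rbrakk>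
          \<Longrightarrow> (Id B W \<otimes> assoc B X Y Z) \<cdot> assoc B W (X \<otimes>\<^sub>o Y) Z \<cdot> (assoc B W X Y \<otimes> Id B Z)
            = assoc B W X (Y \<otimes>\<^sub>o Z) \<cdot> assoc B (W \<otimes>\<^sub>o X) Y Z"
    and triangle: "\<lbrakk>X \<in> Obj B; Y \<in> Obj B\<rbrakk>
          \<Longrightarrow> (Id B X \<otimes> lunit B Y) \<cdot> assoc B X \<one> Y = runit B X \<otimes> Id B Y"

locale braided_monoidal_category = monoidal_category B
  for B :: "('o, 'm, 'z) braided_scheme" (structure) +
  assumes braid_hom: "\<lbrakk>X \<in> Obj B; Y \<in> Obj B\<rbrakk> \<Longrightarrow> braid B X Y \<in> hom B (X \<otimes>\<^sub>o Y) (Y \<otimes>\<^sub>o X)"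
    and braid_iso: "\<lbrakk>X \<in> Obj B; Y \<in> Obj B\<rbrakk> \<Longrightarrow> iso B (braid B X Y)"
    and braid_natural: "\<lbrakk>f \<in> hom B X X'; g \<in> hom B Y Y'\<rbrakk>
          \<Longrightarrow> braid B X' Y' \<cdot> (f \<otimes> g) = (g \<otimes> f) \<cdot> braid B X Y"
    and hexagon_right: "\<lbrakk>X \<in> Obj B; Y \<in> Obj B; Z \<in> Obj B\<rbrakk>
          \<Longrightarrow> assoc B Y Z X \<cdot> braid B X (Y \<otimes>\<^sub>o Z) \<cdot> assoc B X Y Z
            = (Id B Y \<otimes> braid B X Z) \<cdot> assoc B Y X Z \<cdot> (braid B X Y \<otimes> Id B Z)"
    and hexagon_left: "\<lbrakk>X \<in> Obj B; Y \<in> Obj B; Z \<in> Obj B\<rbrakk>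
          \<Longrightarrow> inv_arr B (assoc B Z X Y) \<cdot> braid B (X \<otimes>\<^sub>o Y) Z \<cdot> inv_arr B (assoc B X Y Z)
            = (braid B X Z \<otimes> Id B Y) \<cdot> inv_arr B (assoc B X Z Y) \<cdot> (Id B X \<otimes> braid B Y Z)"

locale twist = braided_monoidal_category B
  for B :: "('o, 'm, 'z) braided_scheme" (structure) +
  fixes \<theta> :: "'o \<Rightarrow> 'm"
  assumes twist_hom: "X \<in> Obj B \<Longrightarrow> \<theta> X \<in> hom B X X"
    and twist_iso: "X \<in> Obj B \<Longrightarrow> iso B (\<theta> X)"
    and twist_natural: "f \<in> hom B X Y \<Longrightarrow> \<theta> Y \<cdot> f = f \<cdot> \<theta> X"
    and twist_tensor: "\<lbrakk>X \<in> Obj B; Y \<in> Obj B\<rbrakk>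
          \<Longrightarrow> \<theta> (X \<otimes>\<^sub>o Y) = (\<theta> X \<otimes> \<theta> Y) \<cdot> braid B Y X \<cdot> braid B X Y"

text \<open>
  \<open>middle_braid B W X Y Z : (W \<otimes> X) \<otimes> (Y \<otimes> Z) \<rightarrow> (W \<otimes> Y) \<otimes> (X \<otimes> Z)\<close> is
  \<open>id\<^sub>W \<otimes> c\<^sub>X\<^sub>,\<^sub>Y \<otimes> id\<^sub>Z\<close>, rebracketed.
\<close>

definition middle_braid ::
    "('o, 'm, 'z) braided_scheme \<Rightarrow> 'o \<Rightarrow> 'o \<Rightarrow> 'o \<Rightarrow> 'o \<Rightarrow> 'm" where
  "middle_braid B W X Y Z =
     inv_arr B (assoc B W Y (X \<otimes>\<^sub>o\<^bsub>B\<^esub> Z))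
     \<cdot>\<^bsub>B\<^esub> (Id B W \<otimes>\<^bsub>B\<^esub>
         (assoc B Y X Z \<cdot>\<^bsub>B\<^esub> (braid B X Y \<otimes>\<^bsub>B\<^esub> Id B Z) \<cdot>\<^bsub>B\<^esub> inv_arr B (assoc B X Y Z)))
     \<cdot>\<^bsub>B\<^esub> assoc B W X (Y \<otimes>\<^sub>o\<^bsub>B\<^esub> Z)"

locale algebra = monoidal_category B
  for B :: "('o, 'm, 'z) monoidal_scheme" (structure) +
  fixes A :: 'o and m u :: 'm
  assumes alg_Obj: "A \<in> Obj B"
    and mult_hom: "m \<in> hom B (A \<otimes>\<^sub>o A) A"
    and unit_hom: "u \<in> hom B \<one> A"
    and mult_assoc: "m \<cdot> (m \<otimes> Id B A) = m \<cdot> (Id B A \<otimes> m) \<cdot> assoc B A A A"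
    and mult_unit_left: "m \<cdot> (u \<otimes> Id B A) = lunit B A"
    and mult_unit_right: "m \<cdot> (Id B A \<otimes> u) = runit B A"

locale coalgebra = monoidal_category B
  for B :: "('o, 'm, 'z) monoidal_scheme" (structure) +
  fixes C :: 'o and \<Delta> \<epsilon> :: 'm
  assumes coalg_Obj: "C \<in> Obj B"
    and comult_hom: "\<Delta> \<in> hom B C (C \<otimes>\<^sub>o C)"
    and counit_hom: "\<epsilon> \<in> hom B C \<one>"
    and comult_coassoc: "assoc B C C C \<cdot> (\<Delta> \<otimes> Id B C) \<cdot> \<Delta> = (Id B C \<otimes> \<Delta>) \<cdot> \<Delta>"
    and comult_counit_left: "lunit B C \<cdot> (\<epsilon> \<otimes> Id B C) \<cdot> \<Delta> = Id B C"
    and comult_counit_right: "runit B C \<cdot> (Id B C \<otimes> \<epsilon>) \<cdot> \<Delta> = Id B C"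

definition algebra_morphism :: "('o, 'm, 'z) monoidal_scheme \<Rightarrow>
    'o \<Rightarrow> 'm \<Rightarrow> 'm \<Rightarrow> 'o \<Rightarrow> 'm \<Rightarrow> 'm \<Rightarrow> 'm \<Rightarrow> bool" where
  "algebra_morphism B A m u A' m' u' f \<longleftrightarrow>
     f \<in> hom B A A' \<and> f \<cdot>\<^bsub>B\<^esub> m = m' \<cdot>\<^bsub>B\<^esub> (f \<otimes>\<^bsub>B\<^esub> f) \<and> f \<cdot>\<^bsub>B\<^esub> u = u'"

definition coalgebra_morphism :: "('o, 'm, 'z) monoidal_scheme \<Rightarrow>
    'o \<Rightarrow> 'm \<Rightarrow> 'm \<Rightarrow> 'o \<Rightarrow> 'm \<Rightarrow> 'm \<Rightarrow> 'm \<Rightarrow> bool" where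
  "coalgebra_morphism B C \<Delta> \<epsilon> C' \<Delta>' \<epsilon>' f \<longleftrightarrow>
     f \<in> hom B C C' \<and> \<Delta>' \<cdot>\<^bsub>B\<^esub> f = (f \<otimes>\<^bsub>B\<^esub> f) \<cdot>\<^bsub>B\<^esub> \<Delta> \<and> \<epsilon>' \<cdot>\<^bsub>B\<^esub> f = \<epsilon>"

record ('o, 'm) hopf_data =
  carr :: "'o"
  mult :: "'m"
  unt :: "'m"
  comult :: "'m"
  counit :: "'m"
  antipode :: "'m"

locale hopf_algebra = braided_monoidal_category B +
    algebra B "carr H" "mult H" "unt H" +
    coalgebra B "carr H" "comult H" "counit H"
  for B :: "('o, 'm, 'z) braided_scheme" (structure)
    and H :: "('o, 'm) hopf_data" +
  assumes comult_mult: "comult H \<cdot> mult H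
        = (mult H \<otimes> mult H) \<cdot> middle_braid B (carr H) (carr H) (carr H) (carr H)
          \<cdot> (comult H \<otimes> comult H)"
    and comult_unit: "comult H \<cdot> unt H = (unt H \<otimes> unt H) \<cdot> inv_arr B (lunit B \<one>)"
    and counit_mult: "counit H \<cdot> mult H = lunit B \<one> \<cdot> (counit H \<otimes> counit H)"
    and counit_unit: "counit H \<cdot> unt H = Id B \<one>"
    and antipode_hom: "antipode H \<in> hom B (carr H) (carr H)"
    and antipode_iso: "iso B (antipode H)"
    and antipode_left:
      "mult H \<cdot> (antipode H \<otimes> Id B (carr H)) \<cdot> comult H = unt H \<cdot> counit H"
    and antipode_right:
      "mult H \<cdot> (Id B (carr H) \<otimes> antipode H) \<cdot> comult H = unt H \<cdot> counit H"

text \<open>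
  The unit object is an algebra with multiplication \<open>lunit B \<one> : \<one> \<otimes> \<one> \<rightarrow> \<one>\<close>, and a
  coalgebra with the inverse of this map as comultiplication.
\<close>

locale modular_pair = hopf_algebra B H
  for B :: "('o, 'm, 'z) braided_scheme" (structure)
    and H :: "('o, 'm) hopf_data" +
  fixes \<delta> \<sigma> :: 'm
  assumes delta_morphism:
      "algebra_morphism B (carr H) (mult H) (unt H) \<one> (lunit B \<one>) (Id B \<one>) \<delta>"
    and sigma_morphism:
      "coalgebra_morphism B \<one> (inv_arr B (lunit B \<one>)) (Id B \<one>)
         (carr H) (comult H) (counit H) \<sigma>"
    and delta_sigma: "\<delta> \<cdot> \<sigma> = Id B \<one>"

text \<open>
  In the involution condition \<open>H \<rightarrow> (\<one> \<otimes> H) \<otimes> \<one> \<rightarrow> H\<close> no constraint needs to be inserted.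
\<close>

locale twisted_modular_pair_in_involution = twist B \<theta> + modular_pair B H \<delta> \<sigma>
  for B :: "('o, 'm, 'z) braided_scheme" (structure)
    and \<theta> :: "'o \<Rightarrow> 'm"
    and H :: "('o, 'm) hopf_data"
    and \<delta> \<sigma> :: 'm +
  assumes involution:
    "antipode H \<cdot> antipode H
     = (mult H \<cdot> (mult H \<otimes> Id B (carr H))
          \<cdot> ((\<sigma> \<otimes> \<theta> (carr H)) \<otimes> (antipode H \<cdot> \<sigma>)))
       \<cdot> (((\<delta> \<cdot> antipode H) \<otimes> Id B (carr H)) \<otimes> \<delta>)
       \<cdot> (comult H \<otimes> Id B (carr H)) \<cdot> comult H"

primrec tensor_pow :: "('o, 'm, 'z) monoidal_scheme \<Rightarrow> 'o \<Rightarrow> nat \<Rightarrow> 'o" where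
  "tensor_pow B X 0 = \<one>\<^bsub>B\<^esub>"
| "tensor_pow B X (Suc n) = X \<otimes>\<^sub>o\<^bsub>B\<^esub> tensor_pow B X n"

text \<open>
  The canonical isomorphism \<open>snoc B X n : X\<^sup>n \<otimes> X \<rightarrow> X\<^sup>n\<^sup>+\<^sup>1\<close> built from constraints only.
\<close>

primrec snoc :: "('o, 'm, 'z) monoidal_scheme \<Rightarrow> 'o \<Rightarrow> nat \<Rightarrow> 'm" where
  "snoc B X 0 = inv_arr B (runit B X) \<cdot>\<^bsub>B\<^esub> lunit B X"
| "snoc B X (Suc n) = (Id B X \<otimes>\<^bsub>B\<^esub> snoc B X n) \<cdot>\<^bsub>B\<^esub> assoc B X (tensor_pow B X n) X"

primrec diag_action :: "('o, 'm, 'z) braided_scheme \<Rightarrow> ('o, 'm) hopf_data \<Rightarrow> nat \<Rightarrow> 'm" where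
  "diag_action B H 0 = counit H \<cdot>\<^bsub>B\<^esub> runit B (carr H)"
| "diag_action B H (Suc n) =
     (mult H \<otimes>\<^bsub>B\<^esub> diag_action B H n)
     \<cdot>\<^bsub>B\<^esub> middle_braid B (carr H) (carr H) (carr H) (tensor_pow B (carr H) n)
     \<cdot>\<^bsub>B\<^esub> (comult H \<otimes>\<^bsub>B\<^esub> Id B (tensor_pow B (carr H) (Suc n)))"

definition twisted_antipode ::
    "('o, 'm, 'z) braided_scheme \<Rightarrow> ('o, 'm) hopf_data \<Rightarrow> 'm \<Rightarrow> 'm" where
  "twisted_antipode B H \<delta> =
     lunit B (carr H) \<cdot>\<^bsub>B\<^esub> (\<delta> \<otimes>\<^bsub>B\<^esub> antipode H) \<cdot>\<^bsub>B\<^esub> comult H"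

primrec paracocyclic ::
    "('o, 'm, 'z) braided_scheme \<Rightarrow> ('o, 'm) hopf_data \<Rightarrow> 'm \<Rightarrow> 'm \<Rightarrow> nat \<Rightarrow> 'm" where
  "paracocyclic B H \<delta> \<sigma> 0 = Id B \<one>\<^bsub>B\<^esub>"
| "paracocyclic B H \<delta> \<sigma> (Suc n) =
     diag_action B H (Suc n)
     \<cdot>\<^bsub>B\<^esub> (twisted_antipode B H \<delta> \<otimes>\<^bsub>B\<^esub>
         (snoc B (carr H) n
          \<cdot>\<^bsub>B\<^esub> (Id B (tensor_pow B (carr H) n) \<otimes>\<^bsub>B\<^esub> \<sigma>)
          \<cdot>\<^bsub>B\<^esub> inv_arr B (runit B (tensor_pow B (carr H) n))))"

end

theory Submission
  imports Defs
begin

text \<open>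
  Write \<open>\<lambda>\<close> for the diagonal action and \<open>S'\<close> for the twisted antipode.  The morphism
  \<open>\<pi>\<^sub>n = \<lambda>\<^sub>n (S' \<otimes> id) : H\<^sup>n\<^sup>+\<^sup>1 \<rightarrow> H\<^sup>n\<close> is split by the unit of \<open>H\<close>.  It absorbs the diagonal action,
  \<open>\<pi>\<^sub>n \<lambda>\<^sub>n\<^sub>+\<^sub>1 = \<delta> \<otimes> \<pi>\<^sub>n\<close>, because \<open>S'\<close> is anti-multiplicative and \<open>m (S' \<otimes> id) \<Delta> = u \<delta>\<close>.
  The involution condition says \<open>m (S' S' \<otimes> \<sigma>) = m (\<sigma> \<otimes> \<theta>\<^sub>H)\<close>, and it gives \<open>\<tau>\<^sub>n \<pi>\<^sub>n = \<pi>\<^sub>n \<rho>\<^sub>n\<close>, where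
  \<open>\<rho>\<^sub>n\<close> braids the first of the \<open>n + 1\<close> tensor factors past the others, twists it and multiplies it by
  \<open>\<sigma>\<close> from the left.  In \<open>\<rho>\<^sub>n\<^sup>n\<^sup>+\<^sup>1\<close> the crossings and twists add up to \<open>\<theta>\<close> of the whole power, and the
  copies of \<open>\<sigma>\<close>, which is group-like, to the diagonal action: \<open>\<rho>\<^sub>n\<^sup>n\<^sup>+\<^sup>1 = \<lambda>\<^sub>n\<^sub>+\<^sub>1 (\<sigma> \<otimes> \<theta>)\<close>.  Hence
  \<open>\<tau>\<^sub>n\<^sup>n\<^sup>+\<^sup>1 \<pi>\<^sub>n = \<pi>\<^sub>n \<lambda>\<^sub>n\<^sub>+\<^sub>1 (\<sigma> \<otimes> \<theta>) = \<delta>\<sigma> \<otimes> \<pi>\<^sub>n \<theta> = \<pi>\<^sub>n \<theta> = \<theta> \<pi>\<^sub>n\<close>, and \<open>\<pi>\<^sub>n\<close> can be cancelled.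
\<close>

section \<open>Diagrams on infinitely many strands\<close>

text \<open>The obstacle is bookkeeping: composition is partial, the category is not strict, and the
  argument is a long chain of regroupings. So the computation is done with strand diagrams, where
  the axioms are rewrite rules free of typing conditions and constraints; the category enters only
  as a model of these rules. The model avoids most constraints because powers of H with a free tail
  are nested to the right: they appear only where a structure morphism, with at most two legs on
  either side, is put next to its tail. Since the row of strands is unbounded, a morphism must be
  extended to become a point: the identity of H^n is padded by units, and surplus strands are
  discarded by the counit, a retraction of the unit. Evaluation at this point gives the equality of
  morphisms. To cancel \<open>Pi\<close>, its section is inserted at the start: \<tau> is iterated
  on \<open>Pi (U x)\<close>. Naturality of \<theta> is used only after evaluation, in the
  category.\<close>

primrec cross_right :: "(nat \<Rightarrow> 'e \<Rightarrow> 'e) \<Rightarrow> nat \<Rightarrow> nat \<Rightarrow> 'e \<Rightarrow> 'e" where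
  "cross_right C 0 i x = x"
| "cross_right C (Suc n) i x = cross_right C n (Suc i) (C i x)"

primrec cross_left :: "(nat \<Rightarrow> 'e \<Rightarrow> 'e) \<Rightarrow> nat \<Rightarrow> nat \<Rightarrow> 'e \<Rightarrow> 'e" where
  "cross_left C 0 i x = x"
| "cross_left C (Suc n) i x = C i (cross_left C n (Suc i) x)"

text \<open>
  A diagram with \<open>n\<close> inputs and \<open>m\<close> outputs is modelled by its insertions \<open>F i\<close> into an unbounded row
  of strands: \<open>F i\<close> replaces the strands \<open>i, \<dots>, i + n - 1\<close> by \<open>m\<close> new ones and renumbers the strands to
  the right.  A point \<open>x\<close> stands for a morphism into the row, and \<open>F i x\<close> for postcomposition, so that
  equations between diagrams become unconditional equations between nested applications.
  The diagrams \<open>cross_right C n i\<close> and \<open>cross_left C n i\<close> braid one strand past \<open>n\<close> others, from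
  position \<open>i\<close> to \<open>i + n\<close> and back.
\<close>

locale strand_calculus =
  fixes gens :: "(nat \<times> nat \<times> (nat \<Rightarrow> 'e \<Rightarrow> 'e)) set"
    and C :: "nat \<Rightarrow> 'e \<Rightarrow> 'e"
  assumes C_gen: "(2, 2, C) \<in> gens"
    and gen_slide: "\<lbrakk>(n, m, F) \<in> gens; (p, q, G) \<in> gens\<rbrakk>
          \<Longrightarrow> F i (G (i + n + k) x) = G (i + m + k) (F i x)"
    and gen_cross_right: "(n, m, F) \<in> gens
          \<Longrightarrow> cross_right C m i (F (Suc i) x) = F i (cross_right C n i x)"
    and gen_cross_left: "(n, m, F) \<in> gens
          \<Longrightarrow> cross_left C m i (F i x) = F (Suc i) (cross_left C n i x)"
begin

abbreviation Cr where "Cr \<equiv> cross_right C"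
abbreviation Cl where "Cl \<equiv> cross_left C"

text \<open>Arities are not determined by the diagram: idle strands may be added on both sides, and
  only those on the left shift the index. As \<open>C\<close> is itself a generator,
  \<open>gen_cross_right\<close> for \<open>C\<close> is the braid relation.\<close>

inductive diag :: "nat \<Rightarrow> nat \<Rightarrow> (nat \<Rightarrow> 'e \<Rightarrow> 'e) \<Rightarrow> bool" where
  gen: "(n, m, F) \<in> gens \<Longrightarrow> diag n m F"
| idle: "diag n n (\<lambda>i x. x)"
| comp: "\<lbrakk>diag n m F; diag m p G\<rbrakk> \<Longrightarrow> diag n p (\<lambda>i x. G i (F i x))"
| whisker: "diag n m F \<Longrightarrow> diag (a + n + b) (a + m + b) (\<lambda>i. F (i + a))"

lemma whisker': "\<lbrakk>diag n m F; N = a + n + b; M = a + m + b\<rbrakk> \<Longrightarrow> diag N M (\<lambda>i. F (i + a))"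
  using whisker by blast

lemma pad: "\<lbrakk>diag n m F; N = n + b; M = m + b\<rbrakk> \<Longrightarrow> diag N M F"
  using whisker'[of n m F N 0 b M] by simp

lemma shift:
  assumes "diag n m F" and "n \<le> N" and "N + m = M + n"
  shows "diag (Suc N) (Suc M) (\<lambda>i. F (Suc i))"
proof -
  have "M = m + (N - n)" using assms(2,3) by simp
  then show ?thesis
    using assms(2) whisker'[OF assms(1), of "Suc N" 1 "N - n" "Suc M"] by simp
qed

text \<open>The assumption \<open>gen_slide\<close> compares two generators. Here the left diagram
  becomes arbitrary by induction; \<open>slide_add\<close> then does the same for the right
  one.\<close>

lemma slide_gen:
  assumes "diag n m F" and "(p, q, G) \<in> gens"
  shows "F i (G (i + n + k) x) = G (i + m + k) (F i x)"
  using assms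
proof (induction arbitrary: i k x)
  case (gen n m F)
  then show ?case using gen_slide by blast
next
  case (whisker n m F a b)
  from whisker.IH[of "i + a" "b + k"] whisker.prems show ?case by (simp add: ac_simps)
qed auto

lemma slide_add:
  assumes "diag p q G" and "diag n m F"
  shows "F i (G (i + n + k) x) = G (i + m + k) (F i x)"
  using assms
proof (induction arbitrary: i k x)
  case (gen n m F)
  then show ?case using slide_gen by blast
next
  case (whisker p q G a b)
  from whisker.IH[of i "k + a"] whisker.prems show ?case by (simp add: ac_simps)
qed auto

lemma slide:
  assumes "diag n m F" and "diag p q G" and "i + n \<le> j" and "l + n = j + m"
  shows "F i (G j x) = G l (F i x)"
proof -
  obtain k where j: "j = i + n + k" using assms(3) le_Suc_ex by blast
  then have "l = i + m + k" using assms(4) by simp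
  then show ?thesis using slide_add[OF assms(2,1)] j by simp
qed

text \<open>\<open>left_in\<close> and \<open>right_in\<close> are the two orientations of
  \<open>slide\<close> as rewrite rules: the left, respectively right, of two disjoint diagrams is
  moved inside, so that it is applied earlier. The inequality makes the truncated subtraction
  exact.\<close>

lemma left_in:
  assumes "diag n m F" and "diag p q G" and "i + n \<le> j"
  shows "F i (G j x) = G (j + m - n) (F i x)"
  using slide[OF assms, of "j + m - n"] assms(3) by simp

lemma right_in:
  assumes "diag n m F" and "diag p q G" and "i + m \<le> j"
  shows "G j (F i x) = F i (G (j + n - m) x)"
  using slide[OF assms(1,2), of i "j + n - m" j] assms(3) by simp

lemma C_diag: "diag 2 2 C" using C_gen by (rule gen)

lemma Cr_diag: "diag (Suc n) (Suc n) (Cr n)"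
proof (induction n)
  case 0
  have "Cr 0 = (\<lambda>i x. x)" by (intro ext) simp
  then show ?case using idle by metis
next
  case (Suc n)
  have "diag (Suc (Suc n)) (Suc (Suc n)) (\<lambda>i x. Cr n (Suc i) (C i x))"
    by (rule comp[OF pad[OF C_diag] shift[OF Suc]]) auto
  then show ?case by (metis (no_types, lifting) cross_right.simps(2) ext)
qed

lemma Cl_diag: "diag (Suc n) (Suc n) (Cl n)"
proof (induction n)
  case 0
  have "Cl 0 = (\<lambda>i x. x)" by (intro ext) simp
  then show ?case using idle by metis
next
  case (Suc n)
  have "diag (Suc (Suc n)) (Suc (Suc n)) (\<lambda>i x. C i (Cl n (Suc i) x))"
    by (rule comp[OF shift[OF Suc] pad[OF C_diag]]) auto
  then show ?case by (metis (no_types, lifting) cross_left.simps(2) ext)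
qed

lemma Cr_add: "Cr (a + b) i x = Cr b (i + a) (Cr a i x)"
  by (induction a arbitrary: i x) auto

lemma Cl_add: "Cl (a + b) i x = Cl a i (Cl b (i + a) x)"
  by (induction a arbitrary: i x) auto

lemma Cr_snoc: "Cr (Suc n) i x = C (i + n) (Cr n i x)"
  using Cr_add[of n 1] by simp

lemma Cl_snoc: "Cl (Suc n) i x = Cl n i (C (i + n) x)"
  using Cl_add[of n 1] by simp

text \<open>In the whisker case the crossing of \<open>a + m + b\<close> strands splits into three
  parts: only the middle one meets the diagram, the outer ones slide past it.\<close>

lemma crossR:
  assumes "diag n m F"
  shows "Cr m i (F (Suc i) x) = F i (Cr n i x)"
  using assms
proof (induction arbitrary: i x)
  case (gen n m F)
  then show ?case by (rule gen_cross_right)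
next
  case (whisker n m F a b)
  have "Cr (a + m + b) i (F (Suc i + a) x) = Cr b (i + a + m) (Cr m (i + a) (Cr a i (F (Suc (i + a)) x)))"
    by (simp add: Cr_add add.assoc)
  also have "\<dots> = Cr b (i + a + m) (Cr m (i + a) (F (Suc (i + a)) (Cr a i x)))"
    by (simp add: slide[OF Cr_diag whisker.hyps])
  also have "\<dots> = F (i + a) (Cr b (i + a + n) (Cr n (i + a) (Cr a i x)))"
    by (simp add: whisker.IH slide[OF whisker.hyps Cr_diag, of "i + a" "i + a + n" "i + a + m"])
  finally show ?case by (simp add: Cr_add add.assoc)
qed auto

lemma crossL:
  assumes "diag n m F"
  shows "Cl m i (F i x) = F (Suc i) (Cl n i x)"
  using assms
proof (induction arbitrary: i x)
  case (gen n m F)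
  then show ?case by (rule gen_cross_left)
next
  case (whisker n m F a b)
  have "Cl (a + m + b) i (F (i + a) x) = Cl a i (Cl m (i + a) (Cl b (i + a + m) (F (i + a) x)))"
    by (simp add: Cl_add add.assoc)
  also have "\<dots> = Cl a i (Cl m (i + a) (F (i + a) (Cl b (i + a + n) x)))"
    by (simp add: slide[OF whisker.hyps Cl_diag, of "i + a" "i + a + n" "i + a + m"])
  also have "\<dots> = F (Suc i + a) (Cl a i (Cl n (i + a) (Cl b (i + a + n) x)))"
    by (simp add: whisker.IH slide[OF Cl_diag whisker.hyps])
  finally show ?case by (simp add: Cl_add add.assoc)
qed auto

text \<open>Here the diagram sits on the travelling strand. In a single crossing either strand may
  be regarded as the travelling one, so the left rule yields a right rule and conversely.\<close>

lemma strand_past: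
  assumes "diag 1 1 F"
  shows "Cr n i (F i x) = F (i + n) (Cr n i x)" and "Cl n i (F (i + n) x) = F i (Cl n i x)"
proof -
  have "C i (F i x) = F (Suc i) (C i x)" and "C i (F (Suc i) x) = F i (C i x)" for i x
    using crossL[OF assms, of i x] crossR[OF assms, of i x] by simp_all
  then show "Cr n i (F i x) = F (i + n) (Cr n i x)" and "Cl n i (F (i + n) x) = F i (Cl n i x)"
    by (induction n arbitrary: i x) (auto simp flip: add_Suc)
qed

end

section \<open>Hopf algebra calculus\<close>

text \<open>
  The letters stand for multiplication, unit, comultiplication, counit, antipode, \<open>\<delta>\<close>, \<open>\<sigma>\<close> and the
  twist of a single strand.
\<close>

locale hopf_strands = strand_calculus gens C
  for gens :: "(nat \<times> nat \<times> (nat \<Rightarrow> 'e \<Rightarrow> 'e)) set" and C +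
  fixes M U D E S d s Th :: "nat \<Rightarrow> 'e \<Rightarrow> 'e"
  assumes gens: "(Suc (Suc 0), Suc 0, M) \<in> gens" "(0, Suc 0, U) \<in> gens"
      "(Suc 0, Suc (Suc 0), D) \<in> gens" "(Suc 0, 0, E) \<in> gens" "(Suc 0, Suc 0, S) \<in> gens"
      "(Suc 0, 0, d) \<in> gens" "(0, Suc 0, s) \<in> gens" "(Suc 0, Suc 0, Th) \<in> gens"
    and M_assoc: "M i (M (Suc i) x) = M i (M i x)"
    and M_U_left [simp]: "M i (U i x) = x"
    and M_U_right [simp]: "M i (U (Suc i) x) = x"
    and D_coassoc: "D (Suc i) (D i x) = D i (D i x)"
    and E_D_left [simp]: "E i (D i x) = x"
    and E_D_right [simp]: "E (Suc i) (D i x) = x"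
    and D_M: "D i (M i x) = M (Suc i) (M i (C (Suc i) (D i (D (Suc i) x))))"
    and D_U: "D i (U i x) = U i (U i x)"
    and E_M: "E i (M i x) = E i (E i x)"
    and E_U [simp]: "E i (U i x) = x"
    and M_S_left: "M i (S i (D i x)) = U i (E i x)"
    and M_S_right: "M i (S (Suc i) (D i x)) = U i (E i x)"
    and d_M: "d i (M i x) = d i (d i x)"
    and d_U [simp]: "d i (U i x) = x"
    and D_s: "D i (s i x) = s i (s i x)"
    and E_s [simp]: "E i (s i x) = x"
    and d_s [simp]: "d i (s i x) = x"
    and S_S: "S i (S i x) = M i (M i (S (Suc (Suc i)) (s (Suc (Suc i)) (s i (Th i
          (d i (S i (d (Suc (Suc i)) (D i (D i x)))))))))) "
begin

lemmas dg = gens[THEN gen]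
lemmas M_dg = dg(1) and U_dg = dg(2) and D_dg = dg(3) and E_dg = dg(4) and S_dg = dg(5)
  and d_dg = dg(6) and s_dg = dg(7) and Th_dg = dg(8)

lemma C_dg: "diag (Suc (Suc 0)) (Suc (Suc 0)) C"
  using C_diag by (simp add: numeral_2_eq_2)

lemma C_C_D: "C i (C (Suc i) (D i x)) = D (Suc i) (C i x)"
  using crossL[OF D_dg, of i x] by simp

lemma C_C_D': "C (Suc i) (C i (D (Suc i) x)) = D i (C i x)"
  using crossR[OF D_dg, of i x] by simp

text \<open>Naturality of the braiding for a diagram without outputs: crossing zero strands is the
  identity.\<close>

lemma C_erase:
  assumes "diag (Suc 0) 0 F"
  shows "F i (C i x) = F (Suc i) x" and "F (Suc i) (C i x) = F i x"
  using crossR[OF assms, of i x] crossL[OF assms, of i x] by simp_all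

lemma C_single:
  assumes "diag (Suc 0) (Suc 0) F"
  shows "C i (F i x) = F (Suc i) (C i x)" and "C i (F (Suc i) x) = F i (C i x)"
  using crossR[OF assms, of i x] crossL[OF assms, of i x] by simp_all

text \<open>
  \<open>W\<close> is the comultiplication of \<open>H \<otimes> H\<close>, and \<open>R\<close> the opposite product of antipodes, the candidate for
  the convolution inverse of \<open>M\<close>.
\<close>

definition W where "W i x = C (Suc i) (D i (D (Suc i) x))"

lemma W_dg: "diag (Suc (Suc 0)) (Suc (Suc (Suc (Suc 0)))) W"
proof -
  have "diag (Suc (Suc 0)) (Suc (Suc (Suc (Suc 0)))) (\<lambda>i x. C (Suc i) (D i (D (Suc i) x)))"
    by (rule comp[OF comp[OF shift[OF D_dg] pad[OF D_dg]] shift[OF C_dg]]) auto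
  then show ?thesis by (simp add: W_def[abs_def])
qed

lemma E_W_right: "E (Suc (Suc i)) (E (Suc (Suc (Suc i))) (W i x)) = x"
  unfolding W_def
  by (simp add: left_in[OF D_dg E_dg] right_in[OF C_dg E_dg] right_in[OF D_dg E_dg] C_erase[OF E_dg])

lemma E_W_left: "E i (E i (W i x)) = x"
  unfolding W_def
  by (simp add: left_in[OF E_dg C_dg] C_erase[OF E_dg])

text \<open>Moving all comultiplications inside turns both sides into the same four
  comultiplications followed by three crossings, of which two disjoint ones come in different
  order.\<close>

lemma W_coassoc: "W (Suc (Suc i)) (W i x) = W i (W i x)"
proof -
  have "W (Suc (Suc i)) (W i x)
      = C (i + 3) (D (i + 2) (C (Suc i) (D i (D (i + 2) (D (Suc i) x)))))"
    unfolding W_def by (simp add: numeral_eq_Suc right_in[OF C_dg D_dg] right_in[OF D_dg D_dg])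
  also have "\<dots> = C (i + 3) (C (Suc i) (C (i + 2) (D i (D i (D (Suc i) (D (Suc i) x))))))"
    by (simp add: numeral_eq_Suc C_C_D[symmetric] D_coassoc)
  finally have 1: "W (Suc (Suc i)) (W i x)
      = C (i + 3) (C (Suc i) (C (i + 2) (D i (D i (D (Suc i) (D (Suc i) x))))))" .
  have "W i (W i x) = C (Suc i) (D i (C (i + 2) (C (Suc i) (D (i + 2) (D i (D (Suc i) x))))))"
    unfolding W_def by (simp add: numeral_eq_Suc C_C_D'[symmetric])
  also have "\<dots> = C (Suc i) (C (i + 3) (C (i + 2) (D i (D i (D (Suc i) (D (Suc i) x))))))"
    by (simp add: numeral_eq_Suc left_in[OF D_dg C_dg] right_in[OF D_dg D_dg])
  finally show ?thesis using 1
    by (simp add: numeral_eq_Suc right_in[OF C_dg C_dg])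
qed

definition R where "R i x = M i (C i (S i (S (Suc i) x)))"

lemma R_dg: "diag (Suc (Suc 0)) (Suc 0) R"
proof -
  have "diag (Suc (Suc 0)) (Suc 0) (\<lambda>i x. M i (C i (S i (S (Suc i) x))))"
    by (rule comp[OF comp[OF comp[OF shift[OF S_dg] pad[OF S_dg]] C_dg] M_dg]) auto
  then show ?thesis by (simp add: R_def[abs_def])
qed

lemma M_M_M: "M i (M i (M (Suc (Suc i)) x)) = M i (M i (M i x))"
  by (simp add: left_in[OF M_dg M_dg] M_assoc)

text \<open>With braidings suppressed, this is x1 y1 S(y2) S(x2): the inner pair cancels by the
  antipode axiom, then the outer pair does.\<close>

lemma M_R_W: "M i (M i (R (Suc (Suc i)) (W i x))) = U i (E i (E i x))"
proof -
  have "R (Suc (Suc i)) (W i x) = M (i + 2) (S (i + 3) (S (i + 2) (C (i + 2) (C (i + 1) (D (i + 2) (D i x))))))"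
    unfolding R_def W_def
    by (simp add: numeral_eq_Suc C_single[OF S_dg] left_in[OF D_dg D_dg])
  also have "\<dots> = M (i + 2) (S (i + 3) (S (i + 2) (D (i + 1) (C (i + 1) (D i x)))))"
    using C_C_D'[of "Suc i"] by (simp add: numeral_eq_Suc)
  finally have "M i (M i (R (Suc (Suc i)) (W i x)))
     = M i (M i (M (i + 1) (S (i + 3) (S (i + 2) (D (i + 1) (C (i + 1) (D i x)))))))"
    by (simp add: numeral_eq_Suc M_M_M M_assoc)
  also have "\<dots> = M i (M i (S (i + 2) (U (i + 1) (E (i + 1) (C (i + 1) (D i x))))))"
    by (simp add: numeral_eq_Suc left_in[OF M_dg S_dg] M_S_right)
  also have "\<dots> = M i (S (i + 1) (D i (E (i + 1) x)))"
    by (simp add: numeral_eq_Suc right_in[OF U_dg S_dg] C_erase[OF E_dg] right_in[OF D_dg E_dg])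
  also have "\<dots> = U i (E i (E i x))"
    by (simp add: M_S_right left_in[OF E_dg E_dg])
  finally show ?thesis .
qed

text \<open>Both sides are convolution inverses of the multiplication on the tensor square.\<close>

lemma S_M: "S i (M i x) = M i (C i (S i (S (Suc i) x)))"
proof -
  \<comment> \<open>The triple convolution product of \<open>S\<close> after \<open>M\<close>, of
    \<open>M\<close>, and of \<open>R\<close>. Cancelling the last two factors leaves the first;
    cancelling the first two leaves \<open>R\<close>.\<close>
  let ?T = "M i (S i (M i (M (Suc (Suc i)) (M (Suc (Suc i)) (R (i + 4) (W i (W i x)))))))"
  have "?T = M i (S i (M i (U (Suc (Suc i)) x)))"
    using M_R_W[of "Suc (Suc i)" "W i x"] E_W_right[of i x]
    by (simp add: numeral_eq_Suc W_coassoc left_in[OF E_dg E_dg])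
  also have "\<dots> = S i (M i x)"
    by (simp add: left_in[OF M_dg U_dg] left_in[OF S_dg U_dg])
  finally have 1: "?T = S i (M i x)" .
  define v where "v = R (i + 2) (W i x)"
  have "?T = M i (S i (M i (M (Suc (Suc i)) (M (Suc (Suc i)) (W i v)))))"
    by (simp add: v_def numeral_eq_Suc right_in[OF W_dg R_dg])
  also have "\<dots> = M i (M i (S i (D i (M i v))))"
    by (simp add: D_M W_def left_in[OF M_dg M_dg] left_in[OF S_dg M_dg] M_assoc)
  also have "\<dots> = E i (E i v)"
    by (simp add: M_S_left E_M)
  also have "\<dots> = R i x"
    by (simp add: v_def numeral_eq_Suc left_in[OF E_dg R_dg] E_W_left)
  finally show ?thesis using 1 by (simp add: R_def)
qed

text \<open>\<open>g\<close> is an algebra morphism, so \<open>g \<circ> S\<close> is its convolution inverse; \<open>h\<close> is another one.\<close>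

definition g where "g i x = d i (D i x)"
definition h where "h i x = S i (d (Suc i) (S (Suc i) (D i x)))"

lemma g_dg: "diag (Suc 0) (Suc 0) g"
proof -
  have "diag (Suc 0) (Suc 0) (\<lambda>i x. d i (D i x))"
    by (rule comp[OF D_dg pad[OF d_dg]]) auto
  then show ?thesis by (simp add: g_def[abs_def])
qed

lemma h_dg: "diag (Suc 0) (Suc 0) h"
proof -
  have "diag (Suc 0) (Suc 0) (\<lambda>i x. S i (d (Suc i) (S (Suc i) (D i x))))"
    by (rule comp[OF comp[OF comp[OF D_dg shift[OF S_dg]] shift[OF d_dg]] S_dg]) auto
  then show ?thesis by (simp add: h_def[abs_def])
qed

lemma g_M: "g i (M i x) = M i (g i (g (Suc i) x))"
  unfolding g_def
  by (simp add: D_M left_in[OF d_dg M_dg] d_M left_in[OF d_dg C_dg] C_erase[OF d_dg]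
      left_in[OF D_dg d_dg] left_in[OF d_dg d_dg])

lemma g_U: "g i (U i x) = U i x"
  by (simp add: g_def D_U)

lemma g_D: "g i (D i x) = D i (g i x)"
  using left_in[OF d_dg D_dg, of i "Suc i" "D i x"] by (simp add: g_def D_coassoc)

lemma d_S_right: "d i (d (Suc i) (S (Suc i) (D i x))) = E i x"
  using d_M[of i "S (Suc i) (D i x)"] by (simp add: M_S_right left_in[OF d_dg d_dg])

text \<open>In \<delta>(x1) x2 S(x3) \<delta>(S x4) the middle cancels by the antipode axiom, and
  then the two characters cancel by \<open>d_S_right\<close>.\<close>

lemma g_h: "M i (g i (h (Suc i) (D i x))) = U i (E i x)"
proof -
  have "M i (g i (h (Suc i) (D i x))) = M i (h (Suc i) (D i (g i x)))"
    by (simp add: left_in[OF g_dg h_dg] g_D)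
  also have "\<dots> = M i (S (Suc i) (D i (d (Suc i) (S (Suc i) (D i (g i x))))))"
    by (simp add: h_def D_coassoc right_in[OF D_dg S_dg] right_in[OF D_dg d_dg])
  also have "\<dots> = U i (d i (S i (g i x)))"
    by (simp add: M_S_right left_in[OF E_dg d_dg] left_in[OF E_dg S_dg])
  also have "\<dots> = U i (d i (d (Suc i) (S (Suc i) (D i x))))"
    by (simp add: g_def right_in[OF d_dg S_dg] left_in[OF d_dg d_dg])
  finally show ?thesis by (simp add: d_S_right)
qed

lemma g_S: "g i (S i x) = S i (d (Suc i) (S (Suc i) (D i x)))"
proof -
  \<comment> \<open>The triple convolution product of \<open>g\<close> after \<open>S\<close>, of
    \<open>g\<close>, and of \<open>h\<close>, evaluated in both groupings.\<close>
  let ?T = "M i (M i (g i (S i (g (Suc i) (h (Suc (Suc i)) (D i (D i x)))))))"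
  have "?T = M i (g i (M i (S i (D i (h (Suc i) (D i x))))))"
    by (simp add: g_M right_in[OF S_dg g_dg] right_in[OF D_dg h_dg])
  also have "\<dots> = h i x"
    by (simp add: M_S_left g_U left_in[OF E_dg h_dg])
  finally have 1: "?T = h i x" .
  have "?T = M i (g i (S i (M (Suc i) (g (Suc i) (h (Suc (Suc i)) (D (Suc i) (D i x)))))))"
    by (simp add: D_coassoc M_assoc[symmetric] left_in[OF S_dg M_dg] left_in[OF g_dg M_dg])
  also have "\<dots> = g i (S i x)"
    by (simp add: g_h left_in[OF S_dg U_dg] left_in[OF g_dg U_dg])
  finally show ?thesis using 1 by (simp add: h_def)
qed


section \<open>The twisted antipode and its square\<close>

definition St where "St i x = S i (d i (D i x))"

lemma St_g: "St i x = S i (g i x)"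
  by (simp add: St_def g_def)

lemma St_dg: "diag (Suc 0) (Suc 0) St"
  using comp[OF g_dg S_dg] by (simp add: St_g[abs_def])

lemma St_M: "St i (M i x) = M i (C i (St i (St (Suc i) x)))"
  by (simp add: St_g g_M S_M left_in[OF g_dg S_dg])

text \<open>\<open>g\<close> passes through the first leg of the comultiplication, so the antipode
  axiom applies to \<open>g i x\<close>; the counit after \<open>g\<close> is \<delta>.\<close>

lemma M_St_D: "M i (St i (D i x)) = U i (d i x)"
proof -
  have "M i (St i (D i x)) = U i (E i (g i x))"
    by (simp add: St_g g_D M_S_left)
  then show ?thesis by (simp add: g_def right_in[OF d_dg E_dg])
qed

text \<open>By \<open>g_S\<close> the left side is the square of \<open>S\<close> at y =
  \<delta>(x1) x2 \<delta>(S x3). The involution condition for y adds \<delta> S on the left and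
  \<delta> on the right; these cancel the characters in y and leave \<sigma> \<theta>(x)
  S(\<sigma>).\<close>

lemma St_St: "St i (St i x) = M i (M i (S (Suc (Suc i)) (s (Suc (Suc i)) (s i (Th i x)))))"
proof -
  let ?w = "d i (D i x)"
  let ?y = "d (Suc i) (S (Suc i) (D i ?w))"
  have "D i (D i ?y) = d (i + 3) (S (i + 3) (D (i + 2) (D i (D i ?w))))"
    by (simp add: numeral_eq_Suc left_in[OF D_dg d_dg] left_in[OF D_dg S_dg] right_in[OF D_dg D_dg]
        D_coassoc)
  then have "d i (S i (d (Suc (Suc i)) (D i (D i ?y)))) = d i (S i (E (i + 2) (D i (D i ?w))))"
    using d_S_right[of "i + 2" "D i (D i ?w)"] by (simp add: numeral_eq_Suc)
  also have "E (i + 2) (D i (D i ?w)) = D i (E (i + 1) (D i ?w))"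
    by (simp only: right_in[OF D_dg E_dg]) simp
  also have "d i (S i (D i (E (i + 1) (D i ?w)))) = d i (S i (D i ?w))"
    by (simp only: Suc_eq_plus1[symmetric] E_D_right)
  also have "\<dots> = d i (S i (d i (D (Suc i) (D i x))))"
    by (simp add: right_in[OF d_dg D_dg])
  also have "\<dots> = d i (d i (S (Suc i) (D i (D i x))))"
    by (simp add: D_coassoc right_in[OF d_dg S_dg])
  also have "\<dots> = x"
    using d_M[of i "S (Suc i) (D i (D i x))"] by (simp add: M_S_right)
  finally have "S i (S i ?y) = M i (M i (S (Suc (Suc i)) (s (Suc (Suc i)) (s i (Th i x)))))"
    by (simp only: S_S)
  then show ?thesis by (simp only: St_def g_S[unfolded g_def])
qed

text \<open>
  Multiplying the involution condition by \<open>\<sigma>\<close> on the right turns it into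
  \<open>M_s_St_St\<close>: the square of the twisted antipode, times \<open>\<sigma>\<close>, is \<open>\<sigma>\<close> times \<open>\<theta>\<^sub>H\<close>.
\<close>

definition Z where "Z i x = M i (s i (Th i x))"

lemma Z_dg: "diag (Suc 0) (Suc 0) Z"
proof -
  have "diag (Suc 0) (Suc 0) (\<lambda>i x. M i (s i (Th i x)))"
    by (rule comp[OF comp[OF Th_dg pad[OF s_dg]] M_dg]) auto
  then show ?thesis by (simp add: Z_def[abs_def])
qed

lemma M_s_St_St: "M i (s (Suc i) (St i (St i x))) = Z i x"
proof -
  let ?y = "s i (Th i x)"
  \<comment> \<open>Two copies of \<sigma> are read as the comultiplication of one, so that the
    antipode axiom gives S(\<sigma>) \<sigma> = 1.\<close>
  have *: "s (Suc j) (S j (s j y)) = S j (D j (s j y))" for j y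
    by (simp add: right_in[OF S_dg s_dg] right_in[OF s_dg s_dg] D_s)
  have "M i (s (Suc i) (St i (St i x)))
      = M i (M i (M (Suc (Suc i)) (s (i + 3) (S (Suc (Suc i)) (s (Suc (Suc i)) ?y)))))"
    by (simp add: numeral_eq_Suc St_St right_in[OF M_dg s_dg] M_M_M)
  also have "s (i + 3) (S (Suc (Suc i)) (s (Suc (Suc i)) ?y))
      = S (Suc (Suc i)) (D (Suc (Suc i)) (s (Suc (Suc i)) ?y))"
    using *[of "Suc (Suc i)"] by (simp add: numeral_eq_Suc)
  also have "M i (M i (M (Suc (Suc i)) \<dots>)) = M i ?y"
    by (simp add: M_S_left left_in[OF M_dg U_dg])
  finally show ?thesis by (simp add: Z_def)
qed

section \<open>The diagonal action\<close>

primrec Lam where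
  "Lam 0 i x = E i x"
| "Lam (Suc n) i x = M i (Lam n (Suc (Suc i)) (C (Suc i) (D i x)))"

lemma Lam_dg: "diag (Suc n) n (Lam n)"
proof (induction n)
  case 0
  have "Lam 0 = E" by (intro ext) simp
  then show ?case using E_dg by simp
next
  case (Suc n)
  have "diag (Suc (Suc (Suc n))) (Suc (Suc n)) (\<lambda>i. Lam n (Suc (Suc i)))"
    using shift[OF shift[OF Suc], of "Suc n" n "Suc (Suc n)" "Suc n"] by simp
  then have "diag (Suc (Suc n)) (Suc n) (\<lambda>i x. M i (Lam n (Suc (Suc i)) (C (Suc i) (D i x))))"
    by (intro comp[OF comp[OF comp[OF pad[OF D_dg] shift[OF C_dg]]] pad[OF M_dg]]) auto
  moreover have "Lam (Suc n) = (\<lambda>i x. M i (Lam n (Suc (Suc i)) (C (Suc i) (D i x))))"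
    by (intro ext) simp
  ultimately show ?case by simp
qed

text \<open>The comultiplication duplicates a group-like element, and a diagram without inputs
  passes a strand without leaving a crossing. Used for the unit and for \<sigma>.\<close>

lemma Lam_group_like:
  assumes "diag 0 (Suc 0) F" and "\<And>i x. D i (F i x) = F i (F i x)"
  shows "Lam (Suc n) i (F i x) = M i (F i (Lam n (Suc i) (F (Suc i) x)))"
proof -
  have "Lam (Suc n) i (F i x) = M i (Lam n (Suc (Suc i)) (C (Suc i) (F (Suc i) (F i x))))"
    using right_in[OF assms(1,1), of i "Suc i" x] by (simp add: assms(2))
  also have "C (Suc i) (F (Suc i) (F i x)) = F (Suc (Suc i)) (F i x)"
    using crossL[OF assms(1), of "Suc i"] by simp
  finally show ?thesis
    by (simp add: right_in[OF assms(1) Lam_dg] right_in[OF assms(1,1)])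
qed

lemma Lam_U: "Lam n i (U i x) = x"
  by (induction n arbitrary: i x) (simp_all add: Lam_group_like[OF U_dg D_U] del: Lam.simps(2))

text \<open>This is the module property. Both sides are brought to two comultiplications, three
  crossings, two actions on the tail and two multiplications; they then differ by associativity and
  the exchange of two disjoint crossings.\<close>

lemma Lam_M: "Lam n i (M i x) = Lam n i (Lam n (Suc i) x)"
proof (induction n arbitrary: i x)
  case 0
  then show ?case by (simp add: E_M left_in[OF E_dg E_dg])
next
  case (Suc n)
  have "Lam (Suc n) i (M i x)
      = M i (Lam n (i + 2) (C (i + 1) (M (i + 1) (M i (C (i + 1) (D i (D (i + 1) x)))))))"
    by (simp add: D_M)
  also have "C (i + 1) (M (i + 1) z) = M (i + 2) (C (i + 1) (C (i + 2) z))" for z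
    using crossL[OF M_dg, of "i + 1"] by (simp add: numeral_2_eq_2)
  also have "M i (Lam n (i + 2) (M (i + 2) (C (i + 1) (C (i + 2) (M i (C (i + 1) (D i (D (i + 1) x))))))))
     = M i (Lam n (i + 2) (Lam n (i + 3) (M i (C (i + 2) (C (i + 3) (C (i + 1) (D i (D (i + 1) x))))))))"
    using Suc[of "i + 2"] by (simp add: numeral_eq_Suc right_in[OF M_dg C_dg])
  also have "\<dots> = M i (M i (Lam n (i + 3) (Lam n (i + 4) (C (i + 2) (C (i + 3) (C (i + 1) (D i (D (i + 1) x))))))))"
    by (simp add: numeral_eq_Suc right_in[OF M_dg Lam_dg])
  finally have 1: "Lam (Suc n) i (M i x)
     = M i (M i (Lam n (i + 3) (Lam n (i + 4) (C (i + 2) (C (i + 3) (C (i + 1) (D i (D (i + 1) x))))))))" .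
  have "Lam (Suc n) i (Lam (Suc n) (Suc i) x)
     = M i (Lam n (i + 2) (C (i + 1) (D i (M (i + 1) (Lam n (i + 3) (C (i + 2) (D (i + 1) x)))))))"
    by (simp add: numeral_eq_Suc)
  also have "\<dots> = M i (Lam n (i + 2) (C (i + 1) (M (i + 2) (Lam n (i + 4) (C (i + 3) (D i (D (i + 1) x)))))))"
    by (simp add: numeral_eq_Suc left_in[OF D_dg M_dg] left_in[OF D_dg C_dg] left_in[OF D_dg Lam_dg])
  also have "C (i + 1) (M (i + 2) z) = M (i + 1) (C (i + 2) (C (i + 1) z))" for z
    using crossR[OF M_dg, of "i + 1"] by (simp add: numeral_2_eq_2)
  also have "M i (Lam n (i + 2) (M (i + 1) (C (i + 2) (C (i + 1) (Lam n (i + 4) (C (i + 3) (D i (D (i + 1) x))))))))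
     = M i (M (i + 1) (Lam n (i + 3) (Lam n (i + 4) (C (i + 2) (C (i + 1) (C (i + 3) (D i (D (i + 1) x))))))))"
    by (simp add: numeral_eq_Suc right_in[OF M_dg Lam_dg] left_in[OF C_dg Lam_dg])
  finally show ?case using 1
    by (simp add: numeral_eq_Suc M_assoc right_in[OF C_dg C_dg])
qed

text \<open>By coassociativity the action can be unfolded at the last factor instead of the first,
  with the second leg braided past \<open>n\<close> factors. This form is needed because \<sigma>
  enters at the right end.\<close>

lemma Lam_snoc: "Lam (Suc n) i x = M (i + n) (Lam n i (Cr n (Suc i) (D i x)))"
proof (induction n arbitrary: i x)
  case 0
  have "Lam (Suc 0) i x = M i (E (i + 2) (C (i + 1) (D i x)))" by (simp add: numeral_eq_Suc)
  also have "\<dots> = M i (E (i + 1) (D i x))"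
    using C_erase(2)[OF E_dg, of "i + 1"] by (simp add: numeral_eq_Suc)
  finally show ?case by simp
next
  case (Suc n)
  let ?z = "C (Suc i) (D i x)"
  have "Lam (Suc (Suc n)) i x = M i (M (i + n + 2) (Lam n (i + 2) (Cr n (i + 3) (D (i + 2) ?z))))"
    using Suc[of "i + 2" ?z] by (simp add: numeral_eq_Suc)
  also have "\<dots> = M (i + n + 1) (M i (Lam n (i + 2) (Cr n (i + 3) (D (i + 2) ?z))))"
    by (simp add: numeral_eq_Suc left_in[OF M_dg M_dg])
  also have "D (i + 2) ?z = C (i + 1) (C (i + 2) (D (i + 1) (D i x)))"
    using C_C_D[of "i + 1" "D i x"] by (simp add: numeral_eq_Suc)
  also have "Cr n (i + 3) (C (i + 1) (C (i + 2) (D (i + 1) (D i x))))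
      = C (i + 1) (Cr n (i + 3) (C (i + 2) (D i (D i x))))"
    by (simp add: numeral_eq_Suc right_in[OF C_dg Cr_diag] D_coassoc)
  also have "Cr n (i + 3) (C (i + 2) (D i (D i x))) = D i (Cr (Suc n) (i + 1) (D i x))"
    by (simp add: numeral_eq_Suc left_in[OF D_dg C_dg] left_in[OF D_dg Cr_diag])
  finally show ?case by (simp add: numeral_eq_Suc)
qed


lemma Cr_erase:
  assumes "diag (Suc 0) 0 F"
  shows "F (i + k) (Cr k i x) = F i x"
proof (induction k arbitrary: i x)
  case (Suc k)
  from Suc[of "Suc i" "C i x"] show ?case by (simp add: C_erase[OF assms])
qed simp

lemma Cr_D: "Cr k i (Cr k (Suc i) (D i x)) = D (i + k) (Cr k i x)"
proof (induction k arbitrary: i x)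
  case (Suc k)
  from Suc[of "Suc i" "C i x"] show ?case
    by (simp add: left_in[OF C_dg Cr_diag] C_C_D)
qed simp

text \<open>On the right the last factor receives h2 S(h3) \<sigma>, which collapses to \<sigma> by
  the antipode axiom. A \<sigma> appended after the action is thus drawn into it, and the module
  property becomes usable on all \<open>k + 1\<close> factors.\<close>

lemma s_Lam: "s (i + k) (Lam k i x) = Lam (Suc k) i (M (i + k + 1) (s (i + k + 2)
    (S (i + k + 1) (Cr k (i + 1) (D i x)))))"
proof -
  let ?p = "Suc (i + k)"
  let ?w = "Cr k (Suc i) (D i x)"
  have "Lam (Suc k) i (M (i + k + 1) (s (i + k + 2) (S (i + k + 1) (Cr k (i + 1) (D i x)))))
     = M (i + k) (Lam k i (Cr k (i + 1) (D i (M (i + k + 1) (s (i + k + 2) (S (i + k + 1) ?w))))))"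
    by (simp add: Lam_snoc del: Lam.simps(2))
  also have "\<dots> = M (i + k) (Lam k i (Cr k (i + 1) (M (i + k + 2) (s (i + k + 3) (S (i + k + 2)
      (Cr k (i + 2) (D i (D i x))))))))"
    by (simp add: numeral_eq_Suc left_in[OF D_dg M_dg] left_in[OF D_dg s_dg]
        left_in[OF D_dg S_dg] left_in[OF D_dg Cr_diag])
  also have "\<dots> = M (i + k) (Lam k i (M (i + k + 2) (s (i + k + 3) (S (i + k + 2)
      (Cr k (i + 1) (Cr k (i + 2) (D (i + 1) (D i x))))))))"
    by (simp add: numeral_eq_Suc left_in[OF Cr_diag M_dg] left_in[OF Cr_diag s_dg]
        left_in[OF Cr_diag S_dg] D_coassoc)
  also have "Cr k (i + 1) (Cr k (i + 2) (D (i + 1) (D i x))) = D ?p ?w"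
    using Cr_D[of k "Suc i" "D i x"] by simp
  also have "M (i + k) (Lam k i (M (i + k + 2) (s (i + k + 3) (S (i + k + 2) (D ?p ?w)))))
      = Lam k i (M ?p (s (Suc ?p) (M ?p (S (Suc ?p) (D ?p ?w)))))"
    by (simp add: numeral_eq_Suc right_in[OF Lam_dg M_dg] M_assoc right_in[OF M_dg s_dg])
  also have "\<dots> = Lam k i (s ?p (E ?p ?w))"
    by (simp add: M_S_right right_in[OF U_dg s_dg])
  also have "E ?p ?w = x"
    using Cr_erase[OF E_dg, of "Suc i" k "D i x"] by simp
  finally show ?thesis
    by (simp add: right_in[OF Lam_dg s_dg])
qed

text \<open>
  \<open>Pi n\<close> exhibits the \<open>n\<close>-th power of \<open>H\<close> as the coinvariant quotient of the next power, on which the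
  paracocyclic operator lifts to the rotation \<open>Rot n\<close>.
\<close>

definition Pi where "Pi n i x = Lam n i (St i x)"

text \<open>Up to braiding S'(x y) = S'(y) S'(x), and by the module property the two act in turn,
  S'(x) first. In \<open>Pi_Lam\<close> this separates the leg h1 from the factor it multiplies, so
  that it can meet h2.\<close>

lemma Pi_M: "Pi n i (M i x) = Pi n i (Pi n (Suc i) (C i x))"
  by (simp add: Pi_def St_M Lam_M C_single[OF St_dg] left_in[OF St_dg Lam_dg] left_in[OF St_dg St_dg])

text \<open>The two actions combine into one by S'(h1) h2, that is, \<delta>(h) times the
  unit.\<close>

lemma Pi_Lam_D: "Pi n i (Lam n (Suc i) (D i x)) = d i x"
  by (simp add: Pi_def left_in[OF St_dg Lam_dg] M_St_D Lam_U flip: Lam_M)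

lemma Pi_Lam: "Pi n i (Lam (Suc n) i x) = Pi n i (d i x)"
  by (simp add: Pi_M left_in[OF C_dg Lam_dg] C_C_D Pi_Lam_D C_erase[OF d_dg])

lemma Pi_U: "Pi n i (U i x) = x"
proof -
  \<comment> \<open>The second unit is inserted to produce the comultiplication of the unit, to
    which the antipode axiom applies.\<close>
  have "S i (U i x) = M i (U (Suc i) (S i (U i x)))" by simp
  also have "\<dots> = M i (S i (D i (U i x)))"
    by (simp add: D_U right_in[OF S_dg U_dg] right_in[OF U_dg U_dg] del: M_U_right)
  finally have "S i (U i x) = U i x" by (simp add: M_S_left)
  then show ?thesis by (simp add: Pi_def St_g g_U Lam_U)
qed

text \<open>Let h be the first strand. \<open>s_Lam\<close> turns the \<sigma> outside the action of
  h2 into S(h3) \<sigma> inside it; then S'(h1) h2 collapses to \<delta>. What remains of h is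
  S'(h), braided to the end and placed left of \<sigma>.\<close>

lemma Pi_s_Lam_D: "Pi (Suc k) i (s (Suc (i + k)) (Lam k (Suc i) (D i x)))
    = M (i + k) (s (Suc (i + k)) (St (i + k) (Cr k i x)))"
proof -
  let ?v = "M (i + k + 2) (s (i + k + 3) (S (i + k + 2) (Cr k (i + 2) (D i (D i x)))))"
  have "Pi (Suc k) i (s (Suc (i + k)) (Lam k (Suc i) (D i x)))
     = Pi (Suc k) i (Lam (Suc k) (Suc i) ?v)"
    using s_Lam[of "Suc i" k "D i x"] by (simp add: D_coassoc numeral_eq_Suc)
  also have "\<dots> = Lam (Suc k) i (M i (St i ?v))"
    by (simp add: Pi_def left_in[OF St_dg Lam_dg] Lam_M del: Lam.simps(2))
  also have "St i ?v = M (i + k + 2) (s (i + k + 3) (S (i + k + 2) (Cr k (i + 2) (St i (D i (D i x))))))"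
    by (simp add: numeral_eq_Suc left_in[OF St_dg M_dg] left_in[OF St_dg s_dg] left_in[OF St_dg S_dg]
        left_in[OF St_dg Cr_diag])
  also have "M i \<dots> = M (i + k + 1) (s (i + k + 2) (S (i + k + 1) (Cr k (i + 1) (M i (St i (D i (D i x)))))))"
    by (simp add: numeral_eq_Suc left_in[OF M_dg M_dg] left_in[OF M_dg s_dg] left_in[OF M_dg S_dg]
        left_in[OF M_dg Cr_diag])
  also have "\<dots> = U i (M (i + k) (s (i + k + 1) (S (i + k) (Cr k i (g i x)))))"
    by (simp add: numeral_eq_Suc M_St_D g_def right_in[OF U_dg M_dg] right_in[OF U_dg s_dg]
        right_in[OF U_dg S_dg] right_in[OF U_dg Cr_diag])
  finally show ?thesis
    using strand_past(1)[of g k i x] g_dg by (simp add: Lam_U St_g del: Lam.simps(2))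
qed

definition Rot where "Rot n i x = Z (i + n) (Cr n i x)"

text \<open>The index is shifted: this is the paracocyclic operator on \<open>k + 1\<close> strands,
  with \<sigma> appended as strand number \<open>k + 2\<close>.\<close>

definition Tau where "Tau k i x = Pi (Suc k) i (s (Suc (i + k)) x)"

text \<open>The first factor produced by \<open>Pi\<close> is a product with left factor h1, where h
  = S'(x0). So \<open>Pi_M\<close> splits off an inner \<open>Pi\<close> to which
  \<open>Pi_s_Lam_D\<close> applies; it leaves S'(S'(x0)) \<sigma> in the last place, which is
  \<open>Z\<close> by \<open>M_s_St_St\<close>.\<close>

lemma Tau_Pi: "Tau k i (Pi (Suc k) i x) = Pi (Suc k) i (Rot (Suc k) i x)"
proof -
  let ?w = "St i x"
  have "Tau k i (Pi (Suc k) i x)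
     = Pi (Suc k) i (M i (s (i + k + 2) (Lam k (i + 2) (C (i + 1) (D i ?w)))))"
    by (simp add: Tau_def Pi_def[of _ _ x] numeral_eq_Suc right_in[OF M_dg s_dg])
  also have "\<dots> = Pi (Suc k) i (Pi (Suc k) (Suc i) (s (i + k + 2) (Lam k (i + 2) (D (Suc i) (C i ?w)))))"
    by (simp add: numeral_eq_Suc Pi_M left_in[OF C_dg s_dg] left_in[OF C_dg Lam_dg] C_C_D)
  also have "\<dots> = Pi (Suc k) i (M (i + k + 1) (s (i + k + 2) (St (i + k + 1) (Cr (Suc k) i ?w))))"
    using Pi_s_Lam_D[of k "Suc i" "C i ?w"] by (simp add: numeral_eq_Suc)
  also have "Cr (Suc k) i ?w = St (i + k + 1) (Cr (Suc k) i x)"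
    using strand_past(1)[of St "Suc k" i x] St_dg by simp
  finally show ?thesis
    using M_s_St_St[of "i + k + 1"] by (simp add: Rot_def numeral_eq_Suc)
qed

section \<open>Powers of the rotation and the full twist\<close>

lemma Rot_dg: "diag (Suc n) (Suc n) (Rot n)"
proof -
  have "diag (Suc n) (Suc n) (\<lambda>i x. Z (i + n) (Cr n i x))"
    by (rule comp[OF Cr_diag whisker'[OF Z_dg]]) auto
  then show ?thesis by (simp add: Rot_def[abs_def])
qed

lemma Rot_shift:
  assumes "diag n n F"
  shows "Rot n i (F (Suc i) x) = F i (Rot n i x)"
  by (simp add: Rot_def crossR[OF assms] right_in[OF assms Z_dg])

lemma Rot_Suc: "Rot (Suc k) i x = C (i + k) (Rot k i x)"
  by (simp add: Rot_def Cr_snoc C_single[OF Z_dg] del: cross_right.simps(2))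

text \<open>In \<open>Suc m\<close> rotations the first strand goes to the end and is then passed by
  \<open>m\<close> others. Equivalently, the others first rotate \<open>m\<close> times among
  themselves, the first strand passes all of them, and \<open>Cl m\<close> takes it back over the
  last \<open>m\<close>.\<close>

lemma Rot_pow: "m \<le> Suc k \<Longrightarrow> (Rot (Suc k) i ^^ Suc m) x
    = Cl m (Suc (i + k) - m) (Rot (Suc k) i ((Rot k (Suc i) ^^ m) x))"
proof (induction m)
  case (Suc m)
  let ?T = "Rot (Suc k) i" and ?j = "i + k - m"
  let ?w = "(Rot k (Suc i) ^^ m) x"
  have j: "Suc (i + k) - m = Suc ?j" "?j = i + (k - m)" "?j + m = i + k"
    using Suc.prems by auto
  \<comment> \<open>\<open>Cl m\<close> is written as a diagram on the strands that do not travel,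
    so \<open>Rot_shift\<close> moves it out of the rotation, one position lower.\<close>
  have "diag (Suc k) (Suc k) (\<lambda>i. Cl m (i + (k - m)))"
    using Suc.prems by (intro whisker'[OF Cl_diag, of _ _ _ 0]) auto
  note Cl = Rot_shift[OF this, of i]
  have "(?T ^^ Suc (Suc m)) x = ?T (Cl m (Suc ?j) (?T ?w))"
    using Suc by (simp add: j(1))
  also have "\<dots> = Cl m ?j (?T (?T ?w))"
    using Cl by (simp add: j(2))
  \<comment> \<open>The outer rotation is one crossing after the shorter rotation, which moves
    inside past the other \<open>?T\<close>. The crossing left over lengthens \<open>Cl m\<close> to
    \<open>Cl (Suc m)\<close>.\<close>
  also have "?T (?T ?w) = C (?j + m) (?T (Rot k (Suc i) ?w))"
    using Rot_Suc[of k i "?T ?w"] Rot_shift[OF Rot_dg, of k i ?w] by (simp add: j(3))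
  finally show ?case by (simp add: Cl_snoc del: cross_left.simps(2))
qed simp

text \<open>The full twist on \<open>n\<close> strands, with \<open>Z\<close> on each: the first
  strand runs once around the others, which are then twisted recursively.\<close>

primrec Full where
  "Full 0 i x = x"
| "Full (Suc n) i x = Z i (Full n (Suc i) (Cl n i (Cr n i x)))"

lemma Full_dg: "diag n n (Full n)"
proof (induction n)
  case 0
  have "Full 0 = (\<lambda>i x. x)" by (intro ext) simp
  then show ?case using idle by metis
next
  case (Suc n)
  have "diag (Suc n) (Suc n) (\<lambda>i x. Z i (Full n (Suc i) (Cl n i (Cr n i x))))"
    by (rule comp[OF comp[OF comp[OF Cr_diag Cl_diag] shift[OF Suc]] pad[OF Z_dg]]) auto
  moreover have "Full (Suc n) = (\<lambda>i x. Z i (Full n (Suc i) (Cl n i (Cr n i x))))"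
    by (intro ext) simp
  ultimately show ?case by simp
qed

text \<open>This is the extreme case of \<open>Rot_pow\<close>: the first strand returns to position
  \<open>i\<close>, while the others have completed a full cycle of their own.\<close>

lemma Rot_pow_Full: "(Rot n i ^^ Suc n) x = Full (Suc n) i x"
proof (induction n arbitrary: i x)
  case 0
  show ?case by (simp add: Rot_def)
next
  case (Suc k)
  have "(Rot (Suc k) i ^^ Suc (Suc k)) x
      = Cl (Suc k) i (Z (i + Suc k) (Cr (Suc k) i (Full (Suc k) (Suc i) x)))"
    using Rot_pow[of "Suc k" k i x] unfolding Suc[of "Suc i" x] by (simp only: Rot_def) simp
  also have "\<dots> = Full (Suc (Suc k)) i x"
    \<comment> \<open>\<open>Z\<close> travels back with its strand, and the twist of the others
      slides through both halves of the double crossing.\<close>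
    using strand_past(2)[of Z "Suc k"] Z_dg crossR[OF Full_dg, of "Suc k"] crossL[OF Full_dg, of "Suc k"]
    by (simp del: Full.simps cross_left.simps cross_right.simps add: Full.simps(2)[of "Suc k"])
  finally show ?case .
qed

text \<open>\<open>Full\<close> without \<sigma>. The recursion mirrors \<open>twist_tensor\<close>
  for H and a power of H, so that it evaluates to \<theta> of the power.\<close>

primrec Tw where
  "Tw 0 i x = x"
| "Tw (Suc n) i x = Th i (Tw n (Suc i) (Cl n i (Cr n i x)))"

text \<open>The twists slide inside past the copies of \<sigma>, and group-likeness collects these
  copies into a single one acting diagonally.\<close>

lemma Full_Tw: "Full n i x = Lam n i (s i (Tw n i x))"
proof (induction n arbitrary: i x)
  case (Suc n)
  then show ?case
    by (simp add: Lam_group_like[OF s_dg D_s] Z_def right_in[OF Th_dg s_dg] right_in[OF Th_dg Lam_dg]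
        del: Lam.simps)
qed simp

text \<open>\<open>x\<close> is replaced by \<open>Pi (Suc k) i (U i x)\<close> before
  \<open>Tau_Pi\<close> is iterated; afterwards \<open>Pi_Lam\<close> and \<delta> \<sigma> = 1
  remove \<sigma>. The exponent is \<open>k + 2\<close> because \<open>Tau k\<close> acts on
  \<open>k + 1\<close> strands.\<close>

theorem Tau_pow: "(Tau k i ^^ (k + 2)) x = Pi (Suc k) i (Tw (k + 2) i (U i x))"
proof -
  have "(Tau k i ^^ m) (Pi (Suc k) i y) = Pi (Suc k) i ((Rot (Suc k) i ^^ m) y)" for m y
    by (induction m) (simp_all add: Tau_Pi)
  from this[of "k + 2" "U i x"] have "(Tau k i ^^ (k + 2)) x = Pi (Suc k) i ((Rot (Suc k) i ^^ (k + 2)) (U i x))"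
    by (simp only: Pi_U)
  also have "\<dots> = Pi (Suc k) i (Lam (Suc (Suc k)) i (s i (Tw (k + 2) i (U i x))))"
    using Rot_pow_Full[of "Suc k" i "U i x"] Full_Tw[of "Suc (Suc k)" i "U i x"] by simp
  finally show ?thesis by (simp add: Pi_Lam del: Lam.simps)
qed

end

section \<open>Coherence in monoidal and braided categories\<close>

context category
begin

lemma homD:
  assumes "f \<in> hom B X Y"
  shows "f \<in> Arr B" and "Dom B f = X" and "Cod B f = Y" and "X \<in> Obj B" and "Y \<in> Obj B"
  using assms Dom_Obj Cod_Obj by (auto simp: hom_def)

lemma Arr_hom: "f \<in> Arr B \<Longrightarrow> f \<in> hom B (Dom B f) (Cod B f)"
  by (simp add: hom_def)

lemma obj_Arr [simp]: "f \<in> Arr B \<Longrightarrow> Dom B f \<in> Obj B" "f \<in> Arr B \<Longrightarrow> Cod B f \<in> Obj B"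
  by (simp_all add: Dom_Obj Cod_Obj)

lemma Id_Arr [simp]:
  assumes "X \<in> Obj B"
  shows "Id B X \<in> Arr B" "Dom B (Id B X) = X" "Cod B (Id B X) = X"
  using homD[OF Id_hom[OF assms]] by simp_all

lemma comp_Arr [simp]:
  assumes "f \<in> Arr B" "g \<in> Arr B" "Dom B g = Cod B f"
  shows "g \<cdot> f \<in> Arr B" "Dom B (g \<cdot> f) = Dom B f" "Cod B (g \<cdot> f) = Cod B g"
  using homD[OF comp_hom[of f "Dom B f" "Cod B f" g "Cod B g"]] assms by (auto simp: hom_def)

lemma comp_Id [simp]:
  assumes "f \<in> Arr B"
  shows "Cod B f = X \<Longrightarrow> Id B X \<cdot> f = f" "Dom B f = X \<Longrightarrow> f \<cdot> Id B X = f"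
  using assms comp_Id_left comp_Id_right by (auto simp: hom_def)

lemma comp_assoc' [simp]:
  assumes "f \<in> Arr B" "g \<in> Arr B" "h \<in> Arr B" "Dom B g = Cod B f" "Dom B h = Cod B g"
  shows "(h \<cdot> g) \<cdot> f = h \<cdot> g \<cdot> f"
  using comp_assoc[of f "Dom B f" "Cod B f" g "Cod B g" h "Cod B h"] assms by (simp add: hom_def)

text \<open>Composites are kept nested to the right, so an equation for a composite of two arrows
  matches only at the end; this turns it into a rule for the middle of a composite.\<close>

lemma comp_ext:
  assumes "a \<cdot> b = c" "a \<in> Arr B" "b \<in> Arr B" "z \<in> Arr B" "Dom B a = Cod B b" "Dom B b = Cod B z"
  shows "a \<cdot> b \<cdot> z = c \<cdot> z"
  using assms comp_assoc' by metis

lemma inverse_unique: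
  assumes "inverse_arrows B f g" and "inverse_arrows B f h"
  shows "g = h"
proof -
  have "g = (h \<cdot> f) \<cdot> g" using assms by (auto simp: inverse_arrows_def hom_def)
  also have "\<dots> = h \<cdot> f \<cdot> g" using assms by (intro comp_assoc') (auto simp: inverse_arrows_def hom_def)
  finally show ?thesis using assms by (auto simp: inverse_arrows_def hom_def)
qed

lemma inverse_inv_arr: "iso B f \<Longrightarrow> inverse_arrows B f (inv_arr B f)"
  unfolding iso_def inv_arr_def by (metis inverse_unique theI)

lemma inv_arr_eq:
  assumes "inverse_arrows B f g"
  shows "inv_arr B f = g"
proof (rule inverse_unique)
  show "inverse_arrows B f (inv_arr B f)"
    using assms by (intro inverse_inv_arr) (auto simp: iso_def)
qed (rule assms)

lemma inv_arr_simps [simp]: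
  assumes "iso B f"
  shows "f \<in> Arr B" "inv_arr B f \<in> Arr B" "Dom B (inv_arr B f) = Cod B f" "Cod B (inv_arr B f) = Dom B f"
    "inv_arr B f \<cdot> f = Id B (Dom B f)" "f \<cdot> inv_arr B f = Id B (Cod B f)"
  using inverse_inv_arr[OF assms] by (auto simp: inverse_arrows_def hom_def)

lemma inv_arr_cancel [simp]:
  assumes "iso B f" "z \<in> Arr B"
  shows "Cod B z = Dom B f \<Longrightarrow> inv_arr B f \<cdot> f \<cdot> z = z" "Cod B z = Cod B f \<Longrightarrow> f \<cdot> inv_arr B f \<cdot> z = z"
  using assms comp_ext[OF inv_arr_simps(5), of f z] comp_ext[OF inv_arr_simps(6), of f z] by auto

lemma iso_inv [simp]:
  assumes "iso B f"
  shows "iso B (inv_arr B f)"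
  unfolding iso_def inverse_arrows_def by (rule exI[of _ f]) (use assms in \<open>simp add: hom_def\<close>)

lemma iso_comp:
  assumes "iso B f" "iso B g" "Dom B g = Cod B f"
  shows "iso B (g \<cdot> f)"
  unfolding iso_def inverse_arrows_def
  by (rule exI[of _ "inv_arr B f \<cdot> inv_arr B g"]) (use assms in \<open>simp add: hom_def\<close>)

lemma iso_Id [simp]: "X \<in> Obj B \<Longrightarrow> iso B (Id B X)"
  unfolding iso_def inverse_arrows_def by (rule exI[of _ "Id B X"]) (simp add: hom_def)

lemma inv_Id [simp]: "X \<in> Obj B \<Longrightarrow> inv_arr B (Id B X) = Id B X"
  by (rule inv_arr_eq) (simp add: inverse_arrows_def hom_def)

lemma iso_epi:
  assumes "f \<cdot> k = g \<cdot> k" "iso B k" "f \<in> Arr B" "g \<in> Arr B" "Dom B f = Cod B k" "Dom B g = Cod B k"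
  shows "f = g"
proof -
  have "(f \<cdot> k) \<cdot> inv_arr B k = (g \<cdot> k) \<cdot> inv_arr B k" using assms by simp
  then show ?thesis using assms(2-6) by simp
qed

lemma iso_mono:
  assumes "k \<cdot> f = k \<cdot> g" "iso B k" "f \<in> Arr B" "g \<in> Arr B" "Cod B f = Dom B k" "Cod B g = Dom B k"
  shows "f = g"
proof -
  have "inv_arr B k \<cdot> k \<cdot> f = inv_arr B k \<cdot> k \<cdot> g" using assms by simp
  then show ?thesis using assms(2-6) by simp
qed

end

section \<open>Unit coherence from the pentagon and the triangle\<close>

context monoidal_category
begin

lemma unit_Obj' [simp]: "\<one> \<in> Obj B" by (rule unit_Obj)

lemma tensor_Obj' [simp]: "X \<in> Obj B \<Longrightarrow> Y \<in> Obj B \<Longrightarrow> X \<otimes>\<^sub>o Y \<in> Obj B" by (rule tensor_Obj)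

lemma tensor_Arr [simp]:
  assumes "f \<in> Arr B" "g \<in> Arr B"
  shows "f \<otimes> g \<in> Arr B" "Dom B (f \<otimes> g) = Dom B f \<otimes>\<^sub>o Dom B g" "Cod B (f \<otimes> g) = Cod B f \<otimes>\<^sub>o Cod B g"
  using homD[OF tensor_hom[OF Arr_hom Arr_hom, OF assms]] by simp_all

lemma interchange:
  assumes "f \<in> Arr B" "f' \<in> Arr B" "g \<in> Arr B" "g' \<in> Arr B" "Dom B f' = Cod B f" "Dom B g' = Cod B g"
  shows "(f' \<otimes> g') \<cdot> (f \<otimes> g) = (f' \<cdot> f) \<otimes> (g' \<cdot> g)"
  using tensor_comp[of f "Dom B f" "Cod B f" f' "Cod B f'" g "Dom B g" "Cod B g" g' "Cod B g'"] assms
  by (simp add: hom_def)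

lemma interchange_ext:
  assumes "f \<in> Arr B" "f' \<in> Arr B" "g \<in> Arr B" "g' \<in> Arr B" "Dom B f' = Cod B f" "Dom B g' = Cod B g"
    "z \<in> Arr B" "Cod B z = Dom B f \<otimes>\<^sub>o Dom B g"
  shows "(f' \<otimes> g') \<cdot> (f \<otimes> g) \<cdot> z = ((f' \<cdot> f) \<otimes> (g' \<cdot> g)) \<cdot> z"
  using comp_ext[OF interchange] assms by simp

lemmas merge = interchange interchange_ext

lemma tensor_Id' [simp]: "X \<in> Obj B \<Longrightarrow> Y \<in> Obj B \<Longrightarrow> Id B X \<otimes> Id B Y = Id B (X \<otimes>\<^sub>o Y)"
  by (rule tensor_Id)

lemma constraint_Arr [simp]:
  assumes "X \<in> Obj B"
  shows "lunit B X \<in> Arr B" "Dom B (lunit B X) = \<one> \<otimes>\<^sub>o X" "Cod B (lunit B X) = X" "iso B (lunit B X)"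
    "runit B X \<in> Arr B" "Dom B (runit B X) = X \<otimes>\<^sub>o \<one>" "Cod B (runit B X) = X" "iso B (runit B X)"
  using homD[OF lunit_hom[OF assms]] homD[OF runit_hom[OF assms]] lunit_iso runit_iso assms by simp_all

lemma assoc_Arr [simp]:
  assumes "X \<in> Obj B" "Y \<in> Obj B" "Z \<in> Obj B"
  shows "assoc B X Y Z \<in> Arr B" "Dom B (assoc B X Y Z) = (X \<otimes>\<^sub>o Y) \<otimes>\<^sub>o Z"
    "Cod B (assoc B X Y Z) = X \<otimes>\<^sub>o Y \<otimes>\<^sub>o Z" "iso B (assoc B X Y Z)"
  using homD[OF assoc_hom[OF assms]] assoc_iso[OF assms] by simp_all

lemma iso_tensor [simp]:
  assumes "iso B f" "iso B g"
  shows "iso B (f \<otimes> g)"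
  unfolding iso_def inverse_arrows_def
  by (rule exI[of _ "inv_arr B f \<otimes> inv_arr B g"]) (use assms in \<open>simp add: hom_def merge\<close>)

lemma inv_tensor [simp]:
  assumes "iso B f" "iso B g"
  shows "inv_arr B (f \<otimes> g) = inv_arr B f \<otimes> inv_arr B g"
  by (rule inv_arr_eq) (use assms in \<open>simp add: inverse_arrows_def hom_def merge\<close>)

lemma assoc_nat:
  assumes "f \<in> Arr B" "g \<in> Arr B" "h \<in> Arr B" "Cod B f = X" "Cod B g = Y" "Cod B h = Z"
  shows "assoc B X Y Z \<cdot> ((f \<otimes> g) \<otimes> h) = (f \<otimes> g \<otimes> h) \<cdot> assoc B (Dom B f) (Dom B g) (Dom B h)"
  using assoc_natural[OF Arr_hom Arr_hom Arr_hom, of f g h] assms by simp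

lemma assoc_nat_ext:
  assumes "f \<in> Arr B" "g \<in> Arr B" "h \<in> Arr B" "Cod B f = X" "Cod B g = Y" "Cod B h = Z"
    "z \<in> Arr B" "Cod B z = (Dom B f \<otimes>\<^sub>o Dom B g) \<otimes>\<^sub>o Dom B h"
  shows "assoc B X Y Z \<cdot> ((f \<otimes> g) \<otimes> h) \<cdot> z = (f \<otimes> g \<otimes> h) \<cdot> assoc B (Dom B f) (Dom B g) (Dom B h) \<cdot> z"
  using comp_ext[OF assoc_nat[OF assms(1-6)], of z] assms by auto

lemma assoc_inv_nat:
  assumes "f \<in> Arr B" "g \<in> Arr B" "h \<in> Arr B" "Cod B f = X" "Cod B g = Y" "Cod B h = Z"
  shows "inv_arr B (assoc B X Y Z) \<cdot> (f \<otimes> g \<otimes> h)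
    = ((f \<otimes> g) \<otimes> h) \<cdot> inv_arr B (assoc B (Dom B f) (Dom B g) (Dom B h))"
proof (rule iso_mono[of "assoc B X Y Z"])
  show "assoc B X Y Z \<cdot> inv_arr B (assoc B X Y Z) \<cdot> (f \<otimes> g \<otimes> h)
    = assoc B X Y Z \<cdot> ((f \<otimes> g) \<otimes> h) \<cdot> inv_arr B (assoc B (Dom B f) (Dom B g) (Dom B h))"
    using assms by (auto simp: assoc_nat_ext)
qed (use assms in auto)

lemma assoc_inv_nat_ext:
  assumes "f \<in> Arr B" "g \<in> Arr B" "h \<in> Arr B" "Cod B f = X" "Cod B g = Y" "Cod B h = Z"
    "z \<in> Arr B" "Cod B z = Dom B f \<otimes>\<^sub>o Dom B g \<otimes>\<^sub>o Dom B h"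
  shows "inv_arr B (assoc B X Y Z) \<cdot> (f \<otimes> g \<otimes> h) \<cdot> z
    = ((f \<otimes> g) \<otimes> h) \<cdot> inv_arr B (assoc B (Dom B f) (Dom B g) (Dom B h)) \<cdot> z"
  using comp_ext[OF assoc_inv_nat[OF assms(1-6)], of z] assms by auto

lemma lunit_nat: "f \<in> Arr B \<Longrightarrow> lunit B (Cod B f) \<cdot> (Id B \<one> \<otimes> f) = f \<cdot> lunit B (Dom B f)"
  by (rule lunit_natural) (rule Arr_hom)

lemma runit_nat: "f \<in> Arr B \<Longrightarrow> runit B (Cod B f) \<cdot> (f \<otimes> Id B \<one>) = f \<cdot> runit B (Dom B f)"
  by (rule runit_natural) (rule Arr_hom)

lemma assoc_inv_nat_left:
  assumes "f \<in> Arr B" "Y \<in> Obj B" "Z \<in> Obj B" "Cod B f = X"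
  shows "inv_arr B (assoc B X Y Z) \<cdot> (f \<otimes> Id B (Y \<otimes>\<^sub>o Z))
    = ((f \<otimes> Id B Y) \<otimes> Id B Z) \<cdot> inv_arr B (assoc B (Dom B f) Y Z)"
    and "z \<in> Arr B \<Longrightarrow> Cod B z = Dom B f \<otimes>\<^sub>o Y \<otimes>\<^sub>o Z \<Longrightarrow>
      inv_arr B (assoc B X Y Z) \<cdot> (f \<otimes> Id B (Y \<otimes>\<^sub>o Z)) \<cdot> z
    = ((f \<otimes> Id B Y) \<otimes> Id B Z) \<cdot> inv_arr B (assoc B (Dom B f) Y Z) \<cdot> z"
  using assoc_inv_nat[of f "Id B Y" "Id B Z" X Y Z] assoc_inv_nat_ext[of f "Id B Y" "Id B Z" X Y Z z] assms
  by auto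

lemma assoc_nat_right:
  assumes "f \<in> Arr B" "X \<in> Obj B" "Y \<in> Obj B" "Cod B f = Z"
  shows "assoc B X Y Z \<cdot> (Id B (X \<otimes>\<^sub>o Y) \<otimes> f)
    = (Id B X \<otimes> Id B Y \<otimes> f) \<cdot> assoc B X Y (Dom B f)"
    and "z \<in> Arr B \<Longrightarrow> Cod B z = (X \<otimes>\<^sub>o Y) \<otimes>\<^sub>o Dom B f \<Longrightarrow>
      assoc B X Y Z \<cdot> (Id B (X \<otimes>\<^sub>o Y) \<otimes> f) \<cdot> z
    = (Id B X \<otimes> Id B Y \<otimes> f) \<cdot> assoc B X Y (Dom B f) \<cdot> z"
  using assoc_nat[of "Id B X" "Id B Y" f X Y Z] assoc_nat_ext[of "Id B X" "Id B Y" f X Y Z z] assms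
  by auto

lemmas shuffle = assoc_nat assoc_nat_ext assoc_inv_nat assoc_inv_nat_ext assoc_inv_nat_left
  assoc_nat_right

lemma split:
  assumes "X \<in> Obj B" "f \<in> Arr B" "g \<in> Arr B" "Dom B g = Cod B f"
  shows "Id B X \<otimes> (g \<cdot> f) = (Id B X \<otimes> g) \<cdot> (Id B X \<otimes> f)"
    and "(g \<cdot> f) \<otimes> Id B X = (g \<otimes> Id B X) \<cdot> (f \<otimes> Id B X)"
  using assms by (simp_all add: interchange)

lemma lunit_nat_ext:
  assumes "f \<in> Arr B" "z \<in> Arr B" "Cod B z = \<one> \<otimes>\<^sub>o Dom B f" "Cod B f = X"
  shows "lunit B X \<cdot> (Id B \<one> \<otimes> f) \<cdot> z = f \<cdot> lunit B (Dom B f) \<cdot> z"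
  using comp_ext[OF lunit_nat[of f]] assms by auto

lemma lunit_inv_nat:
  assumes "f \<in> Arr B" "Cod B f = X"
  shows "inv_arr B (lunit B X) \<cdot> f = (Id B \<one> \<otimes> f) \<cdot> inv_arr B (lunit B (Dom B f))"
    and "z \<in> Arr B \<Longrightarrow> Cod B z = Dom B f \<Longrightarrow>
      inv_arr B (lunit B X) \<cdot> f \<cdot> z = (Id B \<one> \<otimes> f) \<cdot> inv_arr B (lunit B (Dom B f)) \<cdot> z"
proof -
  show 1: "inv_arr B (lunit B X) \<cdot> f = (Id B \<one> \<otimes> f) \<cdot> inv_arr B (lunit B (Dom B f))"
  proof (rule iso_mono[of "lunit B X"])
    show "lunit B X \<cdot> inv_arr B (lunit B X) \<cdot> f = lunit B X \<cdot> (Id B \<one> \<otimes> f) \<cdot> inv_arr B (lunit B (Dom B f))"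
      using assms by (auto simp: lunit_nat_ext)
  qed (use assms in auto)
  show "z \<in> Arr B \<Longrightarrow> Cod B z = Dom B f \<Longrightarrow>
      inv_arr B (lunit B X) \<cdot> f \<cdot> z = (Id B \<one> \<otimes> f) \<cdot> inv_arr B (lunit B (Dom B f)) \<cdot> z"
    using comp_ext[OF 1, of z] assms by auto
qed

text \<open>Naturality of the invertible unit constraint recovers an arrow from its product with the
  unit. Unit coherence can thus be proved after tensoring, where pentagon and triangle
  apply.\<close>

lemma unit_tensor_faithful:
  assumes "Id B \<one> \<otimes> f = Id B \<one> \<otimes> g" "f \<in> Arr B" "g \<in> Arr B" "Dom B f = Dom B g" "Cod B f = Cod B g"
  shows "f = g"
proof (rule iso_epi)
  show "f \<cdot> lunit B (Dom B f) = g \<cdot> lunit B (Dom B f)"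
    using lunit_nat[OF assms(2)] lunit_nat[OF assms(3)] unfolding assms(1,4,5) by (rule trans[OF sym])
qed (use assms in simp_all)

lemma tensor_unit_faithful:
  assumes "f \<otimes> Id B \<one> = g \<otimes> Id B \<one>" "f \<in> Arr B" "g \<in> Arr B" "Dom B f = Dom B g" "Cod B f = Cod B g"
  shows "f = g"
proof (rule iso_epi)
  show "f \<cdot> runit B (Dom B f) = g \<cdot> runit B (Dom B f)"
    using runit_nat[OF assms(2)] runit_nat[OF assms(3)] unfolding assms(1,4,5) by (rule trans[OF sym])
qed (use assms in simp_all)

text \<open>Kelly's argument: composed with the invertible \<open>?k\<close>, the claim follows from
  the pentagon for \<one>, \<one>, X, Y and two triangles.\<close>

lemma lunit_tensor:
  assumes X [simp]: "X \<in> Obj B" and Y [simp]: "Y \<in> Obj B"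
  shows "lunit B (X \<otimes>\<^sub>o Y) \<cdot> assoc B \<one> X Y = lunit B X \<otimes> Id B Y"
proof (rule unit_tensor_faithful)
  let ?k = "assoc B \<one> (\<one> \<otimes>\<^sub>o X) Y \<cdot> (assoc B \<one> \<one> X \<otimes> Id B Y)"
  show "Id B \<one> \<otimes> (lunit B (X \<otimes>\<^sub>o Y) \<cdot> assoc B \<one> X Y) = Id B \<one> \<otimes> (lunit B X \<otimes> Id B Y)"
  proof (rule iso_epi[of _ ?k])
    have "(Id B \<one> \<otimes> (lunit B (X \<otimes>\<^sub>o Y) \<cdot> assoc B \<one> X Y)) \<cdot> ?k
        = (Id B \<one> \<otimes> lunit B (X \<otimes>\<^sub>o Y)) \<cdot> (Id B \<one> \<otimes> assoc B \<one> X Y) \<cdot> ?k"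
      by (simp add: merge)
    also have "\<dots> = (runit B \<one> \<otimes> Id B (X \<otimes>\<^sub>o Y)) \<cdot> assoc B (\<one> \<otimes>\<^sub>o \<one>) X Y"
      using pentagon[of \<one> \<one> X Y] comp_ext[OF triangle[of \<one> "X \<otimes>\<^sub>o Y"]] by simp
    also have "\<dots> = assoc B \<one> X Y \<cdot> ((runit B \<one> \<otimes> Id B X) \<otimes> Id B Y)"
      by (simp add: assoc_nat)
    also have "\<dots> = assoc B \<one> X Y \<cdot> ((Id B \<one> \<otimes> lunit B X) \<otimes> Id B Y) \<cdot> (assoc B \<one> \<one> X \<otimes> Id B Y)"
      by (simp add: merge flip: triangle)
    also have "\<dots> = (Id B \<one> \<otimes> lunit B X \<otimes> Id B Y) \<cdot> ?k"
      by (simp add: assoc_nat_ext)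
    finally show "(Id B \<one> \<otimes> (lunit B (X \<otimes>\<^sub>o Y) \<cdot> assoc B \<one> X Y)) \<cdot> ?k = (Id B \<one> \<otimes> lunit B X \<otimes> Id B Y) \<cdot> ?k" .
  qed (simp_all add: iso_comp)
qed simp_all

lemma runit_tensor:
  assumes X [simp]: "X \<in> Obj B" and Y [simp]: "Y \<in> Obj B"
  shows "(Id B X \<otimes> runit B Y) \<cdot> assoc B X Y \<one> = runit B (X \<otimes>\<^sub>o Y)"
proof (rule tensor_unit_faithful)
  show "((Id B X \<otimes> runit B Y) \<cdot> assoc B X Y \<one>) \<otimes> Id B \<one> = runit B (X \<otimes>\<^sub>o Y) \<otimes> Id B \<one>"
  proof (rule iso_mono[of "assoc B X Y \<one>"])
    have "assoc B X Y \<one> \<cdot> (((Id B X \<otimes> runit B Y) \<cdot> assoc B X Y \<one>) \<otimes> Id B \<one>)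
        = assoc B X Y \<one> \<cdot> ((Id B X \<otimes> runit B Y) \<otimes> Id B \<one>) \<cdot> (assoc B X Y \<one> \<otimes> Id B \<one>)"
      by (simp add: merge)
    also have "\<dots> = (Id B X \<otimes> (runit B Y \<otimes> Id B \<one>)) \<cdot> assoc B X (Y \<otimes>\<^sub>o \<one>) \<one> \<cdot> (assoc B X Y \<one> \<otimes> Id B \<one>)"
      by (simp add: assoc_nat_ext)
    also have "\<dots> = (Id B X \<otimes> (Id B Y \<otimes> lunit B \<one>)) \<cdot> (Id B X \<otimes> assoc B Y \<one> \<one>) \<cdot> assoc B X (Y \<otimes>\<^sub>o \<one>) \<one> \<cdot> (assoc B X Y \<one> \<otimes> Id B \<one>)"
      by (simp add: merge flip: triangle)
    also have "\<dots> = (Id B X \<otimes> (Id B Y \<otimes> lunit B \<one>)) \<cdot> assoc B X Y (\<one> \<otimes>\<^sub>o \<one>) \<cdot> assoc B (X \<otimes>\<^sub>o Y) \<one> \<one>"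
      using pentagon[of X Y \<one> \<one>] by simp
    also have "\<dots> = assoc B X Y \<one> \<cdot> ((Id B X \<otimes> Id B Y) \<otimes> lunit B \<one>) \<cdot> assoc B (X \<otimes>\<^sub>o Y) \<one> \<one>"
      using assoc_nat_ext[of "Id B X" "Id B Y" "lunit B \<one>" X Y \<one> "assoc B (X \<otimes>\<^sub>o Y) \<one> \<one>"] by simp
    also have "\<dots> = assoc B X Y \<one> \<cdot> (runit B (X \<otimes>\<^sub>o Y) \<otimes> Id B \<one>)"
      using triangle[of "X \<otimes>\<^sub>o Y" \<one>] by simp
    finally show "assoc B X Y \<one> \<cdot> (((Id B X \<otimes> runit B Y) \<cdot> assoc B X Y \<one>) \<otimes> Id B \<one>)
        = assoc B X Y \<one> \<cdot> (runit B (X \<otimes>\<^sub>o Y) \<otimes> Id B \<one>)" .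
  qed simp_all
qed simp_all

lemma lunit_runit_unit: "lunit B \<one> = runit B \<one>"
proof (rule tensor_unit_faithful)
  have "lunit B (\<one> \<otimes>\<^sub>o \<one>) = Id B \<one> \<otimes> lunit B \<one>"
    using lunit_nat[of "lunit B \<one>"] iso_mono[of "lunit B \<one>"] by simp
  then show "lunit B \<one> \<otimes> Id B \<one> = runit B \<one> \<otimes> Id B \<one>"
    using lunit_tensor[of \<one> \<one>] triangle[of \<one> \<one>] by simp
qed simp_all

lemma lunit_tensor_inv:
  assumes [simp]: "X \<in> Obj B" "Y \<in> Obj B"
  shows "assoc B \<one> X Y \<cdot> (inv_arr B (lunit B X) \<otimes> Id B Y) = inv_arr B (lunit B (X \<otimes>\<^sub>o Y))"
    and "(lunit B X \<otimes> Id B Y) \<cdot> inv_arr B (assoc B \<one> X Y) = lunit B (X \<otimes>\<^sub>o Y)"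
proof -
  show "assoc B \<one> X Y \<cdot> (inv_arr B (lunit B X) \<otimes> Id B Y) = inv_arr B (lunit B (X \<otimes>\<^sub>o Y))"
  proof (rule iso_mono[of "lunit B (X \<otimes>\<^sub>o Y)"])
    show "lunit B (X \<otimes>\<^sub>o Y) \<cdot> assoc B \<one> X Y \<cdot> (inv_arr B (lunit B X) \<otimes> Id B Y)
      = lunit B (X \<otimes>\<^sub>o Y) \<cdot> inv_arr B (lunit B (X \<otimes>\<^sub>o Y))"
      using comp_ext[OF lunit_tensor[of X Y]] by (simp add: merge)
  qed simp_all
qed (simp flip: lunit_tensor)

lemma triangle_inv:
  assumes [simp]: "X \<in> Obj B" "Y \<in> Obj B"
  shows "(runit B X \<otimes> Id B Y) \<cdot> inv_arr B (assoc B X \<one> Y) = Id B X \<otimes> lunit B Y"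
    and "inv_arr B (assoc B X \<one> Y) \<cdot> (Id B X \<otimes> inv_arr B (lunit B Y)) = inv_arr B (runit B X) \<otimes> Id B Y"
proof -
  show 1: "(runit B X \<otimes> Id B Y) \<cdot> inv_arr B (assoc B X \<one> Y) = Id B X \<otimes> lunit B Y"
    by (simp flip: triangle)
  show "inv_arr B (assoc B X \<one> Y) \<cdot> (Id B X \<otimes> inv_arr B (lunit B Y)) = inv_arr B (runit B X) \<otimes> Id B Y"
  proof (rule iso_mono[of "runit B X \<otimes> Id B Y"])
    show "(runit B X \<otimes> Id B Y) \<cdot> inv_arr B (assoc B X \<one> Y) \<cdot> (Id B X \<otimes> inv_arr B (lunit B Y))
        = (runit B X \<otimes> Id B Y) \<cdot> (inv_arr B (runit B X) \<otimes> Id B Y)"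
      using comp_ext[OF 1] by (simp add: interchange)
  qed simp_all
qed

end

section \<open>Braidings next to a spectator\<close>

context braided_monoidal_category
begin

lemma braid_Arr [simp]:
  assumes "X \<in> Obj B" "Y \<in> Obj B"
  shows "braid B X Y \<in> Arr B" "Dom B (braid B X Y) = X \<otimes>\<^sub>o Y" "Cod B (braid B X Y) = Y \<otimes>\<^sub>o X"
    "iso B (braid B X Y)"
  using homD[OF braid_hom[OF assms]] braid_iso[OF assms] by simp_all

lemma braid_nat: "f \<in> Arr B \<Longrightarrow> g \<in> Arr B \<Longrightarrow>
    braid B (Cod B f) (Cod B g) \<cdot> (f \<otimes> g) = (g \<otimes> f) \<cdot> braid B (Dom B f) (Dom B g)"
  by (rule braid_natural) (rule Arr_hom, assumption)+

text \<open>The hexagon with both passed objects equal to the unit gives \<open>?k\<close> times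
  \<open>?k \<otimes> Id B \<one>\<close> on one side and \<open>?k\<close> times
  \<open>runit B X \<otimes> Id B \<one>\<close> on the other; the invertible \<open>?k\<close>
  cancels.\<close>

lemma lunit_braid:
  assumes X [simp]: "X \<in> Obj B"
  shows "lunit B X \<cdot> braid B X \<one> = runit B X"
proof (rule tensor_unit_faithful)
  let ?k = "lunit B X \<cdot> braid B X \<one>"
  have "?k \<cdot> (runit B X \<otimes> Id B \<one>) = ?k \<cdot> (Id B X \<otimes> lunit B \<one>) \<cdot> assoc B X \<one> \<one>"
    by (simp add: merge flip: triangle)
  also have "\<dots> = lunit B X \<cdot> (braid B X \<one> \<cdot> (Id B X \<otimes> runit B \<one>)) \<cdot> assoc B X \<one> \<one>"
    by (simp add: merge lunit_runit_unit)
  also have "\<dots> = lunit B X \<cdot> (runit B \<one> \<otimes> Id B X) \<cdot> braid B X (\<one> \<otimes>\<^sub>o \<one>) \<cdot> assoc B X \<one> \<one>"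
    using braid_nat[of "Id B X" "runit B \<one>"] by simp
  also have "\<dots> = lunit B X \<cdot> (Id B \<one> \<otimes> lunit B X) \<cdot> assoc B \<one> \<one> X \<cdot> braid B X (\<one> \<otimes>\<^sub>o \<one>) \<cdot> assoc B X \<one> \<one>"
    by (simp add: merge flip: triangle)
  also have "\<dots> = lunit B X \<cdot> (Id B \<one> \<otimes> ?k) \<cdot> assoc B \<one> X \<one> \<cdot> (braid B X \<one> \<otimes> Id B \<one>)"
    by (simp add: merge hexagon_right)
  also have "\<dots> = ?k \<cdot> lunit B (X \<otimes>\<^sub>o \<one>) \<cdot> assoc B \<one> X \<one> \<cdot> (braid B X \<one> \<otimes> Id B \<one>)"
    using comp_ext[OF lunit_nat[of ?k]] by simp
  also have "\<dots> = ?k \<cdot> (?k \<otimes> Id B \<one>)"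
    using comp_ext[OF lunit_tensor[of X \<one>]] by (simp add: merge)
  finally have "?k \<cdot> (?k \<otimes> Id B \<one>) = ?k \<cdot> (runit B X \<otimes> Id B \<one>)" by simp
  then show "?k \<otimes> Id B \<one> = runit B X \<otimes> Id B \<one>"
    by (rule iso_mono) (simp_all add: iso_comp)
qed simp_all


lemma runit_braid:
  assumes X [simp]: "X \<in> Obj B"
  shows "runit B X \<cdot> braid B \<one> X = lunit B X"
proof (rule unit_tensor_faithful)
  let ?k = "runit B X \<cdot> braid B \<one> X"
  let ?a = "inv_arr B (assoc B X \<one> \<one>)" and ?b = "inv_arr B (assoc B \<one> \<one> X)"
  let ?c = "inv_arr B (assoc B \<one> X \<one>)"
  have tri: "(runit B Z \<otimes> Id B Y) \<cdot> inv_arr B (assoc B Z \<one> Y) = Id B Z \<otimes> lunit B Y"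
    if [simp]: "Z \<in> Obj B" "Y \<in> Obj B" for Y Z
    by (simp flip: triangle)
  have "?k \<cdot> (Id B \<one> \<otimes> lunit B X) = ?k \<cdot> (lunit B \<one> \<otimes> Id B X) \<cdot> ?b"
    using tri[of \<one> X] by (simp add: lunit_runit_unit)
  also have "\<dots> = runit B X \<cdot> (braid B \<one> X \<cdot> (lunit B \<one> \<otimes> Id B X)) \<cdot> ?b"
    by simp
  also have "\<dots> = runit B X \<cdot> (Id B X \<otimes> lunit B \<one>) \<cdot> braid B (\<one> \<otimes>\<^sub>o \<one>) X \<cdot> ?b"
    using braid_nat[of "lunit B \<one>" "Id B X"] by simp
  also have "\<dots> = runit B X \<cdot> (runit B X \<otimes> Id B \<one>) \<cdot> ?a \<cdot> braid B (\<one> \<otimes>\<^sub>o \<one>) X \<cdot> ?b"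
    using comp_ext[OF tri[of X \<one>]] by simp
  also have "\<dots> = runit B X \<cdot> (?k \<otimes> Id B \<one>) \<cdot> ?c \<cdot> (Id B \<one> \<otimes> braid B \<one> X)"
    by (simp add: merge hexagon_left)
  also have "\<dots> = ?k \<cdot> runit B (\<one> \<otimes>\<^sub>o X) \<cdot> ?c \<cdot> (Id B \<one> \<otimes> braid B \<one> X)"
    using comp_ext[OF runit_nat[of ?k]] by simp
  also have "\<dots> = ?k \<cdot> (Id B \<one> \<otimes> ?k)"
    by (simp add: merge flip: runit_tensor)
  finally have "?k \<cdot> (Id B \<one> \<otimes> ?k) = ?k \<cdot> (Id B \<one> \<otimes> lunit B X)" by simp
  then show "Id B \<one> \<otimes> ?k = Id B \<one> \<otimes> lunit B X"
    by (rule iso_mono) (simp_all add: iso_comp)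
qed simp_all

text \<open>\<open>past X Y R : X \<otimes> (Y \<otimes> R) \<rightarrow> Y \<otimes> (X \<otimes> R)\<close> is the braiding next to a spectator \<open>R\<close>, rebracketed.\<close>

definition past :: "'o \<Rightarrow> 'o \<Rightarrow> 'o \<Rightarrow> 'm" where
  "past X Y R = assoc B Y X R \<cdot> (braid B X Y \<otimes> Id B R) \<cdot> inv_arr B (assoc B X Y R)"

lemma past_Arr [simp]:
  assumes "X \<in> Obj B" "Y \<in> Obj B" "R \<in> Obj B"
  shows "past X Y R \<in> Arr B" "Dom B (past X Y R) = X \<otimes>\<^sub>o Y \<otimes>\<^sub>o R" "Cod B (past X Y R) = Y \<otimes>\<^sub>o X \<otimes>\<^sub>o R"
  using assms by (simp_all add: past_def)

lemma past_nat:
  assumes "f \<in> Arr B" "g \<in> Arr B" "k \<in> Arr B"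
  shows "past (Cod B f) (Cod B g) (Cod B k) \<cdot> (f \<otimes> g \<otimes> k) = (g \<otimes> f \<otimes> k) \<cdot> past (Dom B f) (Dom B g) (Dom B k)"
proof -
  have "past (Cod B f) (Cod B g) (Cod B k) \<cdot> (f \<otimes> g \<otimes> k)
     = assoc B (Cod B g) (Cod B f) (Cod B k) \<cdot> ((braid B (Cod B f) (Cod B g) \<cdot> (f \<otimes> g)) \<otimes> k)
        \<cdot> inv_arr B (assoc B (Dom B f) (Dom B g) (Dom B k))"
    using assms by (simp add: past_def assoc_inv_nat merge)
  also have "\<dots> = assoc B (Cod B g) (Cod B f) (Cod B k) \<cdot> ((g \<otimes> f) \<otimes> k) \<cdot> (braid B (Dom B f) (Dom B g) \<otimes> Id B (Dom B k))
        \<cdot> inv_arr B (assoc B (Dom B f) (Dom B g) (Dom B k))"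
    using assms by (simp add: merge braid_nat)
  finally show ?thesis using assms by (simp add: past_def assoc_nat_ext)
qed

lemma pentagon_solved:
  assumes [simp]: "W \<in> Obj B" "X \<in> Obj B" "Y \<in> Obj B" "Z \<in> Obj B"
  shows "assoc B W (X \<otimes>\<^sub>o Y) Z \<cdot> (assoc B W X Y \<otimes> Id B Z)
      = (Id B W \<otimes> inv_arr B (assoc B X Y Z)) \<cdot> assoc B W X (Y \<otimes>\<^sub>o Z) \<cdot> assoc B (W \<otimes>\<^sub>o X) Y Z" (is ?A)
    and "assoc B (W \<otimes>\<^sub>o X) Y Z \<cdot> (inv_arr B (assoc B W X Y) \<otimes> Id B Z) \<cdot> inv_arr B (assoc B W (X \<otimes>\<^sub>o Y) Z)
      = inv_arr B (assoc B W X (Y \<otimes>\<^sub>o Z)) \<cdot> (Id B W \<otimes> assoc B X Y Z)" (is ?B)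
    and "inv_arr B (assoc B W (X \<otimes>\<^sub>o Y) Z) \<cdot> (Id B W \<otimes> inv_arr B (assoc B X Y Z)) \<cdot> assoc B W X (Y \<otimes>\<^sub>o Z)
      = (assoc B W X Y \<otimes> Id B Z) \<cdot> inv_arr B (assoc B (W \<otimes>\<^sub>o X) Y Z)" (is ?C)
proof -
  show ?A
    by (rule iso_mono[of "Id B W \<otimes> assoc B X Y Z"]) (simp_all add: pentagon interchange_ext)
  show ?B
  proof (rule iso_epi[of _ "assoc B W (X \<otimes>\<^sub>o Y) Z \<cdot> (assoc B W X Y \<otimes> Id B Z)"])
    show "(assoc B (W \<otimes>\<^sub>o X) Y Z \<cdot> (inv_arr B (assoc B W X Y) \<otimes> Id B Z) \<cdot> inv_arr B (assoc B W (X \<otimes>\<^sub>o Y) Z))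
        \<cdot> assoc B W (X \<otimes>\<^sub>o Y) Z \<cdot> (assoc B W X Y \<otimes> Id B Z)
      = (inv_arr B (assoc B W X (Y \<otimes>\<^sub>o Z)) \<cdot> (Id B W \<otimes> assoc B X Y Z)) \<cdot> assoc B W (X \<otimes>\<^sub>o Y) Z \<cdot> (assoc B W X Y \<otimes> Id B Z)"
      by (simp add: pentagon interchange)
  qed (simp_all add: iso_comp)
  show ?C
  proof (rule iso_epi[of _ "assoc B (W \<otimes>\<^sub>o X) Y Z"])
    show "(inv_arr B (assoc B W (X \<otimes>\<^sub>o Y) Z) \<cdot> (Id B W \<otimes> inv_arr B (assoc B X Y Z)) \<cdot> assoc B W X (Y \<otimes>\<^sub>o Z))
        \<cdot> assoc B (W \<otimes>\<^sub>o X) Y Z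
      = ((assoc B W X Y \<otimes> Id B Z) \<cdot> inv_arr B (assoc B (W \<otimes>\<^sub>o X) Y Z)) \<cdot> assoc B (W \<otimes>\<^sub>o X) Y Z"
      using \<open>?A\<close>[symmetric] by simp
  qed simp_all
qed

text \<open>The hexagon with a spectator. Together with \<open>past_tensor_left\<close> and the two
  unit lemmas it is the source of the crossing rules for generators with two legs or none.\<close>

lemma past_tensor_right:
  assumes [simp]: "X \<in> Obj B" "Y \<in> Obj B" "Z \<in> Obj B" "R \<in> Obj B"
  shows "assoc B Y Z (X \<otimes>\<^sub>o R) \<cdot> past X (Y \<otimes>\<^sub>o Z) R
    = (Id B Y \<otimes> past X Z R) \<cdot> past X Y (Z \<otimes>\<^sub>o R) \<cdot> (Id B X \<otimes> assoc B Y Z R)"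
proof -
  let ?w = "inv_arr B (assoc B X (Y \<otimes>\<^sub>o Z) R)" and ?v = "inv_arr B (assoc B X Y Z)"
  have hex: "assoc B Y Z X \<cdot> braid B X (Y \<otimes>\<^sub>o Z)
      = (Id B Y \<otimes> braid B X Z) \<cdot> assoc B Y X Z \<cdot> (braid B X Y \<otimes> Id B Z) \<cdot> ?v"
  proof (rule iso_epi[of _ "assoc B X Y Z"])
    show "(assoc B Y Z X \<cdot> braid B X (Y \<otimes>\<^sub>o Z)) \<cdot> assoc B X Y Z
      = ((Id B Y \<otimes> braid B X Z) \<cdot> assoc B Y X Z \<cdot> (braid B X Y \<otimes> Id B Z) \<cdot> ?v) \<cdot> assoc B X Y Z"
      by (simp add: hexagon_right)
  qed simp_all
  have "assoc B Y Z (X \<otimes>\<^sub>o R) \<cdot> past X (Y \<otimes>\<^sub>o Z) R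
    = (assoc B Y Z (X \<otimes>\<^sub>o R) \<cdot> assoc B (Y \<otimes>\<^sub>o Z) X R) \<cdot> (braid B X (Y \<otimes>\<^sub>o Z) \<otimes> Id B R) \<cdot> ?w"
    by (simp add: past_def)
  also have "\<dots> = (Id B Y \<otimes> assoc B Z X R) \<cdot> assoc B Y (Z \<otimes>\<^sub>o X) R \<cdot> ((assoc B Y Z X \<cdot> braid B X (Y \<otimes>\<^sub>o Z)) \<otimes> Id B R) \<cdot> ?w"
    by (simp add: merge flip: pentagon)
  also have "\<dots> = (Id B Y \<otimes> assoc B Z X R) \<cdot> assoc B Y (Z \<otimes>\<^sub>o X) R \<cdot> ((Id B Y \<otimes> braid B X Z) \<otimes> Id B R)
      \<cdot> (assoc B Y X Z \<otimes> Id B R) \<cdot> ((braid B X Y \<otimes> Id B Z) \<otimes> Id B R) \<cdot> (?v \<otimes> Id B R) \<cdot> ?w"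
    by (simp add: merge hex)
  also have "\<dots> = (Id B Y \<otimes> assoc B Z X R) \<cdot> (Id B Y \<otimes> braid B X Z \<otimes> Id B R) \<cdot> (assoc B Y (X \<otimes>\<^sub>o Z) R
      \<cdot> (assoc B Y X Z \<otimes> Id B R)) \<cdot> ((braid B X Y \<otimes> Id B Z) \<otimes> Id B R) \<cdot> (?v \<otimes> Id B R) \<cdot> ?w"
    by (simp add: assoc_nat_ext)
  also have "\<dots> = (Id B Y \<otimes> assoc B Z X R) \<cdot> (Id B Y \<otimes> braid B X Z \<otimes> Id B R) \<cdot> (Id B Y \<otimes> inv_arr B (assoc B X Z R))
      \<cdot> assoc B Y X (Z \<otimes>\<^sub>o R) \<cdot> (braid B X Y \<otimes> Id B (Z \<otimes>\<^sub>o R)) \<cdot> (assoc B (X \<otimes>\<^sub>o Y) Z R \<cdot> (?v \<otimes> Id B R) \<cdot> ?w)"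
    by (simp add: pentagon_solved(1) assoc_nat_ext)
  also have "\<dots> = (Id B Y \<otimes> past X Z R) \<cdot> past X Y (Z \<otimes>\<^sub>o R) \<cdot> (Id B X \<otimes> assoc B Y Z R)"
    by (simp add: pentagon_solved(2) past_def merge)
  finally show ?thesis .
qed

lemma past_tensor_left:
  assumes [simp]: "X \<in> Obj B" "Y \<in> Obj B" "Z \<in> Obj B" "R \<in> Obj B"
  shows "(Id B Z \<otimes> assoc B X Y R) \<cdot> past (X \<otimes>\<^sub>o Y) Z R
    = past X Z (Y \<otimes>\<^sub>o R) \<cdot> (Id B X \<otimes> past Y Z R) \<cdot> assoc B X Y (Z \<otimes>\<^sub>o R)"
proof -
  let ?w = "inv_arr B (assoc B (X \<otimes>\<^sub>o Y) Z R)" and ?v = "inv_arr B (assoc B X Z Y)"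
  have hex: "braid B (X \<otimes>\<^sub>o Y) Z
      = assoc B Z X Y \<cdot> (braid B X Z \<otimes> Id B Y) \<cdot> ?v \<cdot> (Id B X \<otimes> braid B Y Z) \<cdot> assoc B X Y Z"
  proof -
    have "braid B (X \<otimes>\<^sub>o Y) Z = assoc B Z X Y \<cdot> (inv_arr B (assoc B Z X Y) \<cdot> braid B (X \<otimes>\<^sub>o Y) Z
        \<cdot> inv_arr B (assoc B X Y Z)) \<cdot> assoc B X Y Z"
      by simp
    then show ?thesis by (simp only: hexagon_left[OF assms(1-3)]) simp
  qed
  have "(Id B Z \<otimes> assoc B X Y R) \<cdot> past (X \<otimes>\<^sub>o Y) Z R
     = ((Id B Z \<otimes> assoc B X Y R) \<cdot> assoc B Z (X \<otimes>\<^sub>o Y) R \<cdot> (assoc B Z X Y \<otimes> Id B R)) \<cdot> ((braid B X Z \<otimes> Id B Y) \<otimes> Id B R)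
      \<cdot> (?v \<otimes> Id B R) \<cdot> ((Id B X \<otimes> braid B Y Z) \<otimes> Id B R) \<cdot> (assoc B X Y Z \<otimes> Id B R) \<cdot> ?w"
    by (simp add: past_def hex merge)
  also have "\<dots> = assoc B Z X (Y \<otimes>\<^sub>o R) \<cdot> (braid B X Z \<otimes> Id B (Y \<otimes>\<^sub>o R)) \<cdot> (assoc B (X \<otimes>\<^sub>o Z) Y R
      \<cdot> (?v \<otimes> Id B R) \<cdot> ((Id B X \<otimes> braid B Y Z) \<otimes> Id B R)
      \<cdot> (inv_arr B (assoc B X (Y \<otimes>\<^sub>o Z) R) \<cdot> (Id B X \<otimes> inv_arr B (assoc B Y Z R)) \<cdot> assoc B X Y (Z \<otimes>\<^sub>o R)))"
    by (simp add: pentagon pentagon_solved(3) del: comp_assoc') (simp add: assoc_nat_ext)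
  also have "\<dots> = past X Z (Y \<otimes>\<^sub>o R) \<cdot> (Id B X \<otimes> past Y Z R) \<cdot> assoc B X Y (Z \<otimes>\<^sub>o R)"
  proof -
    have "((Id B X \<otimes> braid B Y Z) \<otimes> Id B R) \<cdot> inv_arr B (assoc B X (Y \<otimes>\<^sub>o Z) R)
        = inv_arr B (assoc B X (Z \<otimes>\<^sub>o Y) R) \<cdot> (Id B X \<otimes> braid B Y Z \<otimes> Id B R)"
      by (simp add: assoc_inv_nat)
    note 1 = comp_ext[OF this]
    show ?thesis
      using comp_ext[OF pentagon_solved(2)[of X Z Y R, simplified], simplified]
      by (simp add: 1 past_def merge)
  qed
  finally show ?thesis .
qed

lemma past_unit_right:
  assumes [simp]: "X \<in> Obj B" "R \<in> Obj B"
  shows "lunit B (X \<otimes>\<^sub>o R) \<cdot> past X \<one> R = Id B X \<otimes> lunit B R"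
  using comp_ext[OF lunit_tensor[of X R]]
  by (simp add: past_def merge lunit_braid flip: triangle)

lemma past_unit_left:
  assumes [simp]: "X \<in> Obj B" "R \<in> Obj B"
  shows "(Id B X \<otimes> lunit B R) \<cdot> past \<one> X R = lunit B (X \<otimes>\<^sub>o R)"
  using comp_ext[OF triangle[of X R]]
  by (simp add: past_def merge runit_braid flip: lunit_tensor)

end

context twist
begin

lemma twist_Arr [simp]: "X \<in> Obj B \<Longrightarrow> \<theta> X \<in> Arr B" "X \<in> Obj B \<Longrightarrow> Dom B (\<theta> X) = X"
    "X \<in> Obj B \<Longrightarrow> Cod B (\<theta> X) = X"
  using homD[OF twist_hom[of X]] by auto

lemma double_braid_unit:
  assumes [simp]: "X \<in> Obj B"
  shows "braid B \<one> X \<cdot> braid B X \<one> = Id B (X \<otimes>\<^sub>o \<one>)"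
proof (rule iso_mono[of "runit B X"])
  show "runit B X \<cdot> braid B \<one> X \<cdot> braid B X \<one> = runit B X \<cdot> Id B (X \<otimes>\<^sub>o \<one>)"
    using comp_ext[OF runit_braid[of X]] by (simp add: lunit_braid)
qed simp_all

text \<open>The double braiding of the unit with itself is trivial, so naturality along the unit
  constraint makes \<open>\<theta> \<one>\<close> idempotent; being invertible, it is the
  identity.\<close>

lemma twist_unit: "\<theta> \<one> = Id B \<one>"
proof -
  let ?t = "\<theta> \<one>"
  have "?t \<cdot> lunit B \<one> = lunit B \<one> \<cdot> (?t \<otimes> ?t)"
    using twist_natural[OF lunit_hom[of \<one>]] by (simp add: twist_tensor double_braid_unit)
  also have "\<dots> = lunit B \<one> \<cdot> (Id B \<one> \<otimes> ?t) \<cdot> (?t \<otimes> Id B \<one>)"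
    by (simp add: interchange)
  also have "\<dots> = ?t \<cdot> runit B \<one> \<cdot> (?t \<otimes> Id B \<one>)"
    using lunit_nat_ext[of ?t "?t \<otimes> Id B \<one>"] by (simp add: lunit_runit_unit)
  also have "\<dots> = ?t \<cdot> ?t \<cdot> lunit B \<one>"
    using runit_nat[of ?t] by (simp add: lunit_runit_unit)
  finally have "(?t \<cdot> ?t) \<cdot> lunit B \<one> = (?t \<cdot> Id B \<one>) \<cdot> lunit B \<one>" by simp
  then have "?t \<cdot> ?t = ?t \<cdot> Id B \<one>"
    by (rule iso_epi) simp_all
  then show ?thesis
    by (rule iso_mono) (simp_all add: twist_iso)
qed

text \<open>This recursion has the same nesting as \<open>Cl\<close> after \<open>Cr\<close>, which
  makes the evaluation in \<open>Cl_Cr_at\<close> an induction.\<close>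

lemma double_braid_tensor:
  assumes [simp]: "X \<in> Obj B" "Y \<in> Obj B" "Z \<in> Obj B"
  shows "braid B (Y \<otimes>\<^sub>o Z) X \<cdot> braid B X (Y \<otimes>\<^sub>o Z)
    = past Y X Z \<cdot> (Id B Y \<otimes> (braid B Z X \<cdot> braid B X Z)) \<cdot> past X Y Z"
proof -
  have right: "braid B X (Y \<otimes>\<^sub>o Z) = inv_arr B (assoc B Y Z X) \<cdot> (Id B Y \<otimes> braid B X Z) \<cdot> past X Y Z"
  proof (rule iso_epi[of _ "assoc B X Y Z"])
    show "braid B X (Y \<otimes>\<^sub>o Z) \<cdot> assoc B X Y Z
        = (inv_arr B (assoc B Y Z X) \<cdot> (Id B Y \<otimes> braid B X Z) \<cdot> past X Y Z) \<cdot> assoc B X Y Z"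
      by (simp add: past_def flip: hexagon_right)
  qed simp_all
  have left: "braid B (Y \<otimes>\<^sub>o Z) X = past Y X Z \<cdot> (Id B Y \<otimes> braid B Z X) \<cdot> assoc B Y Z X"
  proof -
    have "braid B (Y \<otimes>\<^sub>o Z) X = assoc B X Y Z \<cdot> (inv_arr B (assoc B X Y Z) \<cdot> braid B (Y \<otimes>\<^sub>o Z) X
        \<cdot> inv_arr B (assoc B Y Z X)) \<cdot> assoc B Y Z X"
      by simp
    then show ?thesis by (simp only: hexagon_left[OF assms(2,3,1)]) (simp add: past_def)
  qed
  show ?thesis unfolding left right by (simp add: split)
qed

end

section \<open>A model of the strand calculus\<close>

locale strand_model = braided_monoidal_category B
  for B :: "('o, 'm, 'z) braided_scheme" (structure) +
  fixes A Y :: 'o and e :: 'm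
  assumes A_Obj [simp]: "A \<in> Obj B" and Y_Obj [simp]: "Y \<in> Obj B"
    and e_hom: "e \<in> hom B (A \<otimes>\<^sub>o \<one>) \<one>"
begin

lemma e_Arr [simp]: "e \<in> Arr B" "Dom B e = A \<otimes>\<^sub>o \<one>" "Cod B e = \<one>"
  using homD[OF e_hom] by simp_all

text \<open>The tail \<open>R\<close> is arbitrary: strands on the right are added by enlarging
  \<open>R\<close>, strands on the left by \<open>PA\<close>, and neither needs an associativity
  constraint.\<close>

primrec PO :: "nat \<Rightarrow> 'o \<Rightarrow> 'o" where
  "PO 0 R = R"
| "PO (Suc k) R = A \<otimes>\<^sub>o PO k R"

primrec PA :: "nat \<Rightarrow> 'm \<Rightarrow> 'm" where
  "PA 0 f = f"
| "PA (Suc k) f = Id B A \<otimes> PA k f"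

lemma PO_Obj [simp]: "R \<in> Obj B \<Longrightarrow> PO k R \<in> Obj B"
  by (induction k) auto

lemma PO_tensor [simp]: "PO k (A \<otimes>\<^sub>o R) = A \<otimes>\<^sub>o PO k R"
  by (induction k) auto

lemma PO_add [simp]: "PO (j + k) R = PO j (PO k R)"
  by (induction j) auto

lemma PA_Arr [simp]:
  assumes "f \<in> Arr B"
  shows "PA k f \<in> Arr B" "Dom B (PA k f) = PO k (Dom B f)" "Cod B (PA k f) = PO k (Cod B f)"
  by (induction k) (use assms in auto)

lemma PA_tensor [simp]: "PA k (Id B A \<otimes> f) = Id B A \<otimes> PA k f"
  by (induction k) auto

lemma PA_add [simp]: "PA (j + k) f = PA j (PA k f)"
  by (induction j) auto

lemma PA_Id [simp]: "R \<in> Obj B \<Longrightarrow> PA k (Id B R) = Id B (PO k R)"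
  by (induction k) auto

lemma PA_comp:
  "\<lbrakk>f \<in> Arr B; g \<in> Arr B; Dom B g = Cod B f\<rbrakk> \<Longrightarrow> PA k (g \<cdot> f) = PA k g \<cdot> PA k f"
  by (induction k) (auto simp: interchange)

lemma PO_commute: "PO j (PO k R) = PO k (PO j R)"
  by (simp add: add.commute flip: PO_add)

text \<open>Naturality in the tail expresses that the family touches only its own strands.\<close>

definition natural :: "nat \<Rightarrow> nat \<Rightarrow> ('o \<Rightarrow> 'm) \<Rightarrow> bool" where
  "natural n m F \<longleftrightarrow> (\<forall>R\<in>Obj B. F R \<in> hom B (PO n R) (PO m R)) \<and>
     (\<forall>k\<in>Arr B. F (Cod B k) \<cdot> PA n k = PA m k \<cdot> F (Dom B k))"

lemma natural_Arr:
  assumes "natural n m F" "R \<in> Obj B"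
  shows "F R \<in> Arr B" "Dom B (F R) = PO n R" "Cod B (F R) = PO m R"
  using assms homD[of "F R" "PO n R" "PO m R"] by (auto simp: natural_def)

lemma natural_sq:
  "\<lbrakk>natural n m F; k \<in> Arr B\<rbrakk> \<Longrightarrow> F (Cod B k) \<cdot> PA n k = PA m k \<cdot> F (Dom B k)"
  by (simp add: natural_def)

lemma naturalI:
  assumes "\<And>R. R \<in> Obj B \<Longrightarrow> F R \<in> Arr B \<and> Dom B (F R) = PO n R \<and> Cod B (F R) = PO m R"
    and "\<And>k. k \<in> Arr B \<Longrightarrow> F (Cod B k) \<cdot> PA n k = PA m k \<cdot> F (Dom B k)"
  shows "natural n m F"
  using assms by (simp add: natural_def hom_def)

lemma natural_comp:
  assumes F: "natural n m F" and G: "natural m p G"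
  shows "natural n p (\<lambda>R. G R \<cdot> F R)"
proof (rule naturalI)
  fix k assume k [simp]: "k \<in> Arr B"
  note [simp] = natural_Arr[OF F] natural_Arr[OF G]
  have "(G (Cod B k) \<cdot> F (Cod B k)) \<cdot> PA n k = G (Cod B k) \<cdot> PA m k \<cdot> F (Dom B k)"
    using natural_sq[OF F k] by simp
  then show "(G (Cod B k) \<cdot> F (Cod B k)) \<cdot> PA n k = PA p k \<cdot> G (Dom B k) \<cdot> F (Dom B k)"
    using comp_ext[OF natural_sq[OF G k]] by simp
qed (simp add: natural_Arr[OF F] natural_Arr[OF G])

lemma natural_shift:
  assumes F: "natural n m F"
  shows "natural (Suc n) (Suc m) (\<lambda>R. Id B A \<otimes> F R)"
  by (rule naturalI) (simp_all add: natural_Arr[OF F] interchange natural_sq[OF F])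

lemma natural_pad:
  assumes F: "natural n m F"
  shows "natural (n + k) (m + k) (\<lambda>R. F (PO k R))"
proof (rule naturalI)
  fix f assume f [simp]: "f \<in> Arr B"
  show "F (PO k (Cod B f)) \<cdot> PA (n + k) f = PA (m + k) f \<cdot> F (PO k (Dom B f))"
    using natural_sq[OF F, of "PA k f"] by simp
qed (simp add: natural_Arr[OF F])

lemma natural_Id: "natural n n (\<lambda>R. Id B (PO n R))"
  by (rule naturalI) simp_all

text \<open>
  A point is a morphism from \<open>Y\<close> to the inverse limit of the powers of \<open>A\<close> along \<open>e\<close>, given by its
  components \<open>x N : Y \<rightarrow> A\<^sup>N\<close>; it has as many strands as any diagram may ask for.
\<close>

definition points :: "(nat \<Rightarrow> 'm) set" where
  "points = {x. \<forall>N. x N \<in> hom B Y (PO N \<one>) \<and> PA N e \<cdot> x (Suc N) = x N}"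

lemma points_Arr [simp]:
  assumes "x \<in> points"
  shows "x N \<in> Arr B" "Dom B (x N) = Y" "Cod B (x N) = PO N \<one>"
  using assms homD[of "x N" Y "PO N \<one>"] by (auto simp: points_def)

text \<open>The transition map of the inverse system from level \<open>k + N\<close> to level
  \<open>N\<close>.\<close>

primrec trunc :: "nat \<Rightarrow> nat \<Rightarrow> 'm" where
  "trunc 0 N = Id B (PO N \<one>)"
| "trunc (Suc k) N = PA N e \<cdot> trunc k (Suc N)"

lemma trunc_Arr [simp]:
  "trunc k N \<in> Arr B" "Dom B (trunc k N) = PO k (PO N \<one>)" "Cod B (trunc k N) = PO N \<one>"
proof -
  have "trunc k N \<in> Arr B \<and> Dom B (trunc k N) = PO k (PO N \<one>) \<and> Cod B (trunc k N) = PO N \<one>"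
    by (induction k arbitrary: N) auto
  then show "trunc k N \<in> Arr B" "Dom B (trunc k N) = PO k (PO N \<one>)" "Cod B (trunc k N) = PO N \<one>"
    by auto
qed

lemma trunc_point: "x \<in> points \<Longrightarrow> trunc k N \<cdot> x (k + N) = x N"
proof (induction k arbitrary: N)
  case (Suc k)
  have "trunc (Suc k) N \<cdot> x (Suc k + N) = PA N e \<cdot> trunc k (Suc N) \<cdot> x (k + Suc N)"
    using Suc.prems by (simp add: PO_commute[of k])
  then show ?case using Suc.IH[of "Suc N"] Suc.prems by (simp add: points_def)
qed simp

lemma trunc_PA: "trunc k (j + N) = PA j (trunc k N)"
proof (induction k arbitrary: N)
  case (Suc k)
  from Suc[of "Suc N"] show ?case by (simp add: PA_comp)
qed simp

lemma trunc_snoc: "trunc (Suc k) N = trunc k N \<cdot> PA (k + N) e"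
proof (induction k arbitrary: N)
  case (Suc k)
  have "trunc (Suc (Suc k)) N = PA N e \<cdot> trunc (Suc k) (Suc N)" by simp
  also have "\<dots> = PA N e \<cdot> trunc k (Suc N) \<cdot> PA (k + Suc N) e"
    by (simp only: Suc)
  finally show ?case by simp
qed simp

text \<open>
  Component \<open>i + m + N\<close> of the result involves \<open>F\<close> only (\<open>op_at\<close>); the truncation makes all components
  available.  Sequences that are not points are left fixed, so that equations hold for every sequence.
\<close>

definition op :: "nat \<Rightarrow> nat \<Rightarrow> ('o \<Rightarrow> 'm) \<Rightarrow> nat \<Rightarrow> (nat \<Rightarrow> 'm) \<Rightarrow> nat \<Rightarrow> 'm" where
  "op n m F i x = (if x \<in> points
     then (\<lambda>N. trunc (i + m) N \<cdot> PA i (F (PO N \<one>)) \<cdot> x (i + n + N)) else x)"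

lemma op_outside [simp]: "x \<notin> points \<Longrightarrow> op n m F i x = x"
  by (simp add: op_def)

lemma op_points [simp]:
  assumes F: "natural n m F" and x: "x \<in> points"
  shows "op n m F i x \<in> points"
proof -
  note [simp] = natural_Arr[OF F] x
  have "PA N e \<cdot> op n m F i x (Suc N) = op n m F i x N" for N
  proof -
    have "PA N e \<cdot> op n m F i x (Suc N)
        = (PA N e \<cdot> trunc (i + m) (Suc N)) \<cdot> PA i (F (PO (Suc N) \<one>)) \<cdot> x (i + n + Suc N)"
      by (simp add: op_def)
    also have "\<dots> = (trunc (i + m) N \<cdot> PA (i + m + N) e) \<cdot> PA i (F (PO (Suc N) \<one>)) \<cdot> x (i + n + Suc N)"
      using trunc_snoc[of "i + m" N] by simp
    also have "\<dots> = trunc (i + m) N \<cdot> PA i (PA m (PA N e) \<cdot> F (PO (Suc N) \<one>)) \<cdot> x (i + n + Suc N)"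
      by (simp add: PA_comp)
    also have "\<dots> = trunc (i + m) N \<cdot> PA i (F (PO N \<one>) \<cdot> PA n (PA N e)) \<cdot> x (i + n + Suc N)"
      using natural_sq[OF F, of "PA N e"] by simp
    also have "\<dots> = trunc (i + m) N \<cdot> PA i (F (PO N \<one>)) \<cdot> PA (i + n + N) e \<cdot> x (Suc (i + n + N))"
      by (simp add: PA_comp)
    also have "PA (i + n + N) e \<cdot> x (Suc (i + n + N)) = x (i + n + N)"
      using x unfolding points_def by blast
    finally show ?thesis by (simp add: op_def)
  qed
  moreover have "op n m F i x N \<in> hom B Y (PO N \<one>)" for N
    by (simp add: op_def hom_def)
  ultimately show ?thesis unfolding points_def by blast
qed

text \<open>Naturality in the tail moves the truncation to the other side of \<open>F\<close>, where
  the point absorbs it.\<close>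

lemma op_at:
  assumes F: "natural n m F" and x: "x \<in> points"
  shows "op n m F i x (i + m + N) = PA i (F (PO N \<one>)) \<cdot> x (i + n + N)"
proof -
  note [simp] = natural_Arr[OF F] x
  let ?t = "trunc (i + m) N" and ?M = "i + m + N"
  have "op n m F i x ?M = trunc (i + m) (i + (m + N)) \<cdot> PA i (F (PO ?M \<one>)) \<cdot> x (i + n + ?M)"
    by (simp add: op_def add.assoc)
  also have "\<dots> = PA i (PA m ?t \<cdot> F (PO ?M \<one>)) \<cdot> x (i + n + ?M)"
    unfolding trunc_PA by (simp add: PA_comp PO_commute)
  also have "\<dots> = PA i (F (PO N \<one>) \<cdot> PA n ?t) \<cdot> x (i + n + ?M)"
    using natural_sq[OF F, of ?t] by simp
  also have "\<dots> = PA i (F (PO N \<one>)) \<cdot> trunc (i + m) (i + n + N) \<cdot> x (i + m + (i + n + N))"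
    by (simp add: PA_comp trunc_PA add.assoc add.left_commute PO_commute)
  finally show ?thesis by (simp only: trunc_point[OF x])
qed

lemma points_eqI:
  assumes "x \<in> points" "y \<in> points" and "\<And>N. x (K + N) = y (K + N)"
  shows "x = y"
proof
  fix N show "x N = y N"
    using trunc_point[OF assms(1), of K N] trunc_point[OF assms(2), of K N] assms(3)[of N] by simp
qed

lemma op_eqI:
  assumes F: "natural n m F" and x: "x \<in> points" "y \<in> points"
    and "\<And>N. y (i + m + N) = PA i (F (PO N \<one>)) \<cdot> x (i + n + N)"
  shows "op n m F i x = y"
  by (rule points_eqI[of _ _ "i + m"]) (use assms in \<open>simp_all add: op_at\<close>)

lemma op_cong: "(\<And>R. R \<in> Obj B \<Longrightarrow> F R = G R) \<Longrightarrow> op n m F = op n m G"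
  by (intro ext) (simp add: op_def)

lemma op_Id: "op n n (\<lambda>R. Id B (PO n R)) i x = x"
proof (cases "x \<in> points")
  case True
  show ?thesis by (rule op_eqI[OF natural_Id]) (simp_all add: True)
qed simp

lemma op_comp:
  assumes F: "natural n m F" and G: "natural m p G"
  shows "op m p G i (op n m F i x) = op n p (\<lambda>R. G R \<cdot> F R) i x"
proof (cases "x \<in> points")
  case True
  note [simp] = natural_Arr[OF F] natural_Arr[OF G] True F G
  show ?thesis
    by (rule op_eqI[OF natural_comp[OF F G], symmetric]) (simp_all add: op_at PA_comp)
qed simp

lemma op_shift:
  assumes F: "natural n m F"
  shows "op n m F (Suc i) x = op (Suc n) (Suc m) (\<lambda>R. Id B A \<otimes> F R) i x"
proof (cases "x \<in> points")
  case True
  note [simp] = natural_Arr[OF F] True F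
  show ?thesis
  proof (rule op_eqI[OF natural_shift[OF F], symmetric])
    show "op n m F (Suc i) x (i + Suc m + N) = PA i (Id B A \<otimes> F (PO N \<one>)) \<cdot> x (i + Suc n + N)" for N
      using op_at[OF F True, of "Suc i" N] by simp
  qed simp_all
qed simp

lemma op_pad:
  assumes F: "natural n m F"
  shows "op n m F i x = op (n + k) (m + k) (\<lambda>R. F (PO k R)) i x"
proof (cases "x \<in> points")
  case True
  note [simp] = natural_Arr[OF F] True F
  show ?thesis
  proof (rule op_eqI[OF natural_pad[OF F], symmetric])
    show "op n m F i x (i + (m + k) + N) = PA i (F (PO k (PO N \<one>))) \<cdot> x (i + (n + k) + N)" for N
      using op_at[OF F True, of i "k + N"] by (simp add: add.assoc)
  qed simp_all
qed simp

text \<open>At a component high enough for both insertions to be evaluated by \<open>op_at\<close>,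
  this is naturality of \<open>F\<close> in its tail, on which \<open>G\<close> acts.\<close>

lemma op_slide:
  assumes F: "natural n m F" and G: "natural p q G"
  shows "op n m F i (op p q G (i + n + k) x) = op p q G (i + m + k) (op n m F i x)"
proof (cases "x \<in> points")
  case True
  note [simp] = natural_Arr[OF F] natural_Arr[OF G] True F G
  show ?thesis
  proof (rule points_eqI[of _ _ "i + m + k + q"])
    fix N
    have "op n m F i (op p q G (i + n + k) x) (i + m + k + q + N)
        = PA i (F (PO (k + q + N) \<one>)) \<cdot> op p q G (i + n + k) x (i + n + k + q + N)"
      using op_at[OF F, of "op p q G (i + n + k) x" i "k + q + N"] by (simp add: add.assoc)
    also have "\<dots> = PA i (F (PO (k + q + N) \<one>)) \<cdot> PA (i + n + k) (G (PO N \<one>)) \<cdot> x (i + n + k + p + N)"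
      by (simp only: op_at[OF G True])
    also have "\<dots> = PA i (F (PO (k + q + N) \<one>) \<cdot> PA n (PA k (G (PO N \<one>)))) \<cdot> x (i + n + k + p + N)"
      by (simp add: PA_comp)
    also have "\<dots> = PA i (PA m (PA k (G (PO N \<one>))) \<cdot> F (PO (k + p + N) \<one>)) \<cdot> x (i + n + k + p + N)"
      using natural_sq[OF F, of "PA k (G (PO N \<one>))"] by simp
    also have "\<dots> = PA (i + m + k) (G (PO N \<one>)) \<cdot> PA i (F (PO (k + p + N) \<one>)) \<cdot> x (i + n + (k + p + N))"
      by (simp add: PA_comp add.assoc)
    also have "\<dots> = PA (i + m + k) (G (PO N \<one>)) \<cdot> op n m F i x (i + m + k + p + N)"
      using op_at[OF F True, of i "k + p + N"] by (simp add: add.assoc)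
    finally show "op n m F i (op p q G (i + n + k) x) (i + m + k + q + N)
        = op p q G (i + m + k) (op n m F i x) (i + m + k + q + N)"
      by (simp only: op_at[OF G op_points[OF F True]])
  qed simp_all
qed simp

end

context braided_monoidal_category
begin

lemma past_assoc:
  assumes [simp]: "X \<in> Obj B" "Y \<in> Obj B" "Z \<in> Obj B" "R \<in> Obj B"
  shows "(Id B Y \<otimes> assoc B X Z R) \<cdot> assoc B Y (X \<otimes>\<^sub>o Z) R \<cdot> (past X Y Z \<otimes> Id B R)
    = past X Y (Z \<otimes>\<^sub>o R) \<cdot> (Id B X \<otimes> assoc B Y Z R) \<cdot> assoc B X (Y \<otimes>\<^sub>o Z) R"
proof -
  let ?v = "inv_arr B (assoc B X Y Z)"
  have solved: "assoc B (X \<otimes>\<^sub>o Y) Z R \<cdot> (?v \<otimes> Id B R)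
      = inv_arr B (assoc B X Y (Z \<otimes>\<^sub>o R)) \<cdot> (Id B X \<otimes> assoc B Y Z R) \<cdot> assoc B X (Y \<otimes>\<^sub>o Z) R"
    using arg_cong[OF pentagon_solved(2)[of X Y Z R], of "\<lambda>f. f \<cdot> assoc B X (Y \<otimes>\<^sub>o Z) R"] by simp
  have "(Id B Y \<otimes> assoc B X Z R) \<cdot> assoc B Y (X \<otimes>\<^sub>o Z) R \<cdot> (past X Y Z \<otimes> Id B R)
    = ((Id B Y \<otimes> assoc B X Z R) \<cdot> assoc B Y (X \<otimes>\<^sub>o Z) R \<cdot> (assoc B Y X Z \<otimes> Id B R))
      \<cdot> ((braid B X Y \<otimes> Id B Z) \<otimes> Id B R) \<cdot> (?v \<otimes> Id B R)"
    by (simp add: past_def merge)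
  also have "\<dots> = assoc B Y X (Z \<otimes>\<^sub>o R) \<cdot> (braid B X Y \<otimes> Id B (Z \<otimes>\<^sub>o R)) \<cdot> (assoc B (X \<otimes>\<^sub>o Y) Z R \<cdot> (?v \<otimes> Id B R))"
    by (simp add: pentagon del: comp_assoc') (simp add: assoc_nat_ext)
  finally show ?thesis by (simp add: solved past_def)
qed

end

section \<open>Hopf algebra identities in the model\<close>

locale hopf_strand_model =
    twisted_modular_pair_in_involution B \<theta> H \<delta> \<sigma> + strand_model B "carr H" Y e
  for B :: "('o, 'm, 'z) braided_scheme" (structure)
    and \<theta> :: "'o \<Rightarrow> 'm"
    and H :: "('o, 'm) hopf_data"
    and \<delta> \<sigma> :: 'm and Y :: 'o and e :: 'm
begin

abbreviation A where "A \<equiv> carr H"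
abbreviation m where "m \<equiv> mult H"
abbreviation u where "u \<equiv> unt H"
abbreviation \<Delta> where "\<Delta> \<equiv> comult H"
abbreviation \<epsilon> where "\<epsilon> \<equiv> counit H"
abbreviation S where "S \<equiv> antipode H"

lemma structure_Arr [simp]:
  "m \<in> Arr B" "Dom B m = A \<otimes>\<^sub>o A" "Cod B m = A"
  "u \<in> Arr B" "Dom B u = \<one>" "Cod B u = A"
  "\<Delta> \<in> Arr B" "Dom B \<Delta> = A" "Cod B \<Delta> = A \<otimes>\<^sub>o A"
  "\<epsilon> \<in> Arr B" "Dom B \<epsilon> = A" "Cod B \<epsilon> = \<one>"
  "S \<in> Arr B" "Dom B S = A" "Cod B S = A"
  "\<delta> \<in> Arr B" "Dom B \<delta> = A" "Cod B \<delta> = \<one>"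
  "\<sigma> \<in> Arr B" "Dom B \<sigma> = \<one>" "Cod B \<sigma> = A"
  using homD[OF mult_hom] homD[OF unit_hom] homD[OF comult_hom] homD[OF counit_hom]
    homD[OF antipode_hom] delta_morphism sigma_morphism
  by (auto simp: algebra_morphism_def coalgebra_morphism_def hom_def)

lemma delta_mult: "\<delta> \<cdot> m = lunit B \<one> \<cdot> (\<delta> \<otimes> \<delta>)" and delta_unit: "\<delta> \<cdot> u = Id B \<one>"
  and comult_sigma: "\<Delta> \<cdot> \<sigma> = (\<sigma> \<otimes> \<sigma>) \<cdot> inv_arr B (lunit B \<one>)" and counit_sigma: "\<epsilon> \<cdot> \<sigma> = Id B \<one>"
  using delta_morphism sigma_morphism by (auto simp: algebra_morphism_def coalgebra_morphism_def)

text \<open>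
  \<open>T i\<close> is the source or target of a structure morphism with \<open>i\<close> legs, and \<open>J i R : T i \<otimes> R \<rightarrow> A\<^sup>i R\<close>
  the rebracketing.  Only the indices \<open>i \<le> 2\<close> are meaningful.
\<close>

fun T :: "nat \<Rightarrow> 'o" where
  "T 0 = \<one>"
| "T (Suc 0) = A"
| "T (Suc (Suc k)) = A \<otimes>\<^sub>o A"

fun J :: "nat \<Rightarrow> 'o \<Rightarrow> 'm" where
  "J 0 R = lunit B R"
| "J (Suc 0) R = Id B (A \<otimes>\<^sub>o R)"
| "J (Suc (Suc k)) R = assoc B A A R"

definition hat :: "nat \<Rightarrow> nat \<Rightarrow> 'm \<Rightarrow> 'o \<Rightarrow> 'm" where
  "hat i j f R = J j R \<cdot> (f \<otimes> Id B R) \<cdot> inv_arr B (J i R)"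

abbreviation hM where "hM \<equiv> hat (Suc (Suc 0)) (Suc 0) m"
abbreviation hU where "hU \<equiv> hat 0 (Suc 0) u"
abbreviation hD where "hD \<equiv> hat (Suc 0) (Suc (Suc 0)) \<Delta>"
abbreviation hE where "hE \<equiv> hat (Suc 0) 0 \<epsilon>"
abbreviation hS where "hS \<equiv> hat (Suc 0) (Suc 0) S"
abbreviation hd where "hd \<equiv> hat (Suc 0) 0 \<delta>"
abbreviation hs where "hs \<equiv> hat 0 (Suc 0) \<sigma>"
abbreviation hT where "hT \<equiv> hat (Suc 0) (Suc 0) (\<theta> A)"

lemma T_Obj [simp]: "T n \<in> Obj B"
  by (induction n rule: T.induct) auto

lemma hat_Arr [simp]:
  assumes "R \<in> Obj B"
  shows "hM R \<in> Arr B" "Dom B (hM R) = A \<otimes>\<^sub>o A \<otimes>\<^sub>o R" "Cod B (hM R) = A \<otimes>\<^sub>o R"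
    "hU R \<in> Arr B" "Dom B (hU R) = R" "Cod B (hU R) = A \<otimes>\<^sub>o R"
    "hD R \<in> Arr B" "Dom B (hD R) = A \<otimes>\<^sub>o R" "Cod B (hD R) = A \<otimes>\<^sub>o A \<otimes>\<^sub>o R"
    "hE R \<in> Arr B" "Dom B (hE R) = A \<otimes>\<^sub>o R" "Cod B (hE R) = R"
    "hS R \<in> Arr B" "Dom B (hS R) = A \<otimes>\<^sub>o R" "Cod B (hS R) = A \<otimes>\<^sub>o R"
    "hd R \<in> Arr B" "Dom B (hd R) = A \<otimes>\<^sub>o R" "Cod B (hd R) = R"
    "hs R \<in> Arr B" "Dom B (hs R) = R" "Cod B (hs R) = A \<otimes>\<^sub>o R"
    "hT R \<in> Arr B" "Dom B (hT R) = A \<otimes>\<^sub>o R" "Cod B (hT R) = A \<otimes>\<^sub>o R"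
  using assms by (simp_all add: hat_def)

lemma hat_assoc:
  assumes [simp]: "R \<in> Obj B"
  shows "hM R \<cdot> (Id B A \<otimes> hM R) = hM R \<cdot> hM (A \<otimes>\<^sub>o R)"
proof -
  have "hM R \<cdot> hM (A \<otimes>\<^sub>o R)
      = ((m \<cdot> (m \<otimes> Id B A)) \<otimes> Id B R) \<cdot> inv_arr B (assoc B (A \<otimes>\<^sub>o A) A R) \<cdot> inv_arr B (assoc B A A (A \<otimes>\<^sub>o R))"
    by (simp add: hat_def shuffle interchange_ext)
  also have "\<dots> = (m \<otimes> Id B R) \<cdot> ((Id B A \<otimes> m) \<otimes> Id B R) \<cdot> ((assoc B A A A \<otimes> Id B R)
      \<cdot> inv_arr B (assoc B (A \<otimes>\<^sub>o A) A R)) \<cdot> inv_arr B (assoc B A A (A \<otimes>\<^sub>o R))"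
    by (simp add: mult_assoc split)
  also have "\<dots> = hM R \<cdot> (Id B A \<otimes> hM R)"
    by (simp add: hat_def split shuffle flip: pentagon_solved(3))
  finally show ?thesis by simp
qed

lemma hat_unit_left:
  assumes [simp]: "R \<in> Obj B"
  shows "hM R \<cdot> hU (A \<otimes>\<^sub>o R) = Id B (A \<otimes>\<^sub>o R)"
  using comp_ext[OF lunit_tensor_inv(2)[of A R]]
  by (simp add: hat_def shuffle interchange_ext mult_unit_left)

lemma hat_unit_right:
  assumes [simp]: "R \<in> Obj B"
  shows "hM R \<cdot> (Id B A \<otimes> hU R) = Id B (A \<otimes>\<^sub>o R)"
  by (simp add: hat_def split shuffle)
    (simp add: interchange_ext comp_ext[OF mult_unit_right] triangle_inv interchange)

lemma hat_coassoc:
  assumes [simp]: "R \<in> Obj B"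
  shows "(Id B A \<otimes> hD R) \<cdot> hD R = hD (A \<otimes>\<^sub>o R) \<cdot> hD R"
proof -
  have 1: "(\<Delta> \<otimes> Id B (A \<otimes>\<^sub>o R)) \<cdot> assoc B A A R = assoc B (A \<otimes>\<^sub>o A) A R \<cdot> ((\<Delta> \<otimes> Id B A) \<otimes> Id B R)"
    and 2: "(Id B A \<otimes> \<Delta> \<otimes> Id B R) \<cdot> assoc B A A R = assoc B A (A \<otimes>\<^sub>o A) R \<cdot> ((Id B A \<otimes> \<Delta>) \<otimes> Id B R)"
    by (simp_all add: shuffle)
  have "hD (A \<otimes>\<^sub>o R) \<cdot> hD R
    = (assoc B A A (A \<otimes>\<^sub>o R) \<cdot> assoc B (A \<otimes>\<^sub>o A) A R) \<cdot> (((\<Delta> \<otimes> Id B A) \<cdot> \<Delta>) \<otimes> Id B R)"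
    using comp_ext[OF 1] by (simp add: hat_def interchange)
  also have "\<dots> = (Id B A \<otimes> assoc B A A R) \<cdot> assoc B A (A \<otimes>\<^sub>o A) R \<cdot> ((assoc B A A A \<cdot> (\<Delta> \<otimes> Id B A) \<cdot> \<Delta>) \<otimes> Id B R)"
    by (simp add: merge flip: pentagon)
  also have "\<dots> = (Id B A \<otimes> hD R) \<cdot> hD R"
    using comp_ext[OF 2] unfolding comult_coassoc by (simp add: hat_def split)
  finally show ?thesis by simp
qed

lemma hat_counit_left:
  assumes [simp]: "R \<in> Obj B"
  shows "hE (A \<otimes>\<^sub>o R) \<cdot> hD R = Id B (A \<otimes>\<^sub>o R)"
proof -
  have "(\<epsilon> \<otimes> Id B (A \<otimes>\<^sub>o R)) \<cdot> assoc B A A R = assoc B \<one> A R \<cdot> ((\<epsilon> \<otimes> Id B A) \<otimes> Id B R)"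
    by (simp add: shuffle)
  from comp_ext[OF this] comp_ext[OF lunit_tensor[of A R]] show ?thesis
    by (simp add: hat_def interchange comult_counit_left)
qed

lemma hat_counit_right:
  assumes [simp]: "R \<in> Obj B"
  shows "(Id B A \<otimes> hE R) \<cdot> hD R = Id B (A \<otimes>\<^sub>o R)"
proof -
  have "(Id B A \<otimes> \<epsilon> \<otimes> Id B R) \<cdot> assoc B A A R = assoc B A \<one> R \<cdot> ((Id B A \<otimes> \<epsilon>) \<otimes> Id B R)"
    by (simp add: shuffle)
  from comp_ext[OF this] comp_ext[OF triangle[of A R]] show ?thesis
    by (simp add: hat_def split) (simp add: interchange comult_counit_right)
qed

lemma hat_antipode_left:
  assumes [simp]: "R \<in> Obj B"
  shows "hM R \<cdot> hS (A \<otimes>\<^sub>o R) \<cdot> hD R = hU R \<cdot> hE R"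
  by (simp add: hat_def shuffle merge antipode_left)

lemma hat_antipode_right:
  assumes [simp]: "R \<in> Obj B"
  shows "hM R \<cdot> (Id B A \<otimes> hS R) \<cdot> hD R = hU R \<cdot> hE R"
  by (simp add: hat_def shuffle merge antipode_right)

lemma hat_group_like:
  assumes [simp]: "R \<in> Obj B" "v \<in> Arr B" "Dom B v = \<one>" "Cod B v = A"
    and v: "\<Delta> \<cdot> v = (v \<otimes> v) \<cdot> inv_arr B (lunit B \<one>)"
  shows "hD R \<cdot> hat 0 (Suc 0) v R = hat 0 (Suc 0) v (A \<otimes>\<^sub>o R) \<cdot> hat 0 (Suc 0) v R"
proof -
  have "hD R \<cdot> hat 0 (Suc 0) v R
    = assoc B A A R \<cdot> ((v \<otimes> v) \<otimes> Id B R) \<cdot> (inv_arr B (lunit B \<one>) \<otimes> Id B R) \<cdot> inv_arr B (lunit B R)"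
    by (simp add: hat_def merge v)
  also have "\<dots> = (v \<otimes> v \<otimes> Id B R) \<cdot> inv_arr B (lunit B (\<one> \<otimes>\<^sub>o R)) \<cdot> inv_arr B (lunit B R)"
    using comp_ext[OF lunit_tensor_inv(1)[of \<one> R]] by (simp add: shuffle)
  finally show ?thesis
    by (simp add: hat_def lunit_inv_nat(2)[of "v \<otimes> Id B R"] interchange_ext)
qed

lemma hat_character:
  assumes [simp]: "R \<in> Obj B" "v \<in> Arr B" "Dom B v = A" "Cod B v = \<one>"
    and v: "v \<cdot> m = lunit B \<one> \<cdot> (v \<otimes> v)"
  shows "hat (Suc 0) 0 v R \<cdot> hM R = hat (Suc 0) 0 v R \<cdot> hat (Suc 0) 0 v (A \<otimes>\<^sub>o R)"
proof -
  have "hat (Suc 0) 0 v R \<cdot> hM R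
    = lunit B R \<cdot> (lunit B \<one> \<otimes> Id B R) \<cdot> ((v \<otimes> v) \<otimes> Id B R) \<cdot> inv_arr B (assoc B A A R)"
    by (simp add: hat_def merge v)
  also have "\<dots> = lunit B R \<cdot> ((lunit B \<one> \<otimes> Id B R) \<cdot> inv_arr B (assoc B \<one> \<one> R)) \<cdot> (v \<otimes> v \<otimes> Id B R)"
    by (simp add: shuffle)
  also have "\<dots> = lunit B R \<cdot> lunit B (\<one> \<otimes>\<^sub>o R) \<cdot> (Id B \<one> \<otimes> v \<otimes> Id B R) \<cdot> (v \<otimes> Id B (A \<otimes>\<^sub>o R))"
    by (simp add: lunit_tensor_inv interchange)
  also have "\<dots> = hat (Suc 0) 0 v R \<cdot> hat (Suc 0) 0 v (A \<otimes>\<^sub>o R)"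
    using lunit_nat_ext[of "v \<otimes> Id B R" "v \<otimes> Id B (A \<otimes>\<^sub>o R)"] by (simp add: hat_def)
  finally show ?thesis .
qed

lemma hat_pairing:
  assumes [simp]: "R \<in> Obj B" "v \<in> Arr B" "Dom B v = \<one>" "Cod B v = A" "w \<in> Arr B" "Dom B w = A" "Cod B w = \<one>"
    and "w \<cdot> v = Id B \<one>"
  shows "hat (Suc 0) 0 w R \<cdot> hat 0 (Suc 0) v R = Id B R"
  using assms(8) by (simp add: hat_def merge)


lemma hat_comult_mult:
  assumes [simp]: "R \<in> Obj B"
  shows "hD R \<cdot> hM R = (Id B A \<otimes> hM R) \<cdot> hM (A \<otimes>\<^sub>o A \<otimes>\<^sub>o R) \<cdot> (Id B A \<otimes> past A A (A \<otimes>\<^sub>o R))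
    \<cdot> hD (A \<otimes>\<^sub>o A \<otimes>\<^sub>o R) \<cdot> (Id B A \<otimes> hD R)" (is "_ = ?rhs")
proof -
  let ?AA = "A \<otimes>\<^sub>o A" and ?R = "A \<otimes>\<^sub>o A \<otimes>\<^sub>o R"
  \<comment> \<open>\<open>?Q\<close> rebrackets \<open>(AA \<otimes> AA) \<otimes> R\<close> to the
    nested form. Its second form, found by the pentagon, exposes the middle two factors, where the
    braiding acts.\<close>
  let ?Q = "assoc B A A ?R \<cdot> (Id B ?AA \<otimes> assoc B A A R) \<cdot> assoc B ?AA ?AA R"
  let ?mb = "middle_braid B A A A A"
  have mb: "?mb = inv_arr B (assoc B A A ?AA) \<cdot> (Id B A \<otimes> past A A A) \<cdot> assoc B A A ?AA"
    by (simp add: middle_braid_def past_def)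
  have Q: "?Q = (Id B A \<otimes> ((Id B A \<otimes> assoc B A A R) \<cdot> assoc B A ?AA R)) \<cdot> assoc B A (A \<otimes>\<^sub>o ?AA) R
      \<cdot> (assoc B A A ?AA \<otimes> Id B R)"
  proof -
    have "?Q = (Id B A \<otimes> Id B A \<otimes> assoc B A A R) \<cdot> assoc B A A (?AA \<otimes>\<^sub>o R) \<cdot> assoc B ?AA ?AA R"
      by (simp add: assoc_nat_right)
    then show ?thesis by (simp add: split flip: pentagon)
  qed
  have 1: "hD ?R \<cdot> (Id B A \<otimes> hD R) \<cdot> assoc B A A R = ?Q \<cdot> ((\<Delta> \<otimes> \<Delta>) \<otimes> Id B R)"
    by (simp add: hat_def assoc_nat merge)
  have 2: "(Id B A \<otimes> past A A (A \<otimes>\<^sub>o R)) \<cdot> ?Q = ?Q \<cdot> (?mb \<otimes> Id B R)"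
  proof -
    have "?Q \<cdot> (?mb \<otimes> Id B R)
        = (Id B A \<otimes> ((Id B A \<otimes> assoc B A A R) \<cdot> assoc B A ?AA R)) \<cdot> (assoc B A (A \<otimes>\<^sub>o ?AA) R
          \<cdot> ((Id B A \<otimes> past A A A) \<otimes> Id B R)) \<cdot> (assoc B A A ?AA \<otimes> Id B R)"
      unfolding Q mb by (simp add: merge)
    also have "\<dots> = (Id B A \<otimes> ((Id B A \<otimes> assoc B A A R) \<cdot> assoc B A ?AA R \<cdot> (past A A A \<otimes> Id B R)))
          \<cdot> assoc B A (A \<otimes>\<^sub>o ?AA) R \<cdot> (assoc B A A ?AA \<otimes> Id B R)"
      by (simp add: assoc_nat merge)
    also have "\<dots> = (Id B A \<otimes> past A A (A \<otimes>\<^sub>o R)) \<cdot> ?Q"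
      unfolding Q by (simp add: past_assoc split)
    finally show ?thesis by simp
  qed
  have 3: "(Id B A \<otimes> hM R) \<cdot> hM ?R \<cdot> ?Q = assoc B A A R \<cdot> ((m \<otimes> m) \<otimes> Id B R)"
    by (simp add: hat_def merge shuffle)
  have "?rhs \<cdot> assoc B A A R
      = (Id B A \<otimes> hM R) \<cdot> hM ?R \<cdot> ((Id B A \<otimes> past A A (A \<otimes>\<^sub>o R)) \<cdot> ?Q) \<cdot> ((\<Delta> \<otimes> \<Delta>) \<otimes> Id B R)"
    using 1 by simp
  also have "\<dots> = ((Id B A \<otimes> hM R) \<cdot> hM ?R \<cdot> ?Q) \<cdot> (?mb \<otimes> Id B R) \<cdot> ((\<Delta> \<otimes> \<Delta>) \<otimes> Id B R)"
    unfolding 2 by (simp add: mb)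
  also have "\<dots> = assoc B A A R \<cdot> ((\<Delta> \<cdot> m) \<otimes> Id B R)"
    unfolding 3 comult_mult by (simp add: mb merge)
  also have "\<dots> = (hD R \<cdot> hM R) \<cdot> assoc B A A R"
    by (simp add: hat_def merge)
  finally have eq: "?rhs \<cdot> assoc B A A R = (hD R \<cdot> hM R) \<cdot> assoc B A A R" .
  show ?thesis
    by (rule iso_epi[OF eq[symmetric]]) simp_all
qed

lemma hat_involution:
  assumes [simp]: "R \<in> Obj B"
  shows "hS R \<cdot> hS R = hM R \<cdot> hM (A \<otimes>\<^sub>o R) \<cdot> (Id B A \<otimes> Id B A \<otimes> hS R) \<cdot> (Id B A \<otimes> Id B A \<otimes> hs R)
    \<cdot> hs (A \<otimes>\<^sub>o R) \<cdot> hT R \<cdot> hd (A \<otimes>\<^sub>o R) \<cdot> hS (A \<otimes>\<^sub>o R) \<cdot> (Id B A \<otimes> Id B A \<otimes> hd R)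
    \<cdot> hD (A \<otimes>\<^sub>o R) \<cdot> hD R" (is "_ = ?rhs")
proof -
  let ?AA = "A \<otimes>\<^sub>o A" and ?R = "A \<otimes>\<^sub>o R"
  \<comment> \<open>The right side is cut into comultiplications, characters, insertions with the
    twist, and multiplications. \<open>?P\<close> rebrackets between these stages, and
    \<open>?k\<close> removes the two units that the characters leave behind.\<close>
  let ?P = "assoc B A A ?R \<cdot> assoc B ?AA A R"
  let ?k = "(lunit B A \<otimes> Id B R) \<cdot> (runit B (\<one> \<otimes>\<^sub>o A) \<otimes> Id B R)"
  let ?f = "((\<delta> \<cdot> S) \<otimes> Id B A) \<otimes> \<delta>" and ?g = "(\<sigma> \<otimes> \<theta> A) \<otimes> (S \<cdot> \<sigma>)"
  have 0: "hD ?R \<cdot> hD R = ?P \<cdot> (((\<Delta> \<otimes> Id B A) \<cdot> \<Delta>) \<otimes> Id B R)"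
  proof -
    have "(\<Delta> \<otimes> Id B ?R) \<cdot> assoc B A A R = assoc B ?AA A R \<cdot> ((\<Delta> \<otimes> Id B A) \<otimes> Id B R)"
      by (simp add: shuffle)
    from comp_ext[OF this] show ?thesis by (simp add: hat_def interchange)
  qed
  have 1: "hd ?R \<cdot> hS ?R \<cdot> (Id B A \<otimes> Id B A \<otimes> hd R) \<cdot> ?P = ?k \<cdot> (?f \<otimes> Id B R)"
  proof -
    let ?l = "Id B A \<otimes> Id B A \<otimes> lunit B R" and ?d = "Id B A \<otimes> Id B A \<otimes> \<delta> \<otimes> Id B R"
    have "?l \<cdot> ?d \<cdot> ?P = assoc B A A R \<cdot> ((Id B ?AA \<otimes> lunit B R) \<cdot> assoc B ?AA \<one> R) \<cdot> ((Id B ?AA \<otimes> \<delta>) \<otimes> Id B R)"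
    proof -
      have "assoc B ?AA \<one> R \<cdot> ((Id B ?AA \<otimes> \<delta>) \<otimes> Id B R) = (Id B ?AA \<otimes> \<delta> \<otimes> Id B R) \<cdot> assoc B ?AA A R"
        by (simp add: assoc_nat)
      then show ?thesis by (simp add: assoc_nat_right)
    qed
    also have "\<dots> = assoc B A A R \<cdot> ((runit B ?AA \<cdot> (Id B ?AA \<otimes> \<delta>)) \<otimes> Id B R)"
      unfolding triangle[OF tensor_Obj'[OF A_Obj A_Obj] assms] by (simp add: merge)
    finally have d: "(Id B A \<otimes> Id B A \<otimes> hd R) \<cdot> ?P
        = assoc B A A R \<cdot> ((runit B ?AA \<cdot> (Id B ?AA \<otimes> \<delta>)) \<otimes> Id B R)"
      by (simp add: hat_def split)
    have "((\<delta> \<cdot> S) \<otimes> Id B ?R) \<cdot> assoc B A A R = assoc B \<one> A R \<cdot> (((\<delta> \<cdot> S) \<otimes> Id B A) \<otimes> Id B R)"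
      by (simp add: assoc_nat)
    note comp_ext[OF this]
    then have "hd ?R \<cdot> hS ?R \<cdot> (Id B A \<otimes> Id B A \<otimes> hd R) \<cdot> ?P
        = (lunit B ?R \<cdot> assoc B \<one> A R) \<cdot> (((\<delta> \<cdot> S) \<otimes> Id B A) \<otimes> Id B R)
          \<cdot> ((runit B ?AA \<cdot> (Id B ?AA \<otimes> \<delta>)) \<otimes> Id B R)"
      unfolding d by (simp add: hat_def interchange_ext)
    also have "\<dots> = (lunit B A \<otimes> Id B R) \<cdot> ((((\<delta> \<cdot> S) \<otimes> Id B A) \<cdot> runit B ?AA \<cdot> (Id B ?AA \<otimes> \<delta>)) \<otimes> Id B R)"
      unfolding lunit_tensor[OF A_Obj assms] by (simp add: interchange)
    also have "((\<delta> \<cdot> S) \<otimes> Id B A) \<cdot> runit B ?AA \<cdot> (Id B ?AA \<otimes> \<delta>) = runit B (\<one> \<otimes>\<^sub>o A) \<cdot> ?f"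
      using comp_ext[OF runit_nat[of "(\<delta> \<cdot> S) \<otimes> Id B A", symmetric], of "Id B ?AA \<otimes> \<delta>"]
      by (simp add: interchange)
    finally show ?thesis by (simp add: split)
  qed
  have 2: "(Id B A \<otimes> Id B A \<otimes> hS R) \<cdot> (Id B A \<otimes> Id B A \<otimes> hs R) \<cdot> hs ?R \<cdot> hT R \<cdot> ?k = ?P \<cdot> (?g \<otimes> Id B R)"
  proof -
    let ?h = "((S \<cdot> \<sigma>) \<otimes> Id B R) \<cdot> inv_arr B (lunit B R)"
    have "assoc B (\<one> \<otimes>\<^sub>o A) \<one> R = (Id B (\<one> \<otimes>\<^sub>o A) \<otimes> inv_arr B (lunit B R)) \<cdot> (runit B (\<one> \<otimes>\<^sub>o A) \<otimes> Id B R)"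
      using interchange_ext[of "Id B (\<one> \<otimes>\<^sub>o A)"] by (simp add: merge flip: triangle)
    then have "?P \<cdot> (?g \<otimes> Id B R) = (\<sigma> \<otimes> \<theta> A \<otimes> (S \<cdot> \<sigma>) \<otimes> Id B R) \<cdot> assoc B \<one> A (\<one> \<otimes>\<^sub>o R)
        \<cdot> (Id B (\<one> \<otimes>\<^sub>o A) \<otimes> inv_arr B (lunit B R)) \<cdot> (runit B (\<one> \<otimes>\<^sub>o A) \<otimes> Id B R)"
      by (simp add: assoc_nat assoc_nat_ext)
    also have "\<dots> = (\<sigma> \<otimes> \<theta> A \<otimes> ?h) \<cdot> assoc B \<one> A R \<cdot> (runit B (\<one> \<otimes>\<^sub>o A) \<otimes> Id B R)"
      by (simp add: assoc_nat_right interchange_ext) (simp add: interchange)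
    also have "assoc B \<one> A R = inv_arr B (lunit B ?R) \<cdot> (lunit B A \<otimes> Id B R)"
      by (simp flip: lunit_tensor)
    also have "(\<sigma> \<otimes> \<theta> A \<otimes> ?h) \<cdot> (inv_arr B (lunit B ?R) \<cdot> (lunit B A \<otimes> Id B R)) \<cdot> (runit B (\<one> \<otimes>\<^sub>o A) \<otimes> Id B R)
        = (\<sigma> \<otimes> Id B A \<otimes> ?h) \<cdot> ((Id B \<one> \<otimes> \<theta> A \<otimes> Id B R) \<cdot> inv_arr B (lunit B ?R)) \<cdot> ?k"
      by (simp add: interchange_ext) (simp add: interchange)
    also have "(Id B \<one> \<otimes> \<theta> A \<otimes> Id B R) \<cdot> inv_arr B (lunit B ?R) = inv_arr B (lunit B ?R) \<cdot> (\<theta> A \<otimes> Id B R)"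
      by (simp add: lunit_inv_nat)
    finally show ?thesis by (simp add: hat_def interchange_ext) (simp add: merge)
  qed
  have 3: "hM R \<cdot> hM ?R \<cdot> ?P = (m \<cdot> (m \<otimes> Id B A)) \<otimes> Id B R"
  proof -
    have "inv_arr B (assoc B A A R) \<cdot> (m \<otimes> Id B ?R) = ((m \<otimes> Id B A) \<otimes> Id B R) \<cdot> inv_arr B (assoc B ?AA A R)"
      by (rule assoc_inv_nat_left(1)[of m A R A, simplified])
    from comp_ext[OF this] show ?thesis by (simp add: hat_def interchange)
  qed
  have "?rhs = hM R \<cdot> hM ?R \<cdot> (Id B A \<otimes> Id B A \<otimes> hS R) \<cdot> (Id B A \<otimes> Id B A \<otimes> hs R) \<cdot> hs ?R \<cdot> hT R
      \<cdot> (hd ?R \<cdot> hS ?R \<cdot> (Id B A \<otimes> Id B A \<otimes> hd R) \<cdot> ?P) \<cdot> (((\<Delta> \<otimes> Id B A) \<cdot> \<Delta>) \<otimes> Id B R)"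
    unfolding 0 by simp
  also have "\<dots> = hM R \<cdot> hM ?R \<cdot> ((Id B A \<otimes> Id B A \<otimes> hS R) \<cdot> (Id B A \<otimes> Id B A \<otimes> hs R) \<cdot> hs ?R \<cdot> hT R
      \<cdot> ?k) \<cdot> (?f \<otimes> Id B R) \<cdot> (((\<Delta> \<otimes> Id B A) \<cdot> \<Delta>) \<otimes> Id B R)"
    unfolding 1 by simp
  also have "\<dots> = (hM R \<cdot> hM ?R \<cdot> ?P) \<cdot> (?g \<otimes> Id B R) \<cdot> (?f \<otimes> Id B R) \<cdot> (((\<Delta> \<otimes> Id B A) \<cdot> \<Delta>) \<otimes> Id B R)"
    unfolding 2 by simp
  also have "\<dots> = (S \<cdot> S) \<otimes> Id B R"
    unfolding 3 involution by (simp add: merge)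
  finally have rhs: "?rhs = (S \<cdot> S) \<otimes> Id B R" .
  have "hS R \<cdot> hS R = (S \<cdot> S) \<otimes> Id B R"
    by (simp add: hat_def interchange)
  then show ?thesis using rhs by (rule trans[OF _ sym])
qed

end

section \<open>The category as a model of the Hopf strand calculus\<close>

context hopf_strand_model
begin

lemma small_cases:
  assumes "n \<le> (2::nat)"
  obtains "n = 0" | "n = Suc 0" | "n = Suc (Suc 0)"
  using assms by linarith

lemma J_Arr [simp]:
  assumes "R \<in> Obj B"
  shows "J n R \<in> Arr B" "Dom B (J n R) = T n \<otimes>\<^sub>o R" "iso B (J n R)"
proof -
  have "J n R \<in> Arr B \<and> Dom B (J n R) = T n \<otimes>\<^sub>o R \<and> iso B (J n R)"
    by (cases "(n, R)" rule: J.cases) (use assms in auto)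
  then show "J n R \<in> Arr B" "Dom B (J n R) = T n \<otimes>\<^sub>o R" "iso B (J n R)" by auto
qed

lemma J_Cod [simp]: "n \<le> 2 \<Longrightarrow> R \<in> Obj B \<Longrightarrow> Cod B (J n R) = PO n R"
  by (erule small_cases) auto

lemma J_nat: "n \<le> 2 \<Longrightarrow> k \<in> Arr B \<Longrightarrow> J n (Cod B k) \<cdot> (Id B (T n) \<otimes> k) = PA n k \<cdot> J n (Dom B k)"
  by (erule small_cases) (simp_all add: lunit_nat assoc_nat_right)

definition arity :: "nat \<Rightarrow> nat \<Rightarrow> 'm \<Rightarrow> bool" where
  "arity i j f \<longleftrightarrow> i \<le> 2 \<and> j \<le> 2 \<and> f \<in> hom B (T i) (T j)"

lemma arityD:
  assumes "arity i j f"
  shows "i \<le> 2" "j \<le> 2" "f \<in> Arr B" "Dom B f = T i" "Cod B f = T j"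
  using assms by (auto simp: arity_def hom_def)

lemma natural_hat:
  assumes "arity i j f"
  shows "natural i j (hat i j f)"
proof (rule naturalI)
  note [simp] = arityD[OF assms]
  show "hat i j f R \<in> Arr B \<and> Dom B (hat i j f R) = PO i R \<and> Cod B (hat i j f R) = PO j R"
    if "R \<in> Obj B" for R
    using that by (simp add: hat_def)
  fix k assume k [simp]: "k \<in> Arr B"
  let ?R = "Dom B k" and ?R' = "Cod B k"
  show "hat i j f ?R' \<cdot> PA i k = PA j k \<cdot> hat i j f ?R"
  proof (rule iso_epi[of _ "J i ?R"])
    have "(hat i j f ?R' \<cdot> PA i k) \<cdot> J i ?R = hat i j f ?R' \<cdot> J i ?R' \<cdot> (Id B (T i) \<otimes> k)"
      by (simp add: J_nat hat_def)
    also have "\<dots> = J j ?R' \<cdot> (Id B (T j) \<otimes> k) \<cdot> (f \<otimes> Id B ?R)"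
      by (simp add: hat_def interchange)
    also have "\<dots> = (PA j k \<cdot> hat i j f ?R) \<cdot> J i ?R"
      using comp_ext[OF J_nat[of j k]] by (simp add: hat_def)
    finally show "(hat i j f ?R' \<cdot> PA i k) \<cdot> J i ?R = (PA j k \<cdot> hat i j f ?R) \<cdot> J i ?R" .
  qed (simp_all add: hat_def)
qed

fun cr :: "nat \<Rightarrow> 'o \<Rightarrow> 'm" where
  "cr 0 R = Id B (A \<otimes>\<^sub>o R)"
| "cr (Suc 0) R = past A A R"
| "cr (Suc (Suc k)) R = (Id B A \<otimes> past A A R) \<cdot> past A A (A \<otimes>\<^sub>o R)"

fun cl :: "nat \<Rightarrow> 'o \<Rightarrow> 'm" where
  "cl 0 R = Id B (A \<otimes>\<^sub>o R)"
| "cl (Suc 0) R = past A A R"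
| "cl (Suc (Suc k)) R = past A A (A \<otimes>\<^sub>o R) \<cdot> (Id B A \<otimes> past A A R)"

text \<open>For no legs this is compatibility of the braiding with the unit, for two legs a hexagon.
  Larger lengths never arise, since a generator has at most two inputs and two outputs.\<close>

lemma cr_J: "n \<le> 2 \<Longrightarrow> R \<in> Obj B \<Longrightarrow>
    cr n R \<cdot> (Id B A \<otimes> J n R) = J n (A \<otimes>\<^sub>o R) \<cdot> past A (T n) R"
  by (erule small_cases) (simp_all add: past_unit_right past_tensor_right)

lemma cl_J: "n \<le> 2 \<Longrightarrow> R \<in> Obj B \<Longrightarrow>
    cl n R \<cdot> J n (A \<otimes>\<^sub>o R) = (Id B A \<otimes> J n R) \<cdot> past (T n) A R"
  by (erule small_cases) (simp_all add: past_unit_left past_tensor_left)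

lemma natural_past: "natural (Suc (Suc 0)) (Suc (Suc 0)) (past A A)"
proof (rule naturalI)
  fix k assume "k \<in> Arr B"
  then show "past A A (Cod B k) \<cdot> PA (Suc (Suc 0)) k = PA (Suc (Suc 0)) k \<cdot> past A A (Dom B k)"
    using past_nat[of "Id B A" "Id B A" k] by simp
qed simp

lemma natural_cr:
  assumes "n \<le> 2"
  shows "natural (Suc n) (Suc n) (cr n)" and "natural (Suc n) (Suc n) (cl n)"
proof -
  have p: "natural 3 3 (\<lambda>R. past A A (A \<otimes>\<^sub>o R))" "natural 3 3 (\<lambda>R. Id B A \<otimes> past A A R)"
    using natural_pad[OF natural_past, of 1] natural_shift[OF natural_past]
    by (simp_all add: numeral_eq_Suc)
  have 0: "cr 0 = (\<lambda>R. Id B (PO (Suc 0) R))" "cl 0 = (\<lambda>R. Id B (PO (Suc 0) R))"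
    and 1: "cr (Suc 0) = past A A" "cl (Suc 0) = past A A"
    and 2: "cr (Suc (Suc 0)) = (\<lambda>R. (Id B A \<otimes> past A A R) \<cdot> past A A (A \<otimes>\<^sub>o R))"
      "cl (Suc (Suc 0)) = (\<lambda>R. past A A (A \<otimes>\<^sub>o R) \<cdot> (Id B A \<otimes> past A A R))"
    by auto
  show "natural (Suc n) (Suc n) (cr n)"
    using assms by (rule small_cases)
      (use natural_Id[of "Suc 0"] natural_past natural_comp[OF p] in \<open>simp_all only: 0 1 2 numeral_3_eq_3\<close>)
  show "natural (Suc n) (Suc n) (cl n)"
    using assms by (rule small_cases)
      (use natural_Id[of "Suc 0"] natural_past natural_comp[OF p(2,1)] in \<open>simp_all only: 0 1 2 numeral_3_eq_3\<close>)
qed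

text \<open>Through \<open>cr_J\<close> the successive crossings become one braiding with
  \<open>T\<close>, to which naturality of the braiding applies directly.\<close>

lemma cr_hat:
  assumes f: "arity i j f" and R [simp]: "R \<in> Obj B"
  shows "cr j R \<cdot> (Id B A \<otimes> hat i j f R) = hat i j f (A \<otimes>\<^sub>o R) \<cdot> cr i R"
proof (rule iso_epi[of _ "Id B A \<otimes> J i R"])
  note [simp] = arityD[OF f] natural_Arr[OF natural_cr(1)] natural_Arr[OF natural_hat[OF f]]
  have "(cr j R \<cdot> (Id B A \<otimes> hat i j f R)) \<cdot> (Id B A \<otimes> J i R)
      = (cr j R \<cdot> (Id B A \<otimes> J j R)) \<cdot> (Id B A \<otimes> f \<otimes> Id B R)"
    by (simp add: interchange) (simp add: hat_def)
  also have "\<dots> = J j (A \<otimes>\<^sub>o R) \<cdot> (f \<otimes> Id B (A \<otimes>\<^sub>o R)) \<cdot> past A (T i) R"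
    using past_nat[of "Id B A" f "Id B R"] by (simp add: cr_J)
  also have "\<dots> = hat i j f (A \<otimes>\<^sub>o R) \<cdot> J i (A \<otimes>\<^sub>o R) \<cdot> past A (T i) R"
    by (simp add: hat_def)
  also have "\<dots> = (hat i j f (A \<otimes>\<^sub>o R) \<cdot> cr i R) \<cdot> (Id B A \<otimes> J i R)"
    by (simp add: cr_J)
  finally show "(cr j R \<cdot> (Id B A \<otimes> hat i j f R)) \<cdot> (Id B A \<otimes> J i R)
      = (hat i j f (A \<otimes>\<^sub>o R) \<cdot> cr i R) \<cdot> (Id B A \<otimes> J i R)" .
qed (simp_all add: arityD[OF f] natural_Arr[OF natural_cr(1)] natural_Arr[OF natural_hat[OF f]])

lemma cl_hat:
  assumes f: "arity i j f" and R [simp]: "R \<in> Obj B"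
  shows "cl j R \<cdot> hat i j f (A \<otimes>\<^sub>o R) = (Id B A \<otimes> hat i j f R) \<cdot> cl i R"
proof (rule iso_epi[of _ "J i (A \<otimes>\<^sub>o R)"])
  note [simp] = arityD[OF f] natural_Arr[OF natural_cr(2)] natural_Arr[OF natural_hat[OF f]]
  have "(cl j R \<cdot> hat i j f (A \<otimes>\<^sub>o R)) \<cdot> J i (A \<otimes>\<^sub>o R)
      = (cl j R \<cdot> J j (A \<otimes>\<^sub>o R)) \<cdot> (f \<otimes> Id B (A \<otimes>\<^sub>o R))"
    by (simp add: hat_def)
  also have "\<dots> = (Id B A \<otimes> J j R) \<cdot> (Id B A \<otimes> f \<otimes> Id B R) \<cdot> past (T i) A R"
    using past_nat[of f "Id B A" "Id B R"] by (simp add: cl_J)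
  also have "\<dots> = (Id B A \<otimes> hat i j f R) \<cdot> (Id B A \<otimes> J i R) \<cdot> past (T i) A R"
    by (simp add: interchange_ext) (simp add: hat_def)
  also have "\<dots> = ((Id B A \<otimes> hat i j f R) \<cdot> cl i R) \<cdot> J i (A \<otimes>\<^sub>o R)"
    by (simp add: cl_J)
  finally show "(cl j R \<cdot> hat i j f (A \<otimes>\<^sub>o R)) \<cdot> J i (A \<otimes>\<^sub>o R)
      = ((Id B A \<otimes> hat i j f R) \<cdot> cl i R) \<cdot> J i (A \<otimes>\<^sub>o R)" .
qed (simp_all add: arityD[OF f] natural_Arr[OF natural_cr(2)] natural_Arr[OF natural_hat[OF f]])

abbreviation Cop where "Cop \<equiv> op (Suc (Suc 0)) (Suc (Suc 0)) (past A A)"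

lemma cross_op:
  assumes "n \<le> 2"
  shows "cross_right Cop n i x = op (Suc n) (Suc n) (cr n) i x"
    and "cross_left Cop n i x = op (Suc n) (Suc n) (cl n) i x"
proof -
  note pad = op_pad[OF natural_past, of _ _ "Suc 0", simplified]
  note shift = op_shift[OF natural_past]
  note np = natural_pad[OF natural_past, of "Suc 0", simplified]
  note ns = natural_shift[OF natural_past]
  have 0: "cr 0 = (\<lambda>R. Id B (PO (Suc 0) R))" "cl 0 = (\<lambda>R. Id B (PO (Suc 0) R))"
    and 1: "cr (Suc 0) = past A A" "cl (Suc 0) = past A A"
    and 2: "cr (Suc (Suc 0)) = (\<lambda>R. (Id B A \<otimes> past A A R) \<cdot> past A A (A \<otimes>\<^sub>o R))"
      "cl (Suc (Suc 0)) = (\<lambda>R. past A A (A \<otimes>\<^sub>o R) \<cdot> (Id B A \<otimes> past A A R))"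
    by auto
  have "Cop (Suc i) (Cop i x) = op (Suc (Suc (Suc 0))) (Suc (Suc (Suc 0))) (cr (Suc (Suc 0))) i x"
    by (simp only: pad[of i x] shift op_comp[OF np ns] 2)
  moreover have "Cop i (Cop (Suc i) x) = op (Suc (Suc (Suc 0))) (Suc (Suc (Suc 0))) (cl (Suc (Suc 0))) i x"
    by (subst pad) (simp only: shift op_comp[OF ns np] 2)
  moreover have "x = op (Suc 0) (Suc 0) (cr 0) i x" "x = op (Suc 0) (Suc 0) (cl 0) i x"
    unfolding 0 by (rule op_Id[symmetric])+
  ultimately show "cross_right Cop n i x = op (Suc n) (Suc n) (cr n) i x"
    and "cross_left Cop n i x = op (Suc n) (Suc n) (cl n) i x"
    using assms by (auto elim!: small_cases simp: 1 simp del: cr.simps cl.simps)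
qed

lemma cross_hat:
  assumes f: "arity p q f"
  shows "cross_right Cop q i (op p q (hat p q f) (Suc i) x) = op p q (hat p q f) i (cross_right Cop p i x)"
    and "cross_left Cop q i (op p q (hat p q f) i x) = op p q (hat p q f) (Suc i) (cross_left Cop p i x)"
proof -
  note n = natural_hat[OF f]
  note ar = arityD(1,2)[OF f]
  note ns = natural_shift[OF n] and np = natural_pad[OF n, of "Suc 0", simplified]
  note pad = op_pad[OF n, of _ _ "Suc 0", simplified] and shift = op_shift[OF n]
  show "cross_right Cop q i (op p q (hat p q f) (Suc i) x) = op p q (hat p q f) i (cross_right Cop p i x)"
  proof -
    have "cross_right Cop q i (op p q (hat p q f) (Suc i) x)
        = op (Suc p) (Suc q) (\<lambda>R. cr q R \<cdot> (Id B A \<otimes> hat p q f R)) i x"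
      by (simp only: cross_op ar shift op_comp[OF ns natural_cr(1)])
    also have "\<dots> = op (Suc p) (Suc q) (\<lambda>R. hat p q f (A \<otimes>\<^sub>o R) \<cdot> cr p R) i x"
      by (simp only: op_cong[OF cr_hat[OF f]])
    finally show ?thesis by (subst pad) (simp only: cross_op ar op_comp[OF natural_cr(1) np])
  qed
  show "cross_left Cop q i (op p q (hat p q f) i x) = op p q (hat p q f) (Suc i) (cross_left Cop p i x)"
  proof -
    have "cross_left Cop q i (op p q (hat p q f) i x)
        = op (Suc p) (Suc q) (\<lambda>R. cl q R \<cdot> hat p q f (A \<otimes>\<^sub>o R)) i x"
      by (simp only: cross_op ar pad[of i x] op_comp[OF np natural_cr(2)])
    also have "\<dots> = op (Suc p) (Suc q) (\<lambda>R. (Id B A \<otimes> hat p q f R) \<cdot> cl p R) i x"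
      by (simp only: op_cong[OF cl_hat[OF f]])
    finally show ?thesis by (simp only: cross_op ar shift op_comp[OF natural_cr(2) ns])
  qed
qed

definition gens where "gens = {(p, q, op p q (hat p q f)) | p q f. arity p q f}"

lemma gens_I: "arity p q f \<Longrightarrow> (p, q, op p q (hat p q f)) \<in> gens"
  by (auto simp: gens_def)

lemma arity_generators [simp]:
  "arity (Suc (Suc 0)) (Suc (Suc 0)) (braid B A A)" "arity (Suc (Suc 0)) (Suc 0) m" "arity 0 (Suc 0) u"
  "arity (Suc 0) (Suc (Suc 0)) \<Delta>" "arity (Suc 0) 0 \<epsilon>" "arity (Suc 0) (Suc 0) S"
  "arity (Suc 0) 0 \<delta>" "arity 0 (Suc 0) \<sigma>" "arity (Suc 0) (Suc 0) (\<theta> A)"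
  by (simp_all add: arity_def hom_def)

lemma hat_braid: "hat (Suc (Suc 0)) (Suc (Suc 0)) (braid B A A) = past A A"
  by (intro ext) (simp add: hat_def past_def)

lemma op_at':
  assumes "natural n q F" "y \<in> points" "i + q \<le> K"
  shows "op n q F i y K = PA i (F (PO (K - (i + q)) \<one>)) \<cdot> y (K + n - q)"
proof -
  from assms(3) obtain N where "K = i + q + N" using le_Suc_ex by blast
  then show ?thesis using op_at[OF assms(1,2), of i N] by (simp add: add.commute add.left_commute)
qed

text \<open>Transfers an identity of families to words of insertions. \<open>L\<close> and
  \<open>K\<close> are the ends of the affected strands before and after; beyond them only a common
  tail of length \<open>N\<close> remains.\<close>

lemma word_eqI:
  assumes "\<And>R. R \<in> Obj B \<Longrightarrow> F R = G R" and "x \<notin> points \<Longrightarrow> X = Z"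
    and "x \<in> points \<Longrightarrow> X \<in> points" "x \<in> points \<Longrightarrow> Z \<in> points"
    and "\<And>N. x \<in> points \<Longrightarrow> X (K + N) = PA i (F (PO N \<one>)) \<cdot> x (L + N)"
    and "\<And>N. x \<in> points \<Longrightarrow> Z (K + N) = PA i (G (PO N \<one>)) \<cdot> x (L + N)"
  shows "X = Z"
proof (cases "x \<in> points")
  case True
  show ?thesis
    by (rule points_eqI[of _ _ K]) (use True assms in simp_all)
qed (rule assms(2))

lemmas natural_gen [simp] = arity_generators(2-)[THEN natural_hat] natural_past

abbreviation "Mop \<equiv> op (Suc (Suc 0)) (Suc 0) hM"
abbreviation "Uop \<equiv> op 0 (Suc 0) hU"
abbreviation "Dop \<equiv> op (Suc 0) (Suc (Suc 0)) hD"
abbreviation "Eop \<equiv> op (Suc 0) 0 hE"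
abbreviation "Sop \<equiv> op (Suc 0) (Suc 0) hS"
abbreviation "dop \<equiv> op (Suc 0) 0 hd"
abbreviation "sop \<equiv> op 0 (Suc 0) hs"
abbreviation "Top \<equiv> op (Suc 0) (Suc 0) hT"

lemma op_M_assoc: "Mop i (Mop (Suc i) x) = Mop i (Mop i x)"
  by (rule word_eqI[OF hat_assoc, where K="Suc i" and i=i and L="Suc (Suc (Suc i))" and x=x])
    (simp_all add: op_at', (simp_all add: PA_comp)?)

lemma op_M_U_left: "Mop i (Uop i x) = x"
  by (rule word_eqI[OF hat_unit_left, where K="Suc i" and i=i and L="Suc i" and x=x])
    (simp_all add: op_at', (simp_all add: PA_comp)?)

lemma op_M_U_right: "Mop i (Uop (Suc i) x) = x"
  by (rule word_eqI[OF hat_unit_right, where K="Suc i" and i=i and L="Suc i" and x=x])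
    (simp_all add: op_at', (simp_all add: PA_comp)?)

lemma op_D_coassoc: "Dop (Suc i) (Dop i x) = Dop i (Dop i x)"
  by (rule word_eqI[OF hat_coassoc, where K="Suc (Suc (Suc i))" and i=i and L="Suc i" and x=x])
    (simp_all add: op_at', (simp_all add: PA_comp)?)

lemma op_E_D_left: "Eop i (Dop i x) = x"
  by (rule word_eqI[OF hat_counit_left, where K="Suc i" and i=i and L="Suc i" and x=x])
    (simp_all add: op_at', (simp_all add: PA_comp)?)

lemma op_E_D_right: "Eop (Suc i) (Dop i x) = x"
  by (rule word_eqI[OF hat_counit_right, where K="Suc i" and i=i and L="Suc i" and x=x])
    (simp_all add: op_at', (simp_all add: PA_comp)?)

lemma op_D_M: "Dop i (Mop i x) = Mop (Suc i) (Mop i (Cop (Suc i) (Dop i (Dop (Suc i) x))))"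
  by (rule word_eqI[OF hat_comult_mult, where K="Suc (Suc i)" and i=i and L="Suc (Suc i)" and x=x])
    (simp_all add: op_at', (simp_all add: PA_comp)?)

lemma op_D_U: "Dop i (Uop i x) = Uop i (Uop i x)"
  by (rule word_eqI[OF hat_group_like[OF _ _ _ _ comult_unit], where K="Suc (Suc i)" and i=i and L="i" and x=x])
    (simp_all add: op_at', (simp_all add: PA_comp)?)

lemma op_E_M: "Eop i (Mop i x) = Eop i (Eop i x)"
  by (rule word_eqI[OF hat_character[OF _ _ _ _ counit_mult], where K="i" and i=i and L="Suc (Suc i)" and x=x])
    (simp_all add: op_at', (simp_all add: PA_comp)?)

lemma op_E_U: "Eop i (Uop i x) = x"
  by (rule word_eqI[OF hat_pairing[OF _ _ _ _ _ _ _ counit_unit], where K="i" and i=i and L="i" and x=x])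
    (simp_all add: op_at', (simp_all add: PA_comp)?)

lemma op_M_S_left: "Mop i (Sop i (Dop i x)) = Uop i (Eop i x)"
  by (rule word_eqI[OF hat_antipode_left, where K="Suc i" and i=i and L="Suc i" and x=x])
    (simp_all add: op_at', (simp_all add: PA_comp)?)

lemma op_M_S_right: "Mop i (Sop (Suc i) (Dop i x)) = Uop i (Eop i x)"
  by (rule word_eqI[OF hat_antipode_right, where K="Suc i" and i=i and L="Suc i" and x=x])
    (simp_all add: op_at', (simp_all add: PA_comp)?)

lemma op_d_M: "dop i (Mop i x) = dop i (dop i x)"
  by (rule word_eqI[OF hat_character[OF _ _ _ _ delta_mult], where K="i" and i=i and L="Suc (Suc i)" and x=x])
    (simp_all add: op_at', (simp_all add: PA_comp)?)

lemma op_d_U: "dop i (Uop i x) = x"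
  by (rule word_eqI[OF hat_pairing[OF _ _ _ _ _ _ _ delta_unit], where K="i" and i=i and L="i" and x=x])
    (simp_all add: op_at', (simp_all add: PA_comp)?)

lemma op_D_s: "Dop i (sop i x) = sop i (sop i x)"
  by (rule word_eqI[OF hat_group_like[OF _ _ _ _ comult_sigma], where K="Suc (Suc i)" and i=i and L="i" and x=x])
    (simp_all add: op_at', (simp_all add: PA_comp)?)

lemma op_E_s: "Eop i (sop i x) = x"
  by (rule word_eqI[OF hat_pairing[OF _ _ _ _ _ _ _ counit_sigma], where K="i" and i=i and L="i" and x=x])
    (simp_all add: op_at', (simp_all add: PA_comp)?)

lemma op_d_s: "dop i (sop i x) = x"
  by (rule word_eqI[OF hat_pairing[OF _ _ _ _ _ _ _ delta_sigma], where K="i" and i=i and L="i" and x=x])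
    (simp_all add: op_at', (simp_all add: PA_comp)?)

lemma op_S_S: "Sop i (Sop i x) = Mop i (Mop i (Sop (Suc (Suc i)) (sop (Suc (Suc i)) (sop i (Top i (dop i (Sop i (dop (Suc (Suc i)) (Dop i (Dop i x))))))))))"
  by (rule word_eqI[OF hat_involution, where K="Suc i" and i=i and L="Suc i" and x=x])
    (simp_all add: op_at', (simp_all add: PA_comp)?)

sublocale st: hopf_strands gens Cop Mop Uop Dop Eop Sop dop sop Top
proof unfold_locales
  show "(2, 2, Cop) \<in> gens"
    using gens_I[OF arity_generators(1)] by (simp add: hat_braid numeral_2_eq_2)
  show "F i (G (i + n + k) x) = G (i + q + k) (F i x)"
    if "(n, q, F) \<in> gens" "(p, r, G) \<in> gens" for n q F p r G i k x
    using that by (auto simp: gens_def op_slide natural_hat)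
  show "cross_right Cop q i (F (Suc i) x) = F i (cross_right Cop n i x)"
    and "cross_left Cop q i (F i x) = F (Suc i) (cross_left Cop n i x)"
    if "(n, q, F) \<in> gens" for n q F i x
    using that by (auto simp: gens_def cross_hat)
qed (rule gens_I arity_generators(2-) op_M_assoc op_M_U_left op_M_U_right op_D_coassoc op_E_D_left op_E_D_right op_D_M op_D_U op_E_M op_E_U op_M_S_left op_M_S_right op_d_M op_d_U op_D_s op_E_s op_d_s op_S_S)+

end

section \<open>Evaluating diagrams\<close>

context hopf_strand_model
begin

lemma tensor_pow_PO: "tensor_pow B A n = PO n \<one>"
  by (induction n) auto

lemma diag_points [simp]:
  assumes "st.diag n k F" "x \<in> points"
  shows "F i x \<in> points"
  using assms
proof (induction arbitrary: i x)
  case (gen n q F)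
  then show ?case by (auto simp: gens_def natural_hat)
qed auto

abbreviation lam where "lam n \<equiv> diag_action B H n"

text \<open>The typing of \<open>lam n\<close> is a premise because \<open>lam_Arr\<close> is itself
  proved by induction from this recursion.\<close>

lemma lam_Suc: "lam (Suc n) = hM (PO n \<one>) \<cdot> (Id B A \<otimes> Id B A \<otimes> lam n) \<cdot> (Id B A \<otimes> past A A (PO n \<one>)) \<cdot> hD (PO (Suc n) \<one>)"
  if [simp]: "lam n \<in> Arr B" "Dom B (lam n) = PO (Suc n) \<one>" "Cod B (lam n) = PO n \<one>"
proof -
  let ?X = "PO n \<one>"
  have "middle_braid B A A A ?X = inv_arr B (assoc B A A (A \<otimes>\<^sub>o ?X)) \<cdot> (Id B A \<otimes> past A A ?X) \<cdot> assoc B A A (A \<otimes>\<^sub>o ?X)"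
    by (simp add: middle_braid_def past_def)
  moreover have "inv_arr B (assoc B A A ?X) \<cdot> (Id B A \<otimes> Id B A \<otimes> lam n)
      = (Id B (A \<otimes>\<^sub>o A) \<otimes> lam n) \<cdot> inv_arr B (assoc B A A (A \<otimes>\<^sub>o ?X))"
    using assoc_inv_nat[of "Id B A" "Id B A" "lam n" A A ?X] by simp
  note comp_ext[OF this]
  ultimately show ?thesis
    by (simp add: tensor_pow_PO hat_def) (simp add: interchange_ext)
qed

lemma lam_Arr [simp]: "lam n \<in> Arr B" "Dom B (lam n) = A \<otimes>\<^sub>o PO n \<one>" "Cod B (lam n) = PO n \<one>"
proof -
  have "lam n \<in> Arr B \<and> Dom B (lam n) = PO (Suc n) \<one> \<and> Cod B (lam n) = PO n \<one>"
  proof (induction n)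
    case (Suc n)
    then show ?case by (simp add: lam_Suc del: diag_action.simps)
  qed simp
  then show "lam n \<in> Arr B" "Dom B (lam n) = A \<otimes>\<^sub>o PO n \<one>" "Cod B (lam n) = PO n \<one>"
    by simp_all
qed

lemma Lam_at: "x \<in> points \<Longrightarrow> st.Lam n i x (i + n) = PA i (lam n) \<cdot> x (Suc (i + n))"
proof (induction n arbitrary: i x)
  case 0
  \<comment> \<open>\<open>diag_action\<close> starts with the right unit constraint and
    \<open>hat\<close> with the left one; the two agree at the unit object.\<close>
  have "hE \<one> = lam 0"
    using runit_nat[of \<epsilon>] by (simp add: hat_def lunit_runit_unit)
  then show ?case using 0 by (simp add: op_at')
next
  case (Suc n)
  note pt [simp] = \<open>x \<in> points\<close>
  let ?y = "Cop (Suc i) (Dop i x)"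
  have "st.Lam (Suc n) i x (i + Suc n) = PA i (hM (PO n \<one>)) \<cdot> st.Lam n (Suc (Suc i)) ?y (Suc (Suc i) + n)"
    using op_at'[of "Suc (Suc 0)" "Suc 0" hM "st.Lam n (Suc (Suc i)) ?y" i "i + Suc n"]
    by (simp add: diag_points[OF st.Lam_dg])
  also have "\<dots> = PA i (hM (PO n \<one>)) \<cdot> PA (Suc (Suc i)) (lam n) \<cdot> PA (Suc i) (past A A (PO n \<one>))
      \<cdot> PA i (hD (PO (Suc n) \<one>)) \<cdot> x (Suc (i + Suc n))"
    by (subst Suc.IH) (simp_all add: op_at')
  finally show ?case
    by (simp add: lam_Suc PA_comp del: diag_action.simps)
qed

abbreviation double_braid where
  "double_braid n \<equiv> braid B (PO n \<one>) A \<cdot> braid B A (PO n \<one>)"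

lemma Cl_Cr_at: "x \<in> points \<Longrightarrow> st.Cl n i (st.Cr n i x) (Suc (i + n)) = PA i (double_braid n) \<cdot> x (Suc (i + n))"
proof (induction n arbitrary: i x)
  case 0
  then show ?case by (simp add: double_braid_unit)
next
  case (Suc n)
  note pt [simp] = \<open>x \<in> points\<close>
  let ?y = "st.Cl n (Suc i) (st.Cr n (Suc i) (Cop i x))"
  have "st.Cl (Suc n) i (st.Cr (Suc n) i x) (Suc (i + Suc n)) = PA i (past A A (PO n \<one>)) \<cdot> ?y (Suc (Suc i + n))"
    using op_at'[of "Suc (Suc 0)" "Suc (Suc 0)" "past A A" ?y i "Suc (i + Suc n)"]
    by (simp add: diag_points[OF st.Cl_diag] diag_points[OF st.Cr_diag])
  also have "\<dots> = PA i (past A A (PO n \<one>)) \<cdot> PA (Suc i) (double_braid n)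
      \<cdot> PA i (past A A (PO n \<one>)) \<cdot> x (Suc (i + Suc n))"
    by (subst Suc.IH) (simp_all add: op_at')
  finally show ?case
    by (simp add: double_braid_tensor PA_comp)
qed

lemma Tw_points: "x \<in> points \<Longrightarrow> st.Tw n i x \<in> points"
  by (induction n arbitrary: i x) (simp_all add: diag_points[OF st.Cl_diag] diag_points[OF st.Cr_diag])

lemma Tw_at: "x \<in> points \<Longrightarrow> st.Tw n i x (i + n) = PA i (\<theta> (PO n \<one>)) \<cdot> x (i + n)"
proof (induction n arbitrary: i x)
  case 0
  then show ?case by (simp add: twist_unit)
next
  case (Suc n)
  note pt [simp] = \<open>x \<in> points\<close>
  let ?P = "PO n \<one>" and ?y = "st.Cl n i (st.Cr n i x)"
  have y: "?y \<in> points"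
    by (simp add: diag_points[OF st.Cl_diag] diag_points[OF st.Cr_diag])
  have "hT ?P \<cdot> (Id B A \<otimes> \<theta> ?P) \<cdot> double_braid n = \<theta> (PO (Suc n) \<one>)"
    by (simp add: twist_tensor hat_def interchange_ext)
  note t = this[symmetric]
  have eq: "PA i (\<theta> (PO (Suc n) \<one>)) = PA i (hT ?P) \<cdot> PA (Suc i) (\<theta> ?P) \<cdot> PA i (double_braid n)"
    unfolding t by (simp add: PA_comp)
  have "st.Tw (Suc n) i x (i + Suc n) = PA i (hT ?P) \<cdot> st.Tw n (Suc i) ?y (Suc i + n)"
    using op_at'[of "Suc 0" "Suc 0" hT "st.Tw n (Suc i) ?y" i "i + Suc n"] y
    by (simp add: Tw_points)
  also have "\<dots> = PA i (hT ?P) \<cdot> PA (Suc i) (\<theta> ?P) \<cdot> PA i (double_braid n) \<cdot> x (i + Suc n)"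
    using Cl_Cr_at[OF pt, of n i] by (subst Suc.IH[OF y]) simp
  finally show ?case unfolding eq by simp
qed

lemma twisted_antipode_hat:
  assumes [simp]: "R \<in> Obj B"
  shows "hS R \<cdot> hd (A \<otimes>\<^sub>o R) \<cdot> hD R = twisted_antipode B H \<delta> \<otimes> Id B R"
proof -
  have "(\<delta> \<otimes> Id B (A \<otimes>\<^sub>o R)) \<cdot> assoc B A A R = assoc B \<one> A R \<cdot> ((\<delta> \<otimes> Id B A) \<otimes> Id B R)"
    by (simp add: assoc_nat)
  note comp_ext[OF this]
  then have "hd (A \<otimes>\<^sub>o R) \<cdot> hD R = (lunit B A \<otimes> Id B R) \<cdot> ((\<delta> \<otimes> Id B A) \<otimes> Id B R) \<cdot> (\<Delta> \<otimes> Id B R)"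
    using comp_ext[OF lunit_tensor[of A R]] by (simp add: hat_def)
  moreover have "S \<cdot> lunit B A \<cdot> (\<delta> \<otimes> Id B A) = lunit B A \<cdot> (\<delta> \<otimes> S)"
    using comp_ext[OF lunit_nat[of S, symmetric], of "\<delta> \<otimes> Id B A"] by (simp add: interchange)
  note comp_ext[OF this[symmetric], of \<Delta>]
  ultimately show ?thesis
    by (simp add: hat_def twisted_antipode_def merge)
qed

lemma Pi_at:
  assumes [simp]: "x \<in> points"
  shows "st.Pi n 0 x n = lam n \<cdot> (twisted_antipode B H \<delta> \<otimes> Id B (PO n \<one>)) \<cdot> x (Suc n)"
proof -
  have "st.Pi n 0 x n = lam n \<cdot> st.St 0 x (Suc n)"
    using Lam_at[of "st.St 0 x" n 0] by (simp add: st.Pi_def diag_points[OF st.St_dg])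
  also have "st.St 0 x (Suc n) = hS (PO n \<one>) \<cdot> hd (A \<otimes>\<^sub>o PO n \<one>) \<cdot> hD (PO n \<one>) \<cdot> x (Suc n)"
    by (simp add: st.St_def op_at')
  finally show ?thesis by (simp flip: twisted_antipode_hat)
qed

lemma runit_tensor_inv:
  assumes [simp]: "X \<in> Obj B" "Z \<in> Obj B"
  shows "assoc B X Z \<one> \<cdot> inv_arr B (runit B (X \<otimes>\<^sub>o Z)) = Id B X \<otimes> inv_arr B (runit B Z)"
proof (rule iso_mono[of "Id B X \<otimes> runit B Z"])
  show "(Id B X \<otimes> runit B Z) \<cdot> assoc B X Z \<one> \<cdot> inv_arr B (runit B (X \<otimes>\<^sub>o Z))
      = (Id B X \<otimes> runit B Z) \<cdot> (Id B X \<otimes> inv_arr B (runit B Z))"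
    using comp_ext[OF runit_tensor[of X Z]] by (simp add: interchange)
qed simp_all

lemma snoc_Arr [simp]: "snoc B A n \<in> Arr B" "Dom B (snoc B A n) = PO n \<one> \<otimes>\<^sub>o A"
    "Cod B (snoc B A n) = A \<otimes>\<^sub>o PO n \<one>"
proof -
  have "snoc B A n \<in> Arr B \<and> Dom B (snoc B A n) = PO n \<one> \<otimes>\<^sub>o A \<and> Cod B (snoc B A n) = A \<otimes>\<^sub>o PO n \<one>"
    by (induction n) (auto simp: tensor_pow_PO)
  then show "snoc B A n \<in> Arr B" "Dom B (snoc B A n) = PO n \<one> \<otimes>\<^sub>o A" "Cod B (snoc B A n) = A \<otimes>\<^sub>o PO n \<one>"
    by auto
qed

text \<open>The constraints in \<open>snoc\<close> cancel against those that make room for \<sigma>,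
  so appending \<sigma> is insertion at position \<open>n\<close>, as in \<open>Tau\<close>.\<close>

lemma snoc_sigma: "snoc B A n \<cdot> (Id B (PO n \<one>) \<otimes> \<sigma>) \<cdot> inv_arr B (runit B (PO n \<one>)) = PA n (hs \<one>)"
proof (induction n)
  case 0
  have "inv_arr B (runit B A) \<cdot> \<sigma> = (\<sigma> \<otimes> Id B \<one>) \<cdot> inv_arr B (runit B \<one>)"
  proof (rule iso_mono[of "runit B A"])
    show "runit B A \<cdot> inv_arr B (runit B A) \<cdot> \<sigma> = runit B A \<cdot> (\<sigma> \<otimes> Id B \<one>) \<cdot> inv_arr B (runit B \<one>)"
      using comp_ext[OF runit_nat[of \<sigma>]] by simp
  qed simp_all
  then show ?case
    using lunit_nat_ext[of \<sigma> "inv_arr B (runit B \<one>)"] by (simp add: hat_def lunit_runit_unit)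
next
  case (Suc n)
  let ?P = "PO n \<one>"
  have "snoc B A (Suc n) \<cdot> (Id B (PO (Suc n) \<one>) \<otimes> \<sigma>) \<cdot> inv_arr B (runit B (PO (Suc n) \<one>))
      = (Id B A \<otimes> snoc B A n) \<cdot> (Id B A \<otimes> Id B ?P \<otimes> \<sigma>) \<cdot> (Id B A \<otimes> inv_arr B (runit B ?P))"
    by (simp add: tensor_pow_PO assoc_nat_right runit_tensor_inv)
  also have "\<dots> = Id B A \<otimes> PA n (hs \<one>)"
    by (simp add: merge flip: Suc)
  finally show ?case by simp
qed

lemma paracocyclic_Suc: "paracocyclic B H \<delta> \<sigma> (Suc n)
    = lam (Suc n) \<cdot> (twisted_antipode B H \<delta> \<otimes> Id B (PO (Suc n) \<one>)) \<cdot> PA (Suc n) (hs \<one>)"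
  using snoc_sigma[of n]
  by (simp add: tensor_pow_PO twisted_antipode_def interchange del: diag_action.simps)

lemma Tau_at:
  assumes [simp]: "x \<in> points"
  shows "st.Tau n 0 x (Suc n) = paracocyclic B H \<delta> \<sigma> (Suc n) \<cdot> x (Suc n)"
proof -
  have "sop (Suc n) x (Suc (Suc n)) = PA (Suc n) (hs \<one>) \<cdot> x (Suc n)"
    by (subst op_at') simp_all
  then show ?thesis
    using Pi_at[of "sop (Suc n) x" "Suc n"] 
    by (simp add: st.Tau_def paracocyclic_Suc twisted_antipode_def del: diag_action.simps paracocyclic.simps)
qed

lemma paracocyclic_Arr [simp]: "paracocyclic B H \<delta> \<sigma> (Suc n) \<in> Arr B"
    "Dom B (paracocyclic B H \<delta> \<sigma> (Suc n)) = PO (Suc n) \<one>"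
    "Cod B (paracocyclic B H \<delta> \<sigma> (Suc n)) = PO (Suc n) \<one>"
  using lam_Arr[of "Suc n"]
  by (simp_all add: paracocyclic_Suc twisted_antipode_def del: diag_action.simps paracocyclic.simps)

lemma Tau_points: "x \<in> points \<Longrightarrow> (st.Tau n i ^^ j) x \<in> points"
proof (induction j)
  case (Suc j)
  have "st.diag (Suc (Suc n)) (Suc n) (st.Pi (Suc n))"
  proof -
    have "st.diag (Suc (Suc n)) (Suc n) (\<lambda>i x. st.Lam (Suc n) i (st.St i x))"
      by (rule st.comp[OF st.pad[OF st.St_dg] st.Lam_dg]) auto
    then show ?thesis by (simp add: st.Pi_def[abs_def])
  qed
  with Suc show ?case by (simp add: st.Tau_def diag_points)
qed simp

lemma arr_pow_Arr [simp]:
  assumes "f \<in> Arr B" "Cod B f = Dom B f"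
  shows "arr_pow B f j \<in> Arr B" "Dom B (arr_pow B f j) = Dom B f" "Cod B (arr_pow B f j) = Dom B f"
proof -
  have "arr_pow B f j \<in> Arr B \<and> Dom B (arr_pow B f j) = Dom B f \<and> Cod B (arr_pow B f j) = Dom B f"
    by (induction j) (use assms in auto)
  then show "arr_pow B f j \<in> Arr B" "Dom B (arr_pow B f j) = Dom B f" "Cod B (arr_pow B f j) = Dom B f"
    by auto
qed

lemma Tau_pow_at:
  assumes [simp]: "x \<in> points"
  shows "(st.Tau n 0 ^^ j) x (Suc n) = arr_pow B (paracocyclic B H \<delta> \<sigma> (Suc n)) j \<cdot> x (Suc n)"
proof (induction j)
  case (Suc j)
  then show ?case
    by (simp add: Tau_at Tau_points del: paracocyclic.simps)
qed (simp del: paracocyclic.simps)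

text \<open>\<open>Tau_pow\<close> leaves \<theta> between the section and \<open>Pi\<close>.
  Naturality of \<theta> along \<open>?p\<close> moves it outside, where the section
  cancels.\<close>

lemma arr_pow_paracocyclic_point:
  assumes x [simp]: "x \<in> points"
  shows "arr_pow B (paracocyclic B H \<delta> \<sigma> (Suc n)) (n + 2) \<cdot> x (Suc n) = \<theta> (PO (Suc n) \<one>) \<cdot> x (Suc n)"
proof -
  let ?k = "Suc n"
  let ?p = "lam ?k \<cdot> (twisted_antipode B H \<delta> \<otimes> Id B (PO ?k \<one>))"
  let ?u = "Uop 0 x"
  have p: "?p \<in> hom B (PO (Suc ?k) \<one>) (PO ?k \<one>)"
    using lam_Arr[of ?k] by (simp add: hom_def twisted_antipode_def del: diag_action.simps)
  have u [simp]: "?u \<in> points" by simp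
  have Pi: "st.Pi ?k 0 y ?k = ?p \<cdot> y (Suc ?k)" if [simp]: "y \<in> points" for y
    using lam_Arr[of ?k] by (simp add: Pi_at twisted_antipode_def del: diag_action.simps)
  have "arr_pow B (paracocyclic B H \<delta> \<sigma> ?k) (n + 2) \<cdot> x ?k = st.Pi ?k 0 (st.Tw (n + 2) 0 ?u) ?k"
    by (simp only: st.Tau_pow flip: Tau_pow_at[OF x])
  also have "\<dots> = ?p \<cdot> st.Tw (Suc ?k) 0 ?u (Suc ?k)"
    using Pi[of "st.Tw (n + 2) 0 ?u"] Tw_points[of ?u "n + 2" 0] by simp
  also have "st.Tw (Suc ?k) 0 ?u (Suc ?k) = \<theta> (PO (Suc ?k) \<one>) \<cdot> ?u (Suc ?k)"
    using Tw_at[of ?u "Suc ?k" 0] by simp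
  also have "?p \<cdot> \<theta> (PO (Suc ?k) \<one>) \<cdot> ?u (Suc ?k) = (?p \<cdot> \<theta> (PO (Suc ?k) \<one>)) \<cdot> ?u (Suc ?k)"
    using homD(1-3)[OF p] by (intro comp_assoc'[symmetric]) simp_all
  also have "?p \<cdot> \<theta> (PO (Suc ?k) \<one>) = \<theta> (PO ?k \<one>) \<cdot> ?p"
    using twist_natural[OF p] by simp
  also have "(\<theta> (PO ?k \<one>) \<cdot> ?p) \<cdot> ?u (Suc ?k) = \<theta> (PO ?k \<one>) \<cdot> ?p \<cdot> ?u (Suc ?k)"
    using homD(1-3)[OF p] by (intro comp_assoc') simp_all
  also have "?p \<cdot> ?u (Suc ?k) = x ?k"
    using Pi[of ?u] by (simp add: st.Pi_U)
  finally show ?thesis .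
qed

primrec units :: "nat \<Rightarrow> 'm" where
  "units 0 = Id B \<one>"
| "units (Suc N) = PA N (hU \<one>) \<cdot> units N"

lemma units_Arr [simp]: "units N \<in> Arr B" "Dom B (units N) = \<one>" "Cod B (units N) = PO N \<one>"
proof -
  have "units N \<in> Arr B \<and> Dom B (units N) = \<one> \<and> Cod B (units N) = PO N \<one>"
    by (induction N) auto
  then show "units N \<in> Arr B" "Dom B (units N) = \<one>" "Cod B (units N) = PO N \<one>" by auto
qed

text \<open>Level \<open>N\<close> appends \<open>N\<close> units to the identity and truncates the
  last \<open>n\<close> strands. As \<open>e\<close> retracts the unit, the levels are compatible,
  and at level \<open>n\<close> exactly the units are removed.\<close>

lemma identity_point:
  assumes e: "e \<cdot> hU \<one> = Id B \<one>" and Y: "Y = PO n \<one>"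
  obtains x where "x \<in> points" and "x n = Id B (PO n \<one>)"
proof
  let ?x = "\<lambda>N. trunc n N \<cdot> PA n (units N)"
  have step: "PA N e \<cdot> units (Suc N) = units N" for N
  proof -
    have "PA N e \<cdot> units (Suc N) = PA N (e \<cdot> hU \<one>) \<cdot> units N"
      by (simp add: PA_comp)
    then show ?thesis by (simp add: e)
  qed
  have trunc_units: "trunc k 0 \<cdot> units k = Id B \<one>" for k
  proof (induction k)
    case (Suc k)
    have "trunc (Suc k) 0 \<cdot> units (Suc k) = trunc k 0 \<cdot> PA k e \<cdot> units (Suc k)"
      unfolding trunc_snoc by simp
    also have "\<dots> = trunc k 0 \<cdot> units k"
      by (simp only: step)
    finally show ?case by (simp only: Suc)
  qed simp
  have "PA N e \<cdot> ?x (Suc N) = ?x N" for N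
  proof -
    have "PA N e \<cdot> ?x (Suc N) = trunc (Suc n) N \<cdot> PA n (units (Suc N))"
      by (simp add: PO_commute)
    also have "\<dots> = trunc n N \<cdot> PA (n + N) e \<cdot> PA n (units (Suc N))"
      unfolding trunc_snoc by (simp add: PO_commute)
    also have "\<dots> = trunc n N \<cdot> PA n (PA N e \<cdot> units (Suc N))"
      by (simp add: PA_comp del: units.simps)
    finally show ?thesis by (simp only: step)
  qed
  moreover have "?x N \<in> hom B Y (PO N \<one>)" for N
    by (simp add: hom_def Y)
  ultimately show "?x \<in> points" unfolding points_def by blast
  have "?x n = PA n (trunc n 0 \<cdot> units n)"
    using trunc_PA[of n n 0] by (simp add: PA_comp)
  then show "?x n = Id B (PO n \<one>)" by (simp add: trunc_units)
qed

end

context twisted_modular_pair_in_involution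
begin

lemma arr_pow_paracocyclic:
  "arr_pow B (paracocyclic B H \<delta> \<sigma> n) (n + 1) = \<theta> (tensor_pow B (carr H) n)"
proof (cases n)
  case 0
  \<comment> \<open>\<open>Tau k\<close> covers only positive powers; here both sides are the
    identity of the unit object.\<close>
  then show ?thesis by (simp add: twist_unit)
next
  case (Suc k)
  \<comment> \<open>Source H^n, so that the identity can be a component of a point, and the counit
    to discard strands, as it retracts the unit.\<close>
  let ?Y = "tensor_pow B (carr H) n" and ?e = "lunit B \<one> \<cdot> (counit H \<otimes> Id B \<one>)"
  have [simp]: "carr H \<in> Obj B" by (rule alg_Obj)
  have "?Y \<in> Obj B" by (induction n) auto
  moreover have "?e \<in> hom B (carr H \<otimes>\<^sub>o \<one>) \<one>"
    using homD[OF counit_hom] by (simp add: hom_def)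
  ultimately interpret model: hopf_strand_model B \<theta> H \<delta> \<sigma> ?Y ?e
    by unfold_locales simp_all
  have "?e \<cdot> model.hU \<one> = Id B \<one>"
    using model.hat_pairing[OF _ _ _ _ _ _ _ counit_unit, of \<one>] by (simp add: model.hat_def)
  then obtain x where x: "x \<in> model.points" "x n = Id B (model.PO n \<one>)"
    by (rule model.identity_point[of n]) (simp_all add: model.tensor_pow_PO)
  from model.arr_pow_paracocyclic_point[OF x(1), of k] x(2) show ?thesis
    by (simp add: Suc model.tensor_pow_PO del: arr_pow.simps paracocyclic.simps)
qed

end

theorem corollary4:
  fixes B :: "('o, 'm) braided"
    and \<theta> :: "'o \<Rightarrow> 'm"
    and H :: "('o, 'm) hopf_data"
    and \<delta> \<sigma> :: 'm
    and n :: nat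
  assumes "braided_monoidal_category B"
    and "twist B \<theta>"
    and "hopf_algebra B H"
    and "twisted_modular_pair_in_involution B \<theta> H \<delta> \<sigma>"
  shows "arr_pow B (paracocyclic B H \<delta> \<sigma> n) (n + 1) = \<theta> (tensor_pow B (carr H) n)"
  using assms(4) by (rule twisted_modular_pair_in_involution.arr_pow_paracocyclic)


end
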